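(* Consider an intermittent system $(\mathbf A,\mathbf B,\mathbf C,\sigma,\sigma')$ with erasure probability $p_e$, where $\sigma<\infty$, $\sigma'>0$ and $(\mathbf A,\mathbf B)$ is controllable. Assume further that $(\mathbf A,\mathbf C)$ is observable and that $\mathbf A$ has no eigenvalue cycles, i.e. $\left(\frac{\lambda_i}{\lambda_j}\right)^n\neq1$ for all eigenvalues $\lambda_i\ne\lambda_j$ of $\mathbf A$ and all $n\in\mathbb N$, $n\geq 1$. Then the intermittent system is intermittent observable if and only if $p_e<\frac{1}{|\lambda_{max}|^2}$, where $\lambda_{max}$ is the largest magnitude eigenvalue of $\mathbf A$.
   Context: Intermittent system: for $n\in\mathbb Z_{\ge0}$, $\mathbf x[n+1]=\mathbf A\mathbf x[n]+\mathbf B\mathbf w[n]$ and $\mathbf y[n]=\beta[n](\mathbf C\mathbf x[n]+\mathbf v[n])$, with $\mathbf x[n]\in\mathbb C^m$, $\mathbf w[n]\in\mathbb C^g$, $\mathbf y[n],\mathbf v[n]\in\mathbb C^l$, $\mathbf A\in\mathbb C^{m\times m}$, $\mathbf B\in\mathbb C^{m\times g}$, $\mathbf C\in\mathbb C^{l\times m}$. The vectors $\mathbf x[0]$, $\mathbf w[n]$, $\mathbf v[n]$ ($n\ge0$) are jointly Gaussian, zero mean and independent; $\beta[n]$ are i.i.d. with $\mathbb P(\beta[n]=0)=p_e$, $\mathbb P(\beta[n]=1)=1-p_e$, independent of the rest. For all $n$: $\mathbb E[\mathbf x[0]\mathbf x[0]^\dagger]\preceq\sigma^2\mathbf I$, $\sigma'^2\mathbf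 I\preceq\mathbb E[\mathbf w[n]\mathbf w[n]^\dagger]\preceq\sigma^2\mathbf I$, $\sigma'^2\mathbf I\preceq\mathbb E[\mathbf v[n]\mathbf v[n]^\dagger]\preceq\sigma^2\mathbf I$. This is called the intermittent system $(\mathbf A,\mathbf B,\mathbf C,\sigma,\sigma')$ with erasure probability $p_e$. It is intermittent observable if there is a causal estimator $\widehat{\mathbf x}[n]$ (a function of $\mathbf y[0],\dots,\mathbf y[n]$) with $\sup_{n\ge 0}\mathbb E[(\mathbf x[n]-\widehat{\mathbf x}[n])^\dagger(\mathbf x[n]-\widehat{\mathbf x}[n])]<\infty$. Convention: $\frac10=\infty$ (and a ratio $\lambda_i/0$ with $\lambda_i\neq 0$ is $\infty$, no power of which equals $1$). *)

theory Defs
  imports "HOL-Probability.Probability"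
begin

section \<open>Complex matrices\<close>

(* The power A ^ k of the type class instance for vectors is componentwise, hence matpow. *)
primrec matpow :: "complex^'m^'m \<Rightarrow> nat \<Rightarrow> complex^'m^'m" where
  "matpow A 0 = mat 1"
| "matpow A (Suc k) = A ** matpow A k"

definition eigenvalue :: "complex^'m^'m \<Rightarrow> complex \<Rightarrow> bool" where
  "eigenvalue A z \<longleftrightarrow> (\<exists>u. u \<noteq> 0 \<and> A *v u = z *s u)"

(* The block matrix [B, AB, ..., A^(m-1) B] has rank m.  Its columns are the columns of its
   blocks; vec.dim is the dimension over the complex numbers. *)
definition controllable :: "complex^'m^'m \<Rightarrow> complex^'g^'m \<Rightarrow> bool" where
  "controllable A B \<longleftrightarrow>
     vec.dim (\<Union>k<CARD('m). columns (matpow A k ** B)) = CARD('m)"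

(* The block matrix [C; CA; ...; C A^(m-1)] has rank m. *)
definition observable :: "complex^'m^'m \<Rightarrow> complex^'m^'l \<Rightarrow> bool" where
  "observable A C \<longleftrightarrow>
     vec.dim (\<Union>k<CARD('m). rows (C ** matpow A k)) = CARD('m)"

(* A ratio with denominator 0 has the value 0 in HOL instead of infinity; its positive powers
   differ from 1 under either convention. *)
definition no_eigenvalue_cycles :: "complex^'m^'m \<Rightarrow> bool" where
  "no_eigenvalue_cycles A \<longleftrightarrow>
     (\<forall>z\<^sub>1 z\<^sub>2. eigenvalue A z\<^sub>1 \<longrightarrow> eigenvalue A z\<^sub>2 \<longrightarrow> z\<^sub>1 \<noteq> z\<^sub>2 \<longrightarrow> (\<forall>n\<ge>1. (z\<^sub>1 / z\<^sub>2) ^ n \<noteq> 1))"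

definition hermitian :: "complex^'n^'n \<Rightarrow> bool" where
  "hermitian P \<longleftrightarrow> (\<forall>i j. P $ j $ i = cnj (P $ i $ j))"

definition hdot :: "complex^'n \<Rightarrow> complex^'n \<Rightarrow> complex" where
  "hdot u v = (\<Sum>i\<in>UNIV. cnj (u $ i) * v $ i)"

definition psd :: "complex^'n^'n \<Rightarrow> bool" where
  "psd P \<longleftrightarrow> hermitian P \<and> (\<forall>u. 0 \<le> Re (hdot u (P *v u)))"

definition loewner_le :: "complex^'n^'n \<Rightarrow> complex^'n^'n \<Rightarrow> bool" (infix \<open>\<preceq>\<close> 50) where
  "P \<preceq> Q \<longleftrightarrow> psd (Q - P)"

section \<open>Gaussian random variables\<close>

(* Constants count as (degenerate) Gaussian variables. *)
definition (in prob_space) gaussian :: "('a \<Rightarrow> real) \<Rightarrow> bool" where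
  "gaussian X \<longleftrightarrow> (\<exists>\<mu>. AE \<omega> in M. X \<omega> = \<mu>) \<or>
     (\<exists>\<mu> s. s > 0 \<and> distributed M lborel X (normal_density \<mu> s))"

(* E[X X\<^sup>\<dagger>] *)
definition (in prob_space) second_moment :: "('a \<Rightarrow> complex^'n) \<Rightarrow> complex^'n^'n" where
  "second_moment X = (\<chi> i j. expectation (\<lambda>\<omega>. X \<omega> $ i * cnj (X \<omega> $ j)))"

section \<open>Intermittent systems\<close>

datatype source = Initial | Process nat | Measurement nat | Channel nat

(* In jointly_gaussian, the inner product is the real one: a \<bullet> z is the real part of a\<^sup>\<dagger> z.  So all
   finite real linear combinations of the real and imaginary parts of the entries of x 0, w n, v n
   are required to be Gaussian; no circular symmetry is imposed.

   In independent, all sources are mutually independent; indep_vars does not apply directly as the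
   variables differ in type. *)
locale intermittent_system = prob_space M
  for M :: "'a measure" +
  fixes A :: "complex^'m^'m" and B :: "complex^'g^'m" and C :: "complex^'m^'l"
    and \<sigma> \<sigma>' p\<^sub>e :: real
    and x :: "nat \<Rightarrow> 'a \<Rightarrow> complex^'m" and w :: "nat \<Rightarrow> 'a \<Rightarrow> complex^'g"
    and v :: "nat \<Rightarrow> 'a \<Rightarrow> complex^'l" and \<beta> :: "nat \<Rightarrow> 'a \<Rightarrow> real"
    and y :: "nat \<Rightarrow> 'a \<Rightarrow> complex^'l"
  assumes state: "\<And>n \<omega>. \<omega> \<in> space M \<Longrightarrow> x (Suc n) \<omega> = A *v x n \<omega> + B *v w n \<omega>"
    and observation: "\<And>n \<omega>. \<omega> \<in> space M \<Longrightarrow> y n \<omega> = \<beta> n \<omega> *\<^sub>R (C *v x n \<omega> + v n \<omega>)"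
    and measurable_x0: "x 0 \<in> borel_measurable M"
    and measurable_w: "\<And>n. w n \<in> borel_measurable M"
    and measurable_v: "\<And>n. v n \<in> borel_measurable M"
    and measurable_\<beta>: "\<And>n. \<beta> n \<in> borel_measurable M"
    and jointly_gaussian:
      "\<And>a b c N. gaussian (\<lambda>\<omega>. a \<bullet> x 0 \<omega> + (\<Sum>n<N. b n \<bullet> w n \<omega> + c n \<bullet> v n \<omega>))"
    and mean_x0: "expectation (x 0) = 0"
    and mean_w: "\<And>n. expectation (w n) = 0"
    and mean_v: "\<And>n. expectation (v n) = 0"
    and independent:
      "indep_sets (\<lambda>s. case s of
           Initial \<Rightarrow> sets (vimage_algebra (space M) (x 0) borel)
         | Process n \<Rightarrow> sets (vimage_algebra (space M) (w n) borel)
         | Measurement n \<Rightarrow> sets (vimage_algebra (space M) (v n) borel)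
         | Channel n \<Rightarrow> sets (vimage_algebra (space M) (\<beta> n) borel)) UNIV"
    and erased: "\<And>n. prob {\<omega> \<in> space M. \<beta> n \<omega> = 0} = p\<^sub>e"
    and received: "\<And>n. prob {\<omega> \<in> space M. \<beta> n \<omega> = 1} = 1 - p\<^sub>e"
    and moment_x0: "second_moment (x 0) \<preceq> mat (complex_of_real (\<sigma>\<^sup>2))"
    and moment_w_lower: "\<And>n. mat (complex_of_real (\<sigma>'\<^sup>2)) \<preceq> second_moment (w n)"
    and moment_w_upper: "\<And>n. second_moment (w n) \<preceq> mat (complex_of_real (\<sigma>\<^sup>2))"
    and moment_v_lower: "\<And>n. mat (complex_of_real (\<sigma>'\<^sup>2)) \<preceq> second_moment (v n)"
    and moment_v_upper: "\<And>n. second_moment (v n) \<preceq> mat (complex_of_real (\<sigma>\<^sup>2))"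

(* The estimate of x n is h n (y 0, ..., y n).  The squared norm of e is e\<^sup>\<dagger> e; the
   expectation is a Lebesgue integral with values in [0, \<infinity>], so that an error without finite
   second moment counts as infinite. *)
definition intermittent_observable ::
    "'a measure \<Rightarrow> (nat \<Rightarrow> 'a \<Rightarrow> complex^'m) \<Rightarrow> (nat \<Rightarrow> 'a \<Rightarrow> complex^'l) \<Rightarrow> bool" where
  "intermittent_observable M x y \<longleftrightarrow>
     (\<exists>h :: nat \<Rightarrow> (nat \<Rightarrow> complex^'l) \<Rightarrow> complex^'m.
        (\<forall>n. h n \<in> borel_measurable (PiM {..n} (\<lambda>_. borel))) \<and>
        (SUP n. \<integral>\<^sup>+\<omega>. ennreal ((norm (x n \<omega> - h n (\<lambda>i\<in>{..n}. y i \<omega>)))\<^sup>2) \<partial>M) < \<infinity>)"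

end

theory Submission
  imports Defs "HOL-Computational_Algebra.Fundamental_Theorem_Algebra"
begin

text \<open>Necessity: let \<open>u\<^sup>\<dagger> A = z u\<^sup>\<dagger>\<close>. If the last \<open>n - i\<close> observations are erased, then the estimate of
  \<open>x n\<close> is independent of \<open>w i\<close>, so the estimation error of \<open>u\<^sup>\<dagger> x n\<close> contains the whole term
  \<open>z ^ (n - 1 - i) u\<^sup>\<dagger> B w i\<close>. These terms, restricted to the erasure events, are orthogonal for distinct \<open>i\<close>,
  and by Bessel's inequality the error is at least a constant times the sum of the
  \<open>(p |z|\<^sup>2) ^ (n - 1 - i)\<close>.

  Sufficiency: go back from time \<open>n\<close> until the received observations have density at least \<open>1/N\<close> in the
  window. By a Chernoff bound the window is longer than \<open>k\<close> with probability at most about \<open>p\<^sup>k\<close>. A dense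
  set of times contains a Hilbert cube of dimension \<open>m\<close> with bounded generators. The absence of eigenvalue cycles makes
  every eigenvector of \<open>A\<^sup>d\<close> for a nonzero eigenvalue an eigenvector of \<open>A\<close>; hence observability shows that each
  generator of the cube lowers the dimension of the subspace that is invisible at the times of the
  cube. So the state at the cube can be estimated up to a bounded error, which grows by a factor of about
  \<open>|z|\<^sup>k\<close> until time \<open>n\<close>.\<close>

section \<open>Powers of matrices and eigenvalues\<close>

text \<open>Three obstacles shape the sufficiency part. The eigenvalue 0 is out of reach of the
  argument on powers of \<open>A\<close>, since a nilpotent block has powers with too many
  eigenvectors. The kernels of the powers stabilize at some exponent n, and \<open>A\<close> is
  injective on the range of its n-th power; so the state is reconstructed from n steps before the
  cube. Next, the error constant must not depend on the erasure pattern: as the generators are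
  bounded, there are only finitely many cubes up to translation. Finally, an estimator sees
  \<open>y\<close> but not \<open>\<beta>\<close>; a received observation has a nondegenerate
  Gaussian component, so it is almost surely nonzero, and the nonzero entries of \<open>y\<close>
  reveal the pattern. The strict inequality in the condition pays for three losses: the polynomial
  factors of Jordan blocks, the accumulation of noise over the window, and the rate of the Chernoff
  bound, which exceeds the erasure probability.\<close>

lemma matpow_add: "matpow A (i + j) = matpow A i ** matpow A j"
  by (induction i) (simp_all add: matrix_mul_assoc)

lemma matpow_add_vec: "matpow A (i + j) *v u = matpow A i *v (matpow A j *v u)"
  by (simp add: matpow_add matrix_vector_mul_assoc)

lemma matpow_Suc_vec: "matpow A (Suc i) *v u = matpow A i *v (A *v u)"
  using matpow_add_vec[of A i 1 u] by simp

lemma matpow_commute: "A *v (matpow A i *v u) = matpow A i *v (A *v u)"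
  using matpow_Suc_vec[of A i u] by (simp add: matrix_vector_mul_assoc)

lemma eigenvalue_matpow: "A *v u = a *s u \<Longrightarrow> matpow A k *v u = a ^ k *s u"
  by (induction k) (simp_all add: matrix_vector_mul_assoc[symmetric] vec.scale mult.commute)

text \<open>The vector p(A) u. The type class product on \<open>complex^'m^'m\<close> is
  componentwise, so evaluation by \<open>poly\<close> would not give the matrix polynomial.\<close>

definition matpoly :: "complex^'m^'m \<Rightarrow> complex poly \<Rightarrow> complex^'m \<Rightarrow> complex^'m" where
  "matpoly A p u = (\<Sum>i\<le>degree p. coeff p i *s (matpow A i *v u))"

lemma matpoly_eq_sum:
  assumes "degree p \<le> n"
  shows "matpoly A p u = (\<Sum>i\<le>n. coeff p i *s (matpow A i *v u))"
  unfolding matpoly_def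
  by (rule sum.mono_neutral_left) (use assms in \<open>auto simp: coeff_eq_0\<close>)

text \<open>Peeling off a root trades one degree of an annihilating polynomial for one application
  of \<open>A - a\<close> to the vector; this drives the induction below.\<close>

lemma matpoly_linear_factor:
  "matpoly A ([:- a, 1:] * q) u = matpoly A q (A *v u - a *s u)"
proof -
  define n where "n = Suc (degree q)"
  have "degree ([:- a, 1:] * q) \<le> n"
    using degree_mult_le[of "[:- a, 1:]" q] by (simp add: n_def)
  then have "matpoly A ([:- a, 1:] * q) u
      = (\<Sum>i\<le>n. coeff ([:- a, 1:] * q) i *s (matpow A i *v u))"
    by (rule matpoly_eq_sum)
  also have "\<dots> = (\<Sum>i\<le>n. coeff (pCons 0 q) i *s (matpow A i *v u))
      - a *s (\<Sum>i\<le>n. coeff q i *s (matpow A i *v u))"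
    by (simp add: vec.scale_left_diff_distrib vec.scale_sum_right sum_subtractf[symmetric] vec.scale_left_distrib vec.scale_minus_left sum.distrib sum_negf)
  also have "(\<Sum>i\<le>n. coeff (pCons 0 q) i *s (matpow A i *v u))
      = (\<Sum>i\<le>degree q. coeff q i *s (matpow A (Suc i) *v u))"
    unfolding n_def by (subst sum.atMost_Suc_shift) simp
  also have "(\<Sum>i\<le>n. coeff q i *s (matpow A i *v u)) = matpoly A q u"
    by (rule matpoly_eq_sum[symmetric]) (simp add: n_def)
  finally show ?thesis
    unfolding matpoly_def
    by (simp del: matpow.simps add: matpow_Suc_vec vec.scale_sum_right
        vec.diff vec.scale vec.scale_right_diff_distrib sum_subtractf mult.commute)
qed

lemma matpoly_commute: "A *v matpoly A q u = matpoly A q (A *v u)"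
  by (simp add: matpoly_def vec.sum vec.scale matpow_commute)

lemma matpoly_diff: "matpoly A q (u - t) = matpoly A q u - matpoly A q t"
  by (simp add: matpoly_def vec.diff vec.scale_right_diff_distrib sum_subtractf)

lemma matpoly_scale: "matpoly A q (a *s u) = a *s matpoly A q u"
  by (simp add: matpoly_def vec.scale vec.scale_sum_right mult.commute)

lemma exists_annihilating_matpoly:
  fixes A :: "complex^'m^'m"
  shows "\<exists>p. p \<noteq> 0 \<and> matpoly A p u = 0"
proof -
  define m where "m = CARD('m)"
  define f where "f i = matpow A i *v u" for i
  show ?thesis
  \<comment> \<open>There are m + 1 iterates in dimension m. Since \<open>vec.dependent\<close> is a
    property of sets, a repetition among them is treated separately; there a difference of two
    monomials annihilates \<open>u\<close>.\<close>
  proof (cases "inj_on f {..m}")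
    case False
    then obtain i j where ij: "i < j" "f i = f j"
      by (auto simp: inj_on_def) (metis linorder_neqE_nat)
    define p where "p = monom (1::complex) j - monom 1 i"
    have "coeff p j = 1" using ij by (simp add: p_def)
    then have "p \<noteq> 0" by auto
    have "degree p \<le> j" unfolding p_def
      using ij by (intro degree_diff_le) (auto intro: order_trans[OF degree_monom_le])
    then have "matpoly A p u = (\<Sum>t\<le>j. coeff p t *s f t)"
      unfolding f_def by (rule matpoly_eq_sum)
    also have "\<dots> = (\<Sum>t\<le>j. (if j = t then f t else 0)) - (\<Sum>t\<le>j. (if i = t then f t else 0))"
      unfolding sum_subtractf[symmetric]
      by (rule sum.cong) (auto simp: p_def vec.scale_left_diff_distrib)
    also have "\<dots> = 0" using ij by simp
    finally show ?thesis using \<open>p \<noteq> 0\<close> by blast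
  next
    case True
    have "vec.dependent (f ` {..m})"
    proof (rule ccontr)
      assume "\<not> vec.dependent (f ` {..m})"
      then have "card (f ` {..m}) \<le> m"
        using vec.independent_card_le_dim[of "f ` {..m}" UNIV] by (simp add: card_cart_basis m_def)
      then show False using True by (simp add: card_image)
    qed
    then obtain c where c: "\<exists>v\<in>f ` {..m}. c v \<noteq> 0" "(\<Sum>v\<in>f ` {..m}. c v *s v) = 0"
      by (auto simp: vec.dependent_finite)
    define p where "p = Poly (map (\<lambda>i. c (f i)) [0..<Suc m])"
    have coeff_p: "coeff p i = (if i \<le> m then c (f i) else 0)" for i
      by (auto simp: p_def nth_default_def simp del: upt_Suc)
    have "p \<noteq> 0" using c(1) coeff_p by (metis atMost_iff coeff_0 imageE)
    have "degree p \<le> m" by (rule degree_le) (simp add: coeff_p)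
    then have "matpoly A p u = (\<Sum>i\<le>m. coeff p i *s f i)"
      unfolding f_def by (rule matpoly_eq_sum)
    also have "\<dots> = (\<Sum>v\<in>f ` {..m}. c v *s v)"
      using True by (simp add: sum.reindex coeff_p)
    finally show ?thesis using \<open>p \<noteq> 0\<close> c by auto
  qed
qed

text \<open>Over the complex numbers an annihilating polynomial of \<open>u\<close> splits, so
  finitely many factors \<open>A - z\<close> lead from \<open>u\<close> to 0. This induction
  replaces the Jordan normal form throughout.\<close>

lemma eigenvalue_induct [case_names zero step]:
  assumes zero: "P 0"
    and step: "\<And>u z. eigenvalue A z \<Longrightarrow> P (A *v u - z *s u) \<Longrightarrow> P u"
  shows "P u"
proof -
  obtain p where p: "p \<noteq> 0" "matpoly A p u = 0"
    using exists_annihilating_matpoly by blast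
  from p show ?thesis
  proof (induction "degree p" arbitrary: p u)
    case 0
    then obtain a where "p = [:a:]" by (metis degree_eq_zeroE)
    with 0 have "u = 0" by (simp add: matpoly_def vec.scale_eq_0_iff)
    then show ?case using zero by simp
  next
    case (Suc d)
    have "\<not> constant (poly p)" using Suc.hyps(2) by (metis constant_degree Zero_not_Suc)
    then obtain a where "poly p a = 0" using fundamental_theorem_of_algebra by blast
    then obtain q where q: "p = [:- a, 1:] * q" by (metis dvdE poly_eq_0_iff_dvd)
    have "q \<noteq> 0" using q \<open>p \<noteq> 0\<close> by auto
    moreover have "degree p = degree q + 1"
      using \<open>q \<noteq> 0\<close> unfolding q by (subst degree_mult_eq) auto
    ultimately have d: "d = degree q" "q \<noteq> 0" using Suc.hyps(2) by simp_all
    show ?case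
    proof (cases "eigenvalue A a")
      case True
      then show ?thesis
        using Suc.hyps(1)[OF d] Suc.prems(2) step unfolding q matpoly_linear_factor by blast
    next
      \<comment> \<open>Now \<open>A - a\<close> is injective, so the factor can be cancelled from
        the polynomial while the vector stays the same.\<close>
      case False
      have "A *v matpoly A q u = a *s matpoly A q u"
        using Suc.prems(2) unfolding q matpoly_linear_factor
        by (simp add: matpoly_diff matpoly_scale matpoly_commute)
      then have "matpoly A q u = 0" using False by (auto simp: eigenvalue_def)
      then show ?thesis using Suc.hyps(1)[OF d] by blast
    qed
  qed
qed

text \<open>The vectors met by the induction stay in \<open>V\<close>, and the last nonzero one is
  an eigenvector.\<close>

lemma invariant_subspace_eigenvector:
  fixes A :: "complex^'m^'m"
  assumes V: "vec.subspace V" "\<And>u. u \<in> V \<Longrightarrow> A *v u \<in> V" and "u \<in> V" "u \<noteq> 0"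
  shows "\<exists>z u. u \<in> V \<and> u \<noteq> 0 \<and> A *v u = z *s u"
proof -
  have "u \<in> V \<longrightarrow> u \<noteq> 0 \<longrightarrow> (\<exists>z u. u \<in> V \<and> u \<noteq> 0 \<and> A *v u = z *s u)" for u
  proof (induction u rule: eigenvalue_induct[where A = A])
    case zero
    show ?case by simp
  next
    case (step u z)
    show ?case
    proof (cases "A *v u - z *s u = 0")
      case True
      then show ?thesis by auto
    next
      case False
      then show ?thesis using step V by (auto intro: vec.subspace_diff vec.subspace_scale)
    qed
  qed
  then show ?thesis using assms by blast
qed

section \<open>Growth of matrix powers\<close>

lemma norm_scale_vec: "norm (a *s (u::complex^'m)) = cmod a * norm u"
  by (simp add: norm_vec_def L2_set_def norm_mult power_mult_distrib sum_distrib_left[symmetric] real_sqrt_mult)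

text \<open>Passing from k to k + 1 multiplies the norm by at most \<open>cmod z\<close> and adds a
  term of order r^k from the induction. The gap between \<open>cmod z\<close> and \<open>r\<close>
  absorbs the polynomial factors of Jordan blocks.\<close>

lemma matpow_bound_vec:
  assumes "\<And>z. eigenvalue A z \<Longrightarrow> cmod z < r"
  shows "\<exists>c\<ge>0. \<forall>k. norm (matpow A k *v u) \<le> c * r ^ k"
proof (induction u rule: eigenvalue_induct[where A = A])
  case zero
  show ?case by (rule exI[of _ 0]) simp
next
  case (step u z)
  from assms[OF step(1)] have r: "cmod z < r" .
  then have "r > 0" using norm_ge_zero[of z] by linarith
  obtain c where c: "c \<ge> 0" "\<And>k. norm (matpow A k *v (A *v u - z *s u)) \<le> c * r ^ k"
    using step by blast
  \<comment> \<open>The second argument is the fixed point of the recursion: it gives cmod z * c' +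
    c \<le> r * c'. The first covers k = 0.\<close>
  define c' where "c' = max (norm u) (c / (r - cmod z))"
  have c': "norm u \<le> c'" "c \<le> c' * (r - cmod z)" "c' \<ge> 0"
    using r c(1) by (auto simp: c'_def pos_divide_le_eq[symmetric] le_max_iff_disj)
  have "norm (matpow A k *v u) \<le> c' * r ^ k" for k
  proof (induction k)
    case 0
    then show ?case using c' by simp
  next
    case (Suc k)
    have "matpow A (Suc k) *v u = z *s (matpow A k *v u) + matpow A k *v (A *v u - z *s u)"
      by (simp del: matpow.simps add: matpow_Suc_vec vec.diff vec.scale)
    also have "norm \<dots> \<le> cmod z * norm (matpow A k *v u) + c * r ^ k"
      using c(2)[of k] by (intro order_trans[OF norm_triangle_ineq] add_mono) (simp_all add: norm_scale_vec)
    also have "\<dots> \<le> cmod z * (c' * r ^ k) + (c' * (r - cmod z)) * r ^ k"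
      using Suc c' \<open>r > 0\<close> by (intro add_mono mult_left_mono mult_right_mono) auto
    also have "\<dots> = c' * r ^ Suc k" by (simp add: algebra_simps)
    finally show ?case .
  qed
  then show ?case using c' by blast
qed

lemma vec_eq_sum_axis: "u = (\<Sum>i\<in>UNIV. (u $ i) *s axis i (1::complex))"
  by (simp add: vec_eq_iff axis_def if_distrib cong: if_cong)

lemma matpow_bound:
  fixes A :: "complex^'m^'m"
  assumes "\<And>z. eigenvalue A z \<Longrightarrow> cmod z < r"
  shows "\<exists>c\<ge>0. \<forall>k u. norm (matpow A k *v u) \<le> c * r ^ k * norm u"
proof -
  have "\<forall>i. \<exists>c\<ge>0. \<forall>k. norm (matpow A k *v axis i 1) \<le> c * r ^ k"
    using matpow_bound_vec[of A r] assms by blast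
  then obtain c where c: "\<And>i. c i \<ge> 0" "\<And>i k. norm (matpow A k *v axis i 1) \<le> c i * r ^ k"
    by metis
  have "norm (matpow A k *v u) \<le> (\<Sum>i\<in>UNIV. c i) * r ^ k * norm u" for k u
  proof -
    have "matpow A k *v u = (\<Sum>i\<in>UNIV. (u $ i) *s (matpow A k *v axis i 1))"
      by (subst vec_eq_sum_axis[of u]) (simp add: vec.sum vec.scale)
    also have "norm \<dots> \<le> (\<Sum>i\<in>UNIV. norm u * (c i * r ^ k))"
      by (intro sum_norm_le) (auto simp: norm_scale_vec intro!: mult_mono c Finite_Cartesian_Product.norm_nth_le)
    finally show ?thesis by (simp add: sum_distrib_left sum_distrib_right mult_ac)
  qed
  then show ?thesis using c(1) by (intro exI[of _ "\<Sum>i\<in>UNIV. c i"]) (auto intro: sum_nonneg)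
qed

lemma matrix_bound: "\<exists>c\<ge>0. \<forall>u. norm ((D::complex^'m^'l) *v u) \<le> c * norm u"
proof -
  have "bounded_linear ((*v) D)" by (rule matrix_vector_mul_bounded_linear)
  then obtain c where "\<And>u. norm (D *v u) \<le> norm u * c" "c > 0"
    using bounded_linear.pos_bounded by blast
  then show ?thesis by (intro exI[of _ c]) (auto simp: mult.commute)
qed

text \<open>The kernels increase with bounded dimension, so one of maximal dimension is final.
  Consequently every power of \<open>A\<close> is injective on the range of
  \<open>matpow A n\<close>, which is how the eigenvalue 0 is avoided later.\<close>

lemma matpow_kernel_stabilizes:
  fixes A :: "complex^'m^'m"
  shows "\<exists>n. \<forall>k u. matpow A (k + n) *v u = 0 \<longrightarrow> matpow A n *v u = 0"
proof -
  define K where "K n = {u. matpow A n *v u = 0}" for n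
  have sub: "vec.subspace (K n)" for n
    by (auto simp: K_def vec.subspace_def vec.add vec.scale)
  have mono: "K n \<subseteq> K (k + n)" for n k
    by (auto simp: K_def matpow_add_vec)
  have "\<exists>n. \<forall>k. vec.dim (K k) \<le> vec.dim (K n)"
    by (rule ex_has_greatest_nat[where b = "Suc CARD('m)" and P = "\<lambda>_. True" and k = 0, simplified])
      (simp add: dim_subset_UNIV_cart_gen less_Suc_eq_le)
  then obtain n where n: "\<And>k. vec.dim (K k) \<le> vec.dim (K n)" by blast
  have "K n = K (k + n)" for k
    by (rule vec.subspace_dim_equal[OF sub sub mono n])
  then show ?thesis unfolding K_def by blast
qed

text \<open>A map that vanishes on the common kernel factors through the joint map. Later the
  \<open>F i\<close> are noise-free observations at the times of a cube, and the
  \<open>\<Psi> i\<close> are the coefficients of a linear estimator.\<close>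

lemma matrix_factor_family:
  fixes F :: "'i \<Rightarrow> complex^'m^'l" and D :: "complex^'m^'n"
  assumes "finite I" and "\<And>u. (\<forall>i\<in>I. F i *v u = 0) \<Longrightarrow> D *v u = 0"
  shows "\<exists>\<Psi> :: 'i \<Rightarrow> complex^'l^'n. \<forall>u. D *v u = (\<Sum>i\<in>I. \<Psi> i *v (F i *v u))"
  using assms
proof (induction I arbitrary: F D rule: finite_induct)
  case empty
  then show ?case by simp
next
  case (insert j I)
  obtain h where h: "Vector_Spaces.linear (*s) (*s) h" "\<And>u. F j *v h (F j *v u) = F j *v u"
    using vec.linear_exists_right_inverse_on[OF matrix_vector_mul_linear_gen[of "F j"] vec.subspace_UNIV]
    by auto
  \<comment> \<open>\<open>H\<close> is a generalized inverse of \<open>F j\<close>, so \<open>E\<close> projects onto the kernel of \<open>F j\<close>.\<close>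
  define H where "H = matrix h"
  have H: "F j *v (H *v (F j *v u)) = F j *v u" for u
    unfolding H_def matrix_works[OF h(1)] by (rule h(2))
  define E where "E = mat 1 - H ** F j"
  have E: "E *v u = u - H *v (F j *v u)" for u
    by (simp add: E_def matrix_vector_mult_diff_rdistrib matrix_vector_mul_assoc)
  have "F j *v (E *v u) = 0" for u by (simp add: E vec.diff H)
  then have "(D ** E) *v u = 0" if "\<forall>i\<in>I. (F i ** E) *v u = 0" for u
    using that insert.prems[of "E *v u"] by (simp add: matrix_vector_mul_assoc[symmetric])
  from insert.IH[where F = "\<lambda>i. F i ** E" and D = "D ** E", OF this]
  obtain \<Psi> where \<Psi>: "\<And>u. D *v (E *v u) = (\<Sum>i\<in>I. \<Psi> i *v (F i *v (E *v u)))"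
    by (auto simp: matrix_vector_mul_assoc[symmetric])
  \<comment> \<open>Expanding \<open>E\<close> in the sum over \<open>I\<close> produces further
    terms in \<open>F j *v u\<close>; the coefficient at \<open>j\<close> collects them together
    with \<open>D ** H\<close>.\<close>
  define \<Psi>' where "\<Psi>' i = (if i = j then D ** H - (\<Sum>i\<in>I. \<Psi> i ** F i ** H) else \<Psi> i)" for i
  have sum_vec: "(\<Sum>i\<in>I. G i) *v t = (\<Sum>i\<in>I. G i *v t)" for G :: "'i \<Rightarrow> complex^'l^'n" and t
    using insert.hyps(1) by (induction I rule: finite_induct) (auto simp: matrix_vector_mult_add_rdistrib)
  have "D *v u = (\<Sum>i\<in>insert j I. \<Psi>' i *v (F i *v u))" for u
  proof -
    have "D *v u = D *v (H *v (F j *v u)) + D *v (E *v u)"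
      by (simp add: E vec.diff)
    also have "D *v (E *v u) = (\<Sum>i\<in>I. \<Psi> i *v (F i *v u)) - (\<Sum>i\<in>I. \<Psi> i ** F i ** H) *v (F j *v u)"
      unfolding \<Psi> by (simp add: E vec.diff sum_subtractf sum_vec matrix_vector_mul_assoc[symmetric])
    also have "(\<Sum>i\<in>I. \<Psi> i *v (F i *v u)) = (\<Sum>i\<in>I. \<Psi>' i *v (F i *v u))"
      using insert.hyps(2) by (intro sum.cong) (auto simp: \<Psi>'_def)
    finally show ?thesis
      using insert.hyps
      by (simp add: \<Psi>'_def matrix_vector_mult_diff_rdistrib matrix_vector_mul_assoc[symmetric] del: vec.sum)
  qed
  then show ?case by blast
qed

section \<open>Observation times containing a cube\<close>

text \<open>Every eigenvalue of \<open>A\<close> on the eigenspace \<open>W\<close> is a d-th root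
  of \<mu>, so without cycles there is just one. A Jordan block for it is impossible too, as its
  d-th power would have the nonzero entry d z^(d-1) off the diagonal, whereas the d-th power of
  \<open>A\<close> is scalar on \<open>W\<close>.\<close>

lemma eigenvector_of_matpow:
  fixes A :: "complex^'m^'m"
  assumes cycles: "no_eigenvalue_cycles A" and "d \<ge> 1"
    and u: "matpow A d *v u = \<mu> *s u" "\<mu> \<noteq> 0" "u \<noteq> 0"
  shows "\<exists>z. A *v u = z *s u"
proof -
  define W where "W = {t. matpow A d *v t = \<mu> *s t}"
  have W: "vec.subspace W"
    by (auto simp: W_def vec.subspace_def vec.add vec.scale vec.scale_right_distrib mult.commute)
  have inv: "A *v t \<in> W" if "t \<in> W" for t
    using that by (simp add: W_def matpow_commute[symmetric] vec.scale)
  have power: "z ^ d = \<mu>" if "t \<in> W" "t \<noteq> 0" "A *v t = z *s t" for z t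
    using that eigenvalue_matpow[OF that(3), of d] by (simp add: W_def)
  obtain z t where t: "t \<in> W" "t \<noteq> 0" "A *v t = z *s t"
    using invariant_subspace_eigenvector[OF W inv, of u] u by (auto simp: W_def)
  have "z \<noteq> 0" using power[OF t] u(2) \<open>d \<ge> 1\<close> by (auto simp: power_0_left)
  have "A *v u - z *s u = 0"
  proof (rule ccontr)
    assume nz: "A *v u - z *s u \<noteq> 0"
    \<comment> \<open>Then \<open>A - z\<close> maps \<open>W\<close> onto a nonzero invariant subspace. Its eigenvectors have eigenvalue \<open>z\<close> as well,
      so \<open>A\<^sup>d\<close> has a nontrivial Jordan block on its own eigenspace \<open>W\<close>.\<close>
    define V where "V = (\<lambda>t. A *v t - z *s t) ` W"
    have "vec.subspace V"
      unfolding V_def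
    proof (rule vec.subspaceI)
      show "0 \<in> (\<lambda>t. A *v t - z *s t) ` W"
        using vec.subspace_0[OF W] by (intro image_eqI[of _ _ 0]) auto
    next
      fix a b assume "a \<in> (\<lambda>t. A *v t - z *s t) ` W" "b \<in> (\<lambda>t. A *v t - z *s t) ` W"
      then obtain a' b' where "a' \<in> W" "b' \<in> W" "a = A *v a' - z *s a'" "b = A *v b' - z *s b'"
        by auto
      then show "a + b \<in> (\<lambda>t. A *v t - z *s t) ` W"
        by (intro image_eqI[of _ _ "a' + b'"])
          (auto simp: vec.add vec.scale_right_distrib vec.subspace_add[OF W])
    next
      fix c a assume "a \<in> (\<lambda>t. A *v t - z *s t) ` W"
      then obtain a' where "a' \<in> W" "a = A *v a' - z *s a'" by auto
      then show "c *s a \<in> (\<lambda>t. A *v t - z *s t) ` W"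
        by (intro image_eqI[of _ _ "c *s a'"])
          (auto simp: vec.scale vec.scale_right_diff_distrib mult.commute vec.subspace_scale[OF W])
    qed
    moreover have "A *v s \<in> V" if "s \<in> V" for s
      using that inv unfolding V_def by (force simp: vec.diff vec.scale)
    moreover have "A *v u - z *s u \<in> V" using u by (auto simp: V_def W_def)
    ultimately obtain z' s where s: "s \<in> V" "s \<noteq> 0" "A *v s = z' *s s"
      using invariant_subspace_eigenvector[of V A] nz by blast
    then obtain t' where t': "t' \<in> W" "s = A *v t' - z *s t'" by (auto simp: V_def)
    then have "s \<in> W" using inv W by (auto intro: vec.subspace_diff vec.subspace_scale)
    have "z' ^ d = z ^ d" using power t s \<open>s \<in> W\<close> by metis
    moreover have "eigenvalue A z" "eigenvalue A z'" using t s by (auto simp: eigenvalue_def)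
    moreover have "(z / z') ^ d = 1"
      using calculation(1) \<open>z \<noteq> 0\<close> by (auto simp: power_divide)
    ultimately have "z' = z" using cycles \<open>d \<ge> 1\<close> unfolding no_eigenvalue_cycles_def by metis
    \<comment> \<open>Powers along the Jordan chain of length two formed by \<open>s\<close> and
      \<open>t'\<close>.\<close>
    have "matpow A (Suc k) *v t' = z ^ Suc k *s t' + (of_nat (Suc k) * z ^ k) *s s" for k
    proof (induction k)
      case 0
      then show ?case by (simp add: t')
    next
      case (Suc k)
      have "matpow A (Suc (Suc k)) *v t' = A *v (matpow A (Suc k) *v t')"
        by (simp add: matrix_vector_mul_assoc)
      also have "\<dots> = z ^ Suc k *s (s + z *s t') + (of_nat (Suc k) * z ^ k) *s (z *s s)"
        unfolding Suc vec.add vec.scale s(3) \<open>z' = z\<close> by (simp add: t')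
      also have "\<dots> = z ^ Suc (Suc k) *s t' + (of_nat (Suc (Suc k)) * z ^ Suc k) *s s"
        by (simp add: vec_eq_iff algebra_simps)
      finally show ?case .
    qed
    from this[of "d - 1"] have "matpow A d *v t' = z ^ d *s t' + (of_nat d * z ^ (d - 1)) *s s"
      using \<open>d \<ge> 1\<close> by simp
    then have "(of_nat d * z ^ (d - 1)) *s s = 0"
      using t'(1) power[OF t] by (simp add: W_def)
    then show False using s \<open>z \<noteq> 0\<close> \<open>d \<ge> 1\<close> by (auto simp: vec.scale_eq_0_iff)
  qed
  then show ?thesis by auto
qed

section \<open>Rank conditions and eigenvectors\<close>

lemma full_dim_annihilator:
  fixes S :: "(complex^'m) set"
  assumes "vec.dim S = CARD('m)" and "\<And>s. s \<in> S \<Longrightarrow> (\<Sum>i\<in>UNIV. s $ i * u $ i) = 0"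
  shows "u = 0"
proof -
  define H where "H = {s. (\<Sum>i\<in>UNIV. s $ i * u $ i) = 0}"
  have "vec.subspace H"
    by (auto simp: H_def vec.subspace_def distrib_right sum.distrib mult.assoc sum_distrib_left[symmetric])
  then have "vec.span S \<subseteq> H"
    using assms(2) by (intro vec.span_minimal) (auto simp: H_def)
  moreover have "vec.span S = UNIV"
    using assms(1) vec.dim_eq_full[of S] by (simp add: card_cart_basis vec.dimension_def)
  ultimately have "axis i 1 \<in> H" for i by auto
  then show ?thesis
    by (auto simp: H_def vec_eq_iff axis_def if_distrib[of "\<lambda>x. x * _"] cong: if_cong)
qed

text \<open>One half of the Popov-Belevitch-Hautus test: an eigenvector invisible to
  \<open>C\<close> stays invisible under all powers of \<open>A\<close>, so every row of the
  observability matrix annihilates it.\<close>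

lemma observable_eigenvector:
  fixes A :: "complex^'m^'m"
  assumes "observable A C" "A *v u = z *s u" "C *v u = 0"
  shows "u = 0"
proof (rule full_dim_annihilator)
  show "vec.dim (\<Union>k<CARD('m). rows (C ** matpow A k)) = CARD('m)"
    using assms(1) by (simp add: observable_def)
next
  fix s assume "s \<in> (\<Union>k<CARD('m). rows (C ** matpow A k))"
  then obtain k i where s: "s = row i (C ** matpow A k)" by (auto simp: rows_def)
  have "(C ** matpow A k) *v u = z ^ k *s (C *v u)"
    by (simp add: matrix_vector_mul_assoc[symmetric] eigenvalue_matpow[OF assms(2)] vec.scale)
  then have "((C ** matpow A k) *v u) $ i = 0" by (simp add: assms(3))
  then show "(\<Sum>i\<in>UNIV. s $ i * u $ i) = 0"
    by (simp add: s matrix_vector_mult_def row_def)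
qed

text \<open>The dual half of the test. The pairing with the columns is bilinear, so transposes occur
  here and no conjugates.\<close>

lemma controllable_left_eigenvector:
  fixes A :: "complex^'m^'m"
  assumes "controllable A B" "transpose A *v l = z *s l" "transpose B *v l = 0"
  shows "l = 0"
proof (rule full_dim_annihilator)
  show "vec.dim (\<Union>k<CARD('m). columns (matpow A k ** B)) = CARD('m)"
    using assms(1) by (simp add: controllable_def)
next
  fix s assume "s \<in> (\<Union>k<CARD('m). columns (matpow A k ** B))"
  then obtain k i where s: "s = column i (matpow A k ** B)" by (auto simp: columns_def)
  have pow: "transpose (matpow A k) *v l = z ^ k *s l"
  proof (induction k)
    case 0
    show ?case by (simp add: transpose_mat)
  next
    case (Suc k)
    show ?case
      by (simp only: matpow.simps matrix_transpose_mul matrix_vector_mul_assoc[symmetric] assms(2)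
          vec.scale Suc vec.scale_scale power_Suc)
  qed
  have "transpose (matpow A k ** B) *v l = 0"
    by (simp only: matrix_transpose_mul matrix_vector_mul_assoc[symmetric] pow vec.scale assms(3)
        vec.scale_zero_right)
  then have "(transpose (matpow A k ** B) *v l) $ i = 0" by simp
  then show "(\<Sum>i\<in>UNIV. s $ i * l $ i) = 0"
    by (simp add: s matrix_vector_mult_def column_def transpose_def del: transpose_matrix_vector)
qed

text \<open>Eigenvalues are the zeros of \<open>det (A - mat z)\<close>, and transposition preserves
  determinants. This provides the left eigenvectors for the necessity part.\<close>

lemma eigenvalue_transpose:
  fixes A :: "complex^'m^'m"
  assumes "eigenvalue A z"
  shows "eigenvalue (transpose A) z"
proof -
  have iff: "eigenvalue D z \<longleftrightarrow> det (D - mat z) = 0" for D :: "complex^'m^'m"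
  proof -
    have "det (D - mat z) \<noteq> 0 \<longleftrightarrow> (\<forall>u. (D - mat z) *v u = 0 \<longrightarrow> u = 0)"
      by (simp add: invertible_det_nz[symmetric] invertible_left_inverse matrix_left_invertible_ker)
    also have "\<dots> \<longleftrightarrow> \<not> eigenvalue D z"
    proof -
      have "mat z *v u = z *s u" for u :: "complex^'m"
        by (simp add: vec_eq_iff matrix_vector_mult_def mat_def if_distrib[of "\<lambda>x. x * _"] cong: if_cong)
      then show ?thesis by (auto simp: eigenvalue_def matrix_vector_mult_diff_rdistrib)
    qed
    finally show ?thesis by blast
  qed
  have "transpose A - mat z = transpose (A - mat z)"
    by (simp add: vec_eq_iff transpose_def mat_def)
  then show ?thesis using assms by (simp add: iff det_transpose)
qed

section \<open>Hilbert cubes in dense sets of times\<close>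

fun subset_sums :: "nat list \<Rightarrow> nat set" where
  "subset_sums [] = {0}"
| "subset_sums (d # ds) = subset_sums ds \<union> (+) d ` subset_sums ds"

lemma finite_subset_sums [simp]: "finite (subset_sums ds)"
  by (induction ds) auto

lemma zero_in_subset_sums [simp]: "0 \<in> subset_sums ds"
  by (induction ds) auto

lemma subset_sums_le: "set ds \<subseteq> {..D} \<Longrightarrow> s \<in> subset_sums ds \<Longrightarrow> s \<le> length ds * D"
proof (induction ds arbitrary: s)
  case (Cons d ds)
  from Cons.prems(2) consider "s \<in> subset_sums ds" | t where "t \<in> subset_sums ds" "s = d + t" by auto
  then show ?case
  proof cases
    case 1
    with Cons have "s \<le> length ds * D" by auto
    then show ?thesis by simp
  next
    case 2
    with Cons have "t \<le> length ds * D" "d \<le> D" by auto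
    then show ?thesis using 2 by simp
  qed
qed simp

text \<open>Let \<open>V ds\<close> be the part of the range of \<open>matpow A n\<close> that is
  invisible on the cube of \<open>ds\<close>. If a new generator \<open>d\<close> does not shrink
  it, then \<open>V ds\<close> is invariant under \<open>matpow A d\<close> and contains an
  eigenvector of it. This is an eigenvector of \<open>A\<close>, and it is invisible to
  \<open>C\<close> because 0 is a subset sum, contrary to observability. So each of the CARD('m)
  generators costs a dimension.\<close>

lemma subset_sums_kernel:
  fixes A :: "complex^'m^'m" and C :: "complex^'m^'l"
  assumes "observable A C" "no_eigenvalue_cycles A"
    and stable: "\<And>k u. matpow A (k + n) *v u = 0 \<Longrightarrow> matpow A n *v u = 0"
    and ds: "length ds = CARD('m)" "0 \<notin> set ds"
    and zero: "\<And>s. s \<in> subset_sums ds \<Longrightarrow> C *v (matpow A s *v (matpow A n *v u)) = 0"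
  shows "matpow A n *v u = 0"
proof -
  define V where "V ds = {t. (\<exists>u. t = matpow A n *v u) \<and>
      (\<forall>s\<in>subset_sums ds. C *v (matpow A s *v t) = 0)}" for ds
  have sub: "vec.subspace (V ds)" for ds
  proof -
    have "vec.subspace (range ((*v) (matpow A n)))"
      by (rule vec.linear_subspace_image) auto
    moreover have "vec.subspace {t. \<forall>s\<in>subset_sums ds. C *v (matpow A s *v t) = 0}"
      by (auto simp: vec.subspace_def vec.add vec.scale)
    moreover have "V ds = range ((*v) (matpow A n)) \<inter> {t. \<forall>s\<in>subset_sums ds. C *v (matpow A s *v t) = 0}"
      by (auto simp: V_def)
    ultimately show ?thesis by (simp add: vec.subspace_inter)
  qed
  \<comment> \<open>The first alternative is needed because a trivial space cannot lose further
    dimensions.\<close>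
  have "V ds \<subseteq> {0} \<or> vec.dim (V ds) + length ds \<le> CARD('m)" if "0 \<notin> set ds" for ds
    using that
  proof (induction ds)
    case Nil
    then show ?case by (simp add: dim_subset_UNIV_cart_gen)
  next
    case (Cons d ds)
    have mono: "V (d # ds) \<subseteq> V ds" by (auto simp: V_def)
    have "V (d # ds) \<subset> V ds" if nz: "\<not> V (d # ds) \<subseteq> {0}"
    proof -
      have "V (d # ds) \<noteq> V ds"
      proof
        assume eq: "V (d # ds) = V ds"
        have "matpow A d *v t \<in> V ds" if "t \<in> V ds" for t
        proof -
          have t: "t \<in> V (d # ds)" using that eq by simp
          then obtain u where "t = matpow A n *v u" by (auto simp: V_def)
          then have "matpow A d *v t = matpow A n *v (matpow A d *v u)"
            by (simp add: matpow_add_vec[symmetric] add.commute)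
          moreover have "C *v (matpow A s *v (matpow A d *v t)) = 0" if "s \<in> subset_sums ds" for s
            using t that by (auto simp: V_def matpow_add_vec[symmetric] add.commute)
          ultimately show ?thesis by (auto simp: V_def)
        qed
        then obtain \<mu> t where t: "t \<in> V ds" "t \<noteq> 0" "matpow A d *v t = \<mu> *s t"
          using invariant_subspace_eigenvector[OF sub[of ds], of "matpow A d"] nz eq by blast
        obtain u where u: "t = matpow A n *v u" using t by (auto simp: V_def)
        \<comment> \<open>\<open>t\<close> lies in the range of \<open>matpow A n\<close>, where the
          powers of \<open>A\<close> are injective.\<close>
        have "\<mu> \<noteq> 0"
          using stable[of d u] t by (auto simp: u matpow_add_vec)
        then obtain z where "A *v t = z *s t"
          using eigenvector_of_matpow[OF assms(2), of d t \<mu>] t Cons.prems by auto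
        moreover have "C *v t = 0"
          using t(1) by (auto simp: V_def dest!: bspec[of _ _ 0])
        ultimately show False using observable_eigenvector[OF assms(1)] t(2) by blast
      qed
      then show ?thesis using mono by blast
    qed
    moreover have "vec.dim (V (d # ds)) < vec.dim (V ds)" if "V (d # ds) \<subset> V ds"
      using that by (intro vec.dim_psubset) (simp add: vec.span_eq_iff[THEN iffD2, OF sub])
    ultimately show ?case using Cons mono by fastforce
  qed
  from this[OF ds(2)] have "V ds \<subseteq> {0}" using ds(1) by auto
  moreover have "matpow A n *v u \<in> V ds" using zero by (auto simp: V_def)
  ultimately show ?thesis by blast
qed

text \<open>A Bonferroni inequality: two of the \<open>n\<close> translates overlap in a copy of the
  points of \<open>T\<close> that have a second point of \<open>T\<close> at the given distance. The
  factor n^2 generously counts the pairs of translates.\<close>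

lemma card_shifts:
  fixes T :: "nat set"
  assumes "finite T" and "\<And>d. d \<in> {1..<n} \<Longrightarrow> card {t\<in>T. t + d \<in> T} \<le> \<eta>"
  shows "n * card T \<le> card (\<Union>i<n. (\<lambda>t. t + i) ` T) + n\<^sup>2 * \<eta>"
  using assms(2)
proof (induction n)
  case (Suc n)
  define U where "U = (\<Union>i<n. (\<lambda>t. t + i) ` T)"
  define X where "X = (\<lambda>t. t + n) ` T"
  have fin: "finite U" "finite X" using assms(1) by (auto simp: U_def X_def)
  have "card ((\<lambda>t. t + i) ` T \<inter> X) \<le> \<eta>" if "i < n" for i
  proof -
    have "(\<lambda>t. t + i) ` T \<inter> X \<subseteq> (\<lambda>t. t + n) ` {t\<in>T. t + (n - i) \<in> T}"
    proof
      fix a assume "a \<in> (\<lambda>t. t + i) ` T \<inter> X"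
      then obtain t t' where t: "t \<in> T" "t' \<in> T" "a = t + i" "a = t' + n" by (auto simp: X_def)
      then have "t = t' + (n - i)" using that by linarith
      then show "a \<in> (\<lambda>t. t + n) ` {t\<in>T. t + (n - i) \<in> T}" using t by auto
    qed
    then have "card ((\<lambda>t. t + i) ` T \<inter> X) \<le> card {t\<in>T. t + (n - i) \<in> T}"
      using assms(1) by (intro surj_card_le) auto
    also have "\<dots> \<le> \<eta>" using that by (intro Suc.prems) auto
    finally show ?thesis .
  qed
  then have "card (U \<inter> X) \<le> n * \<eta>"
    using card_UN_le[of "{..<n}" "\<lambda>i. (\<lambda>t. t + i) ` T \<inter> X"]
      sum_bounded_above[of "{..<n}" "\<lambda>i. card ((\<lambda>t. t + i) ` T \<inter> X)" \<eta>]
    by (simp add: U_def)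
  moreover have "card U + card X = card (U \<union> X) + card (U \<inter> X)"
    by (rule card_Un_Int[OF fin])
  moreover have "card X = card T" by (simp add: X_def card_image)
  moreover have "n * card T \<le> card U + n\<^sup>2 * \<eta>"
    unfolding U_def by (rule Suc.IH) (simp add: Suc.prems)
  moreover have "(\<Union>i<Suc n. (\<lambda>t. t + i) ` T) = U \<union> X"
    by (auto simp: U_def X_def lessThan_Suc)
  moreover have "n\<^sup>2 * \<eta> + n * \<eta> \<le> (Suc n)\<^sup>2 * \<eta>"
    by (simp add: power2_eq_square algebra_simps)
  ultimately show ?case by simp
qed simp

text \<open>Hilbert's cube lemma for sets of density at least 1/N. Some distance \<open>d\<close>
  below 2N occurs so often that the starting points again form a dense set, to which the induction
  applies. It matters that \<open>D\<close> depends on \<open>N\<close> and \<open>r\<close> only: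
  up to translation finitely many cubes suffice for all \<open>T\<close>.\<close>

lemma dense_set_contains_cube:
  "\<exists>K\<^sub>0 D. \<forall>K\<ge>K\<^sub>0. \<forall>T\<subseteq>{..<K::nat}. K \<le> N * card T \<longrightarrow>
     (\<exists>ds t. length ds = r \<and> set ds \<subseteq> {1..D} \<and> (\<forall>s\<in>subset_sums ds. t + s \<in> T))"
proof (induction r arbitrary: N)
  case 0
  have "\<exists>t. t \<in> T" if "K \<ge> 1" "K \<le> N * card T" for K and T :: "nat set"
    using that by (cases "T = {}") auto
  then show ?case by (intro exI[of _ 1] exI[of _ 0]) auto
next
  case (Suc r)
  obtain K\<^sub>0 D where IH: "\<And>K T. K \<ge> K\<^sub>0 \<Longrightarrow> T \<subseteq> {..<K} \<Longrightarrow> K \<le> 8 * N\<^sup>2 * card T \<Longrightarrow>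
     (\<exists>ds t. length ds = r \<and> set ds \<subseteq> {1..D} \<and> (\<forall>s\<in>subset_sums ds. t + s \<in> T))"
    using Suc.IH[of "8 * N\<^sup>2"] by metis
  show ?case
  proof (rule exI[of _ "max (4 * N + 1) K\<^sub>0"], rule exI[of _ "max D (2 * N)"], intro allI impI)
    fix K and T :: "nat set"
    assume K: "max (4 * N + 1) K\<^sub>0 \<le> K" and T: "T \<subseteq> {..<K}" "K \<le> N * card T"
    have "N \<ge> 1" using K T(2) by (cases N) auto
    have fin: "finite T" using T(1) finite_subset by blast
    define f where "f d = card {t\<in>T. t + d \<in> T}" for d
    define \<eta> where "\<eta> = Max (f ` {1..<2*N})"
    have ne: "f ` {1..<2*N} \<noteq> {}" using \<open>N \<ge> 1\<close> by auto
    then have "\<eta> \<in> f ` {1..<2*N}" unfolding \<eta>_def by (intro Max_in) auto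
    then obtain d where d: "d \<in> {1..<2*N}" "\<eta> = f d" by auto
    have "2 * N * card T \<le> card (\<Union>i<2*N. (\<lambda>t. t + i) ` T) + (2*N)\<^sup>2 * \<eta>"
    proof (rule card_shifts[OF fin])
      fix d assume "d \<in> {1..<2*N}"
      then have "f d \<le> \<eta>" unfolding \<eta>_def by (intro Max_ge) auto
      then show "card {t\<in>T. t + d \<in> T} \<le> \<eta>" by (simp add: f_def)
    qed
    moreover have "card (\<Union>i<2*N. (\<lambda>t. t + i) ` T) \<le> card {..<K + 2*N}"
      using T(1) by (intro card_mono) force+
    \<comment> \<open>The 2N translates have at least 2K points with multiplicity but fit into K +
      2N places, so K - 2N is at most 4 N^2 \<eta>. As K exceeds 4N, the left side is at least K/2;
      hence the density 1/(8 N^2) in the induction hypothesis.\<close>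
    ultimately have "K \<le> 8 * N\<^sup>2 * \<eta>"
      using K T(2) by (simp add: power2_eq_square)
    then obtain ds t where ds: "length ds = r" "set ds \<subseteq> {1..D}"
      "\<forall>s\<in>subset_sums ds. t + s \<in> {t\<in>T. t + d \<in> T}"
      using IH[of K "{t\<in>T. t + d \<in> T}"] K T(1) d by (auto simp: f_def)
    have "length (d # ds) = Suc r \<and> set (d # ds) \<subseteq> {1..max D (2*N)} \<and>
        (\<forall>s\<in>subset_sums (d # ds). t + s \<in> T)"
      using ds d by (auto simp: add_ac subset_iff)
    then show "\<exists>ds t. length ds = Suc r \<and> set ds \<subseteq> {1..max D (2*N)} \<and>
        (\<forall>s\<in>subset_sums ds. t + s \<in> T)"
      by blast
  qed
qed

text \<open>Variation of constants. The constant precedes the trajectories, because the bound is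
  applied to every outcome separately and to trajectories shifted in time.\<close>

lemma state_propagation_bound:
  fixes A :: "complex^'m^'m" and B :: "complex^'g^'m"
  assumes "\<And>z. eigenvalue A z \<Longrightarrow> cmod z < r"
  shows "\<exists>c\<ge>0. \<forall>x w. (\<forall>n. x (Suc n) = A *v x n + B *v w n) \<longrightarrow>
     (\<forall>a s. norm (x (a + s) - matpow A s *v x a) \<le> c * (\<Sum>j<s. r ^ (s - Suc j) * norm (w (a + j))))"
proof -
  obtain cA where cA: "cA \<ge> 0" "\<And>k u. norm (matpow A k *v u) \<le> cA * r ^ k * norm u"
    using matpow_bound[of A r] assms by blast
  obtain cB where cB: "cB \<ge> 0" "\<And>u. norm (B *v u) \<le> cB * norm u"
    using matrix_bound[of B] by blast
  \<comment> \<open>The existence of some eigenvalue is what makes \<open>r\<close>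
    positive.\<close>
  obtain z where "eigenvalue A z"
    using invariant_subspace_eigenvector[of UNIV A "axis undefined 1"]
    by (auto simp: eigenvalue_def)
  from assms[OF this] have "r > 0" using norm_ge_zero[of z] by linarith
  have "norm (x (a + s) - matpow A s *v x a) \<le> cA * cB * (\<Sum>j<s. r ^ (s - Suc j) * norm (w (a + j)))"
    if x: "\<And>n. x (Suc n) = A *v x n + B *v w n" for x w a s
  proof (induction s arbitrary: a)
    case 0
    then show ?case by simp
  next
    case (Suc s)
    have "x (a + Suc s) - matpow A (Suc s) *v x a
        = (x (Suc a + s) - matpow A s *v x (Suc a)) + matpow A s *v (B *v w a)"
      by (simp del: matpow.simps add: x matpow_Suc_vec vec.add)
    also have "norm \<dots> \<le> cA * cB * (\<Sum>j<s. r ^ (s - Suc j) * norm (w (Suc a + j)))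
        + cA * r ^ s * (cB * norm (w a))"
      using cA cB \<open>r > 0\<close>
      by (intro order_trans[OF norm_triangle_ineq] add_mono Suc order_trans[OF cA(2)] mult_left_mono) auto
    also have "\<dots> = cA * cB * (\<Sum>j<Suc s. r ^ (Suc s - Suc j) * norm (w (a + j)))"
      by (subst sum.lessThan_Suc_shift) (simp add: algebra_simps)
    finally show ?case .
  qed
  then show ?thesis using cA cB by (intro exI[of _ "cA * cB"]) auto
qed

lemma matrix_family_bound:
  fixes G :: "'i \<Rightarrow> complex^'m^'l"
  assumes "finite I"
  shows "\<exists>c\<ge>0. \<forall>i\<in>I. \<forall>u. norm (G i *v u) \<le> c * norm u"
proof -
  have "\<forall>i. \<exists>c\<ge>0. \<forall>u. norm (G i *v u) \<le> c * norm u"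
    using matrix_bound by blast
  then obtain c where c: "\<And>i. c i \<ge> 0" "\<And>i u. norm (G i *v u) \<le> c i * norm u" by metis
  have "norm (G i *v u) \<le> (\<Sum>i\<in>I. c i) * norm u" if "i \<in> I" for i u
    by (rule order_trans[OF c(2)]) (auto intro!: mult_right_mono member_le_sum that assms c(1))
  then show ?thesis using c(1) by (intro exI[of _ "\<Sum>i\<in>I. c i"]) (auto intro: sum_nonneg)
qed

section \<open>Estimation from a dense set of observation times\<close>

text \<open>The received times contain one of finitely many cubes up to translation, so the constant
  is uniform in \<open>K\<close> and \<open>T\<close>. The state \<open>n\<close> steps before the
  cube determines all noise-free observations on it, and these determine its image under
  \<open>matpow A n\<close> exactly. The bound contains the noise inside the window but no initial
  state, so the window may later start at any time.\<close>

lemma dense_observation_estimate: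
  fixes A :: "complex^'m^'m" and B :: "complex^'g^'m" and C :: "complex^'m^'l"
  assumes obs: "observable A C" and cyc: "no_eigenvalue_cycles A"
    and r: "\<And>z. eigenvalue A z \<Longrightarrow> cmod z < r" "r \<ge> 1"
  shows "\<exists>c K\<^sub>0. c \<ge> 0 \<and> (\<forall>K\<ge>K\<^sub>0. \<forall>T\<subseteq>{..<K}. K \<le> N * card T \<longrightarrow>
    (\<exists>\<Phi> :: nat \<Rightarrow> complex^'l^'m. \<forall>x w v. (\<forall>n. x (Suc n) = A *v x n + B *v w n) \<longrightarrow>
       norm (x (K - 1) - (\<Sum>t\<in>T. \<Phi> t *v (C *v x t + v t)))
         \<le> c * r ^ K * (\<Sum>j<K. norm (w j) + norm (v j))))"
proof -
  obtain n where n: "\<And>k u. matpow A (k + n) *v u = 0 \<Longrightarrow> matpow A n *v u = 0"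
    using matpow_kernel_stabilizes[of A] by blast
  obtain cA where cA: "cA \<ge> 0" "\<And>k u. norm (matpow A k *v u) \<le> cA * r ^ k * norm u"
    using matpow_bound[of A r] r(1) by blast
  obtain cC where cC: "cC \<ge> 0" "\<And>u. norm (C *v u) \<le> cC * norm u"
    using matrix_bound[of C] by blast
  from state_propagation_bound[of A r B, OF r(1)]
  obtain cW where cW: "cW \<ge> 0" "\<And>x (w :: nat \<Rightarrow> complex^'g) a s. (\<And>n. x (Suc n) = A *v x n + B *v w n) \<Longrightarrow>
     norm (x (a + s) - matpow A s *v x a) \<le> cW * (\<Sum>j<s. r ^ (s - Suc j) * norm (w (a + j)))"
    by blast
  \<comment> \<open>The density 1/(2N) is what remains after the first \<open>n\<close> times of the
    window are discarded, provided that K is at least 2Nn.\<close>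
  obtain K\<^sub>1 D where cube: "\<forall>K\<ge>K\<^sub>1. \<forall>T\<subseteq>{..<K}. K \<le> 2 * N * card T \<longrightarrow>
     (\<exists>ds t. length ds = CARD('m) \<and> set ds \<subseteq> {1..D} \<and> (\<forall>s\<in>subset_sums ds. t + s \<in> T))"
    using dense_set_contains_cube[of "2 * N" "CARD('m)"] by (elim exE)
  define L where "L = {ds. set ds \<subseteq> {1..D} \<and> length ds = CARD('m)}"
  have "finite L" unfolding L_def by (rule finite_lists_length_eq) simp
  \<comment> \<open>\<open>P\<close> says that \<open>\<Psi>\<close> reconstructs the state at the
    base of the cube in the absence of noise, with coefficients bounded by \<open>c\<close>.\<close>
  define P where "P ds c \<Psi> \<longleftrightarrow> c \<ge> (0::real) \<and>
      (\<forall>u. matpow A n *v u = (\<Sum>s\<in>subset_sums ds. \<Psi> s *v (C *v (matpow A (s + n) *v u)))) \<and>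
      (\<forall>s\<in>subset_sums ds. \<forall>u. norm (\<Psi> s *v u) \<le> c * norm u)"
    for ds c and \<Psi> :: "nat \<Rightarrow> complex^'l^'m"
  have "\<exists>q. P ds (fst q) (snd q)" if "ds \<in> L" for ds
  proof -
    have "matpow A n *v u = 0"
      if "\<forall>s\<in>subset_sums ds. (C ** matpow A (s + n)) *v u = 0" for u
    proof (rule subset_sums_kernel[OF obs cyc n])
      show "length ds = CARD('m)" "0 \<notin> set ds" using \<open>ds \<in> L\<close> by (auto simp: L_def)
    qed (use that in \<open>auto simp: matrix_vector_mul_assoc[symmetric] matpow_add_vec\<close>)
    from matrix_factor_family[of "subset_sums ds" "\<lambda>s. C ** matpow A (s + n)", OF _ this]
    obtain \<Psi> :: "nat \<Rightarrow> complex^'l^'m" where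
      "\<forall>u. matpow A n *v u = (\<Sum>s\<in>subset_sums ds. \<Psi> s *v ((C ** matpow A (s + n)) *v u))"
      by auto
    moreover obtain c where "c \<ge> 0" "\<forall>s\<in>subset_sums ds. \<forall>u. norm (\<Psi> s *v u) \<le> c * norm u"
      using matrix_family_bound[of "subset_sums ds" \<Psi>] by auto
    ultimately have "P ds c \<Psi>" by (simp add: P_def matrix_vector_mul_assoc[symmetric])
    then show ?thesis by (intro exI[of _ "(c, \<Psi>)"]) simp
  qed
  then have "\<forall>ds\<in>L. \<exists>q. P ds (fst q) (snd q)" by blast
  from bchoice[OF this] obtain q where q: "\<forall>ds\<in>L. P ds (fst (q ds)) (snd (q ds))" ..
  define c\<^sub>\<Psi> where "c\<^sub>\<Psi> ds = fst (q ds)" for ds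
  define \<Psi> where "\<Psi> ds = snd (q ds)" for ds
  have \<Psi>: "\<And>ds. ds \<in> L \<Longrightarrow> c\<^sub>\<Psi> ds \<ge> 0"
    "\<And>ds u. ds \<in> L \<Longrightarrow>
       matpow A n *v u = (\<Sum>s\<in>subset_sums ds. (\<Psi> ds s :: complex^'l^'m) *v (C *v (matpow A (s + n) *v u)))"
    "\<And>ds s u. ds \<in> L \<Longrightarrow> s \<in> subset_sums ds \<Longrightarrow> norm (\<Psi> ds s *v u) \<le> c\<^sub>\<Psi> ds * norm u"
    using q by (simp_all add: P_def c\<^sub>\<Psi>_def \<Psi>_def)
  define c\<^sub>1 where "c\<^sub>1 = (\<Sum>ds\<in>L. c\<^sub>\<Psi> ds)"
  have c\<^sub>1: "c\<^sub>1 \<ge> 0" "\<And>ds. ds \<in> L \<Longrightarrow> c\<^sub>\<Psi> ds \<le> c\<^sub>1"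
    using \<Psi>(1) \<open>finite L\<close> by (auto simp: c\<^sub>1_def intro!: sum_nonneg member_le_sum)
  define S where "S = CARD('m) * D"
  define c\<^sub>3 where "c\<^sub>3 = cW * r ^ (n + S)"
  \<comment> \<open>Error at the base of the cube: the drift over \<open>n\<close> steps, and for
    each of at most S + 1 cube times the drift seen through \<open>C\<close> plus the measurement
    noise, both amplified by \<open>\<Psi>\<close>.\<close>
  define c\<^sub>4 where "c\<^sub>4 = c\<^sub>3 + of_nat (Suc S) * (c\<^sub>1 * (cC * c\<^sub>3 + 1))"
  have "c\<^sub>3 \<ge> 0" "c\<^sub>4 \<ge> 0" using cW(1) r(2) c\<^sub>1 cC(1) by (auto simp: c\<^sub>3_def c\<^sub>4_def)
  define K\<^sub>0 where "K\<^sub>0 = max (max K\<^sub>1 (2 * N * n)) 1"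
  have *: "\<exists>\<Phi> :: nat \<Rightarrow> complex^'l^'m. \<forall>x w v. (\<forall>n. x (Suc n) = A *v x n + B *v w n) \<longrightarrow>
       norm (x (K - 1) - (\<Sum>t\<in>T. \<Phi> t *v (C *v x t + v t)))
         \<le> (cW + cA * c\<^sub>4) * r ^ K * (\<Sum>j<K. norm (w j) + norm (v j))"
    if K: "K \<ge> K\<^sub>0" and T: "T \<subseteq> {..<K}" "K \<le> N * card T" for K T
  proof -
    \<comment> \<open>The cube has to start at time \<open>n\<close> or later, so that the
      trajectory can be followed from \<open>n\<close> steps earlier.\<close>
    define T' where "T' = T - {..<n}"
    have "card T \<le> card T' + n"
      using diff_card_le_card_Diff[of "{..<n}" T] by (simp add: T'_def)
    then have "N * card T \<le> N * card T' + N * n" by (metis add_mult_distrib2 mult_le_mono2)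
    then have "K \<le> 2 * N * card T'" using T(2) K by (simp add: K\<^sub>0_def)
    moreover have "K\<^sub>1 \<le> K" "T' \<subseteq> {..<K}" using K T(1) by (auto simp: K\<^sub>0_def T'_def)
    ultimately obtain ds \<tau> where "length ds = CARD('m)" "set ds \<subseteq> {1..D}"
      and ds_T': "\<forall>s\<in>subset_sums ds. \<tau> + s \<in> T'"
      using cube by blast
    then have ds: "ds \<in> L" "\<And>s. s \<in> subset_sums ds \<Longrightarrow> \<tau> + s \<in> T'"
      by (auto simp: L_def)
    from ds(2)[OF zero_in_subset_sums] have \<tau>: "n \<le> \<tau>" "\<tau> < K" using T(1) by (auto simp: T'_def)
    have sK: "\<tau> + s < K" if "s \<in> subset_sums ds" for s using ds(2)[OF that] T(1) by (auto simp: T'_def)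
    have sS: "s \<le> S" if "s \<in> subset_sums ds" for s
      using subset_sums_le[OF _ that, of D] ds(1) by (force simp: L_def S_def)
    then have card: "card (subset_sums ds) \<le> Suc S"
      using card_mono[of "{..S}" "subset_sums ds"] by auto
    \<comment> \<open>Estimate the state at the base \<open>\<tau>\<close> and transport it to the
      end of the window; received times off the cube are ignored.\<close>
    define \<Phi> where "\<Phi> t = (if t \<in> (+) \<tau> ` subset_sums ds then matpow A (K - 1 - \<tau>) ** \<Psi> ds (t - \<tau>) else 0)" for t
    show ?thesis
    proof (rule exI[of _ \<Phi>], intro allI impI)
      fix x :: "nat \<Rightarrow> complex^'m" and w :: "nat \<Rightarrow> complex^'g" and v :: "nat \<Rightarrow> complex^'l"
      assume "\<forall>n. x (Suc n) = A *v x n + B *v w n"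
      then have x: "x (Suc n) = A *v x n + B *v w n" for n by blast
      define Z where "Z = (\<Sum>j<K. norm (w j) + norm (v j))"
      have "Z \<ge> 0" unfolding Z_def by (auto intro: sum_nonneg add_nonneg_nonneg)
      \<comment> \<open>All powers of \<open>r\<close> are replaced by the largest one, which is
        possible since r \<ge> 1.\<close>
      have drift: "norm (x (a + s) - matpow A s *v x a) \<le> cW * r ^ k * Z"
        if "a + s \<le> K" "s \<le> k" for a s k
      proof -
        have "norm (x (a + s) - matpow A s *v x a) \<le> cW * (\<Sum>j<s. r ^ (s - Suc j) * norm (w (a + j)))"
          by (rule cW(2)) (rule x)
        also have "(\<Sum>j<s. r ^ (s - Suc j) * norm (w (a + j))) \<le> (\<Sum>j<s. r ^ k * norm (w (a + j)))"
          using that r(2) by (intro sum_mono mult_right_mono power_increasing) auto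
        also have "\<dots> = r ^ k * (\<Sum>j\<in>(+) a ` {..<s}. norm (w j))"
          by (simp add: sum.reindex sum_distrib_left)
        also have "(\<Sum>j\<in>(+) a ` {..<s}. norm (w j)) \<le> (\<Sum>j<K. norm (w j))"
          using that by (intro sum_mono2) auto
        also have "\<dots> \<le> Z" unfolding Z_def by (intro sum_mono) simp
        finally show ?thesis using cW(1) r(2) by (simp add: mult.assoc mult_left_mono)
      qed
      define a where "a = \<tau> - n"
      have \<tau>_a: "\<tau> = a + n" using \<tau> by (simp add: a_def)
      define e\<^sub>2 where "e\<^sub>2 = x \<tau> - matpow A n *v x a"
      define e\<^sub>3 where "e\<^sub>3 s = x (\<tau> + s) - matpow A (s + n) *v x a" for s
      have e\<^sub>2: "norm e\<^sub>2 \<le> c\<^sub>3 * Z"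
        using drift[of a n "n + S"] \<tau> by (simp add: e\<^sub>2_def c\<^sub>3_def \<tau>_a)
      have e\<^sub>3: "norm (e\<^sub>3 s) \<le> c\<^sub>3 * Z" if "s \<in> subset_sums ds" for s
        using drift[of a "s + n" "n + S"] sK[OF that] sS[OF that]
        by (simp add: e\<^sub>3_def c\<^sub>3_def \<tau>_a add_ac)
      have v: "norm (v (\<tau> + s)) \<le> Z" if "s \<in> subset_sums ds" for s
        unfolding Z_def using sK[OF that]
        by (intro order_trans[OF _ member_le_sum[of "\<tau> + s"]]) auto
      have "(\<Sum>t\<in>T. \<Phi> t *v (C *v x t + v t))
          = (\<Sum>t\<in>(+) \<tau> ` subset_sums ds. \<Phi> t *v (C *v x t + v t))"
        using ds(2) T(1) by (intro sum.mono_neutral_right) (auto simp: \<Phi>_def T'_def intro: finite_subset)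
      also have "\<dots> = matpow A (K - 1 - \<tau>) *v
          (\<Sum>s\<in>subset_sums ds. \<Psi> ds s *v (C *v (x (\<tau> + s)) + v (\<tau> + s)))"
        by (simp add: sum.reindex \<Phi>_def matrix_vector_mul_assoc[symmetric] vec.sum)
      also have "(\<Sum>s\<in>subset_sums ds. \<Psi> ds s *v (C *v (x (\<tau> + s)) + v (\<tau> + s)))
          = matpow A n *v x a + (\<Sum>s\<in>subset_sums ds. \<Psi> ds s *v (C *v e\<^sub>3 s + v (\<tau> + s)))"
        unfolding \<Psi>(2)[OF ds(1), of "x a"] sum.distrib[symmetric]
        by (intro sum.cong refl) (simp add: e\<^sub>3_def vec.add vec.diff)
      finally have est: "x (K - 1) - (\<Sum>t\<in>T. \<Phi> t *v (C *v x t + v t))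
          = (x (K - 1) - matpow A (K - 1 - \<tau>) *v x \<tau>) +
            matpow A (K - 1 - \<tau>) *v (e\<^sub>2 - (\<Sum>s\<in>subset_sums ds. \<Psi> ds s *v (C *v e\<^sub>3 s + v (\<tau> + s))))"
        by (simp add: e\<^sub>2_def vec.add vec.diff)
      have "norm (\<Sum>s\<in>subset_sums ds. \<Psi> ds s *v (C *v e\<^sub>3 s + v (\<tau> + s)))
          \<le> (\<Sum>s\<in>subset_sums ds. c\<^sub>1 * (cC * (c\<^sub>3 * Z) + Z))"
      proof (rule sum_norm_le)
        fix s assume s: "s \<in> subset_sums ds"
        have "norm (\<Psi> ds s *v (C *v e\<^sub>3 s + v (\<tau> + s))) \<le> c\<^sub>1 * norm (C *v e\<^sub>3 s + v (\<tau> + s))"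
          by (rule order_trans[OF \<Psi>(3)[OF ds(1) s]]) (simp add: mult_right_mono c\<^sub>1(2) ds(1))
        also have "\<dots> \<le> c\<^sub>1 * (cC * (c\<^sub>3 * Z) + Z)"
          using e\<^sub>3[OF s] v[OF s] cC c\<^sub>1(1)
          by (intro mult_left_mono order_trans[OF norm_triangle_ineq] add_mono order_trans[OF cC(2)]) auto
        finally show "norm (\<Psi> ds s *v (C *v e\<^sub>3 s + v (\<tau> + s))) \<le> c\<^sub>1 * (cC * (c\<^sub>3 * Z) + Z)" .
      qed
      also have "\<dots> \<le> of_nat (Suc S) * (c\<^sub>1 * (cC * (c\<^sub>3 * Z) + Z))"
        using card c\<^sub>1(1) cC(1) \<open>c\<^sub>3 \<ge> 0\<close> \<open>Z \<ge> 0\<close> by (simp del: of_nat_Suc add: mult_right_mono)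
      finally have "norm (e\<^sub>2 - (\<Sum>s\<in>subset_sums ds. \<Psi> ds s *v (C *v e\<^sub>3 s + v (\<tau> + s)))) \<le> c\<^sub>4 * Z"
        using e\<^sub>2 by (intro order_trans[OF norm_triangle_ineq4])
          (simp add: c\<^sub>4_def algebra_simps del: of_nat_Suc)
      then have "norm (matpow A (K - 1 - \<tau>) *v (e\<^sub>2 - (\<Sum>s\<in>subset_sums ds. \<Psi> ds s *v (C *v e\<^sub>3 s + v (\<tau> + s)))))
          \<le> cA * r ^ K * (c\<^sub>4 * Z)"
        using cA(1) r(2) by (intro order_trans[OF cA(2)] mult_mono power_increasing) auto
      moreover have "norm (x (K - 1) - matpow A (K - 1 - \<tau>) *v x \<tau>) \<le> cW * r ^ K * Z"
        using drift[of \<tau> "K - 1 - \<tau>" K] \<tau> by simp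
      ultimately show "norm (x (K - 1) - (\<Sum>t\<in>T. \<Phi> t *v (C *v x t + v t)))
          \<le> (cW + cA * c\<^sub>4) * r ^ K * (\<Sum>j<K. norm (w j) + norm (v j))"
        unfolding est Z_def[symmetric]
        by (intro order_trans[OF norm_triangle_ineq]) (simp add: algebra_simps)
    qed
  qed
  have "cW + cA * c\<^sub>4 \<ge> 0" using cW(1) cA(1) \<open>c\<^sub>4 \<ge> 0\<close> by simp
  then show ?thesis
    using * by (intro exI[of _ "cW + cA * c\<^sub>4"] exI[of _ K\<^sub>0]) simp
qed

section \<open>Second moments and independence of the sources\<close>

lemma borel_measurable_matrix_vector [measurable (raw)]:
  fixes A :: "complex^'m^'l"
  assumes "f \<in> borel_measurable N"
  shows "(\<lambda>\<omega>. A *v f \<omega>) \<in> borel_measurable N"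
  using borel_measurable_continuous_on[OF _ assms, of "(*v) A"]
    linear_continuous_on[OF matrix_vector_mul_bounded_linear[of A]] by blast

lemma borel_measurable_cnj [measurable (raw)]:
  assumes "f \<in> borel_measurable N"
  shows "(\<lambda>\<omega>. cnj (f \<omega>)) \<in> borel_measurable N"
  using borel_measurable_continuous_on[OF _ assms, of cnj] by (simp add: continuous_on_cnj)

lemma norm_vec_power2: "(norm (u :: complex^'n))\<^sup>2 = (\<Sum>i\<in>UNIV. (cmod (u $ i))\<^sup>2)"
  by (simp add: norm_vec_def L2_set_def sum_nonneg)

lemma borel_measurable_hdot [measurable (raw)]:
  assumes "f \<in> borel_measurable N"
  shows "(\<lambda>\<omega>. hdot u (f \<omega>)) \<in> borel_measurable N"
proof -
  have "bounded_linear (\<lambda>t. hdot u t)"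
    unfolding hdot_def
    by (intro bounded_linear_sum bounded_linear_const_mult bounded_linear_vec_nth)
  then show ?thesis
    using borel_measurable_continuous_on[OF _ assms, of "hdot u"] linear_continuous_on by blast
qed

lemma hdot_axis [simp]: "hdot (axis i 1) t = t $ i"
  by (simp add: hdot_def axis_def if_distrib[of cnj] if_distrib[of "\<lambda>x. x * _"] cong: if_cong)

lemma norm_hdot_le: "cmod (hdot u t) \<le> (\<Sum>i\<in>UNIV. cmod (u $ i)) * norm t"
proof -
  have "cmod (hdot u t) \<le> (\<Sum>i\<in>UNIV. cmod (u $ i) * norm t)"
    unfolding hdot_def
    by (intro sum_norm_le) (auto simp: norm_mult intro!: mult_left_mono Finite_Cartesian_Product.norm_nth_le)
  then show ?thesis by (simp add: sum_distrib_right)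
qed

context prob_space
begin

lemma gaussian_square_integrable:
  assumes "gaussian X" and [measurable]: "X \<in> borel_measurable M"
  shows "integrable M (\<lambda>\<omega>. (X \<omega>)\<^sup>2)"
  using assms(1) unfolding gaussian_def
proof
  assume "\<exists>\<mu>. AE \<omega> in M. X \<omega> = \<mu>"
  then obtain \<mu> where "AE \<omega> in M. X \<omega> = \<mu>" by blast
  then have "AE \<omega> in M. (X \<omega>)\<^sup>2 = \<mu>\<^sup>2" by eventually_elim simp
  then show ?thesis by (subst integrable_cong_AE[where g = "\<lambda>_. \<mu>\<^sup>2"]) auto
next
  assume "\<exists>\<mu> s. s > 0 \<and> distributed M lborel X (normal_density \<mu> s)"
  then obtain \<mu> s where s: "s > 0" and d: "distributed M lborel X (normal_density \<mu> s)" by blast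
  \<comment> \<open>Expansion of t^2 around \<mu>, in terms of central moments.\<close>
  have "integrable lborel (\<lambda>t. normal_density \<mu> s t * (t - \<mu>) ^ 2 +
      2 * \<mu> * (normal_density \<mu> s t * (t - \<mu>) ^ 1) + \<mu>\<^sup>2 * (normal_density \<mu> s t * (t - \<mu>) ^ 0))"
    using integrable_normal_moment[OF s] by (intro Bochner_Integration.integrable_add integrable_mult_right) blast+
  also have "(\<lambda>t. normal_density \<mu> s t * (t - \<mu>) ^ 2 +
      2 * \<mu> * (normal_density \<mu> s t * (t - \<mu>) ^ 1) + \<mu>\<^sup>2 * (normal_density \<mu> s t * (t - \<mu>) ^ 0))
      = (\<lambda>t. normal_density \<mu> s t * t\<^sup>2)"
    by (simp add: fun_eq_iff power2_eq_square algebra_simps)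
  finally show ?thesis
    using distributed_integrable[OF d, of "\<lambda>t. t\<^sup>2"] by simp
qed

text \<open>Zero mean and positive second moment exclude the degenerate case of
  \<open>gaussian\<close>; in the other case there is a density, so single points have no
  mass.\<close>

lemma gaussian_nonzero:
  assumes "gaussian X" and [measurable]: "X \<in> borel_measurable M"
    and "expectation X = 0" "expectation (\<lambda>\<omega>. (X \<omega>)\<^sup>2) > 0"
  shows "AE \<omega> in M. X \<omega> \<noteq> 0"
  using assms(1) unfolding gaussian_def
proof
  assume "\<exists>\<mu>. AE \<omega> in M. X \<omega> = \<mu>"
  then obtain \<mu> where \<mu>: "AE \<omega> in M. X \<omega> = \<mu>" by blast
  then have "expectation X = expectation (\<lambda>_. \<mu>)" by (intro integral_cong_AE) auto
  then have "\<mu> = 0" using assms(3) by (simp add: prob_space)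
  have "AE \<omega> in M. (X \<omega>)\<^sup>2 = 0" using \<mu> by eventually_elim (simp add: \<open>\<mu> = 0\<close>)
  then have "expectation (\<lambda>\<omega>. (X \<omega>)\<^sup>2) = 0"
    by (intro integral_eq_zero_AE) auto
  then show ?thesis using assms(4) by simp
next
  assume "\<exists>\<mu> s. s > 0 \<and> distributed M lborel X (normal_density \<mu> s)"
  then obtain \<mu> s where d: "distributed M lborel X (normal_density \<mu> s)" by blast
  have "emeasure M (X -` {0} \<inter> space M) = (\<integral>\<^sup>+t. ennreal (normal_density \<mu> s t) * indicator {0} t \<partial>lborel)"
    by (rule distributed_emeasure[OF d]) auto
  also have "\<dots> = (\<integral>\<^sup>+(t::real). 0 \<partial>lborel)"
  proof (rule nn_integral_cong_AE)
    show "AE t in lborel. ennreal (normal_density \<mu> s t) * indicator {0} t = 0"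
      using AE_lborel_singleton[of "0::real"] by eventually_elim simp
  qed
  finally have "emeasure M (X -` {0} \<inter> space M) = 0" by simp
  then have "X -` {0} \<inter> space M \<in> null_sets M" by (intro null_setsI) auto
  then have "AE \<omega> in M. \<omega> \<notin> X -` {0} \<inter> space M" by (rule AE_not_in)
  then show ?thesis using AE_space by eventually_elim auto
qed

lemma gaussian_vector_square_integrable:
  fixes \<xi> :: "'a \<Rightarrow> 'b::euclidean_space"
  assumes "\<And>a. gaussian (\<lambda>\<omega>. a \<bullet> \<xi> \<omega>)" and [measurable]: "\<xi> \<in> borel_measurable M"
  shows "integrable M (\<lambda>\<omega>. (norm (\<xi> \<omega>))\<^sup>2)"
proof -
  have "(norm (\<xi> \<omega>))\<^sup>2 = (\<Sum>b\<in>Basis. (b \<bullet> \<xi> \<omega>)\<^sup>2)" for \<omega>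
    unfolding power2_norm_eq_inner
    by (subst euclidean_inner) (simp add: power2_eq_square inner_commute)
  then show ?thesis using assms(1) by (auto intro!: Bochner_Integration.integrable_sum gaussian_square_integrable)
qed

lemma square_integrable_imp_integrable:
  fixes \<xi> :: "'a \<Rightarrow> 'b::{banach, second_countable_topology}"
  assumes [measurable]: "\<xi> \<in> borel_measurable M" and "integrable M (\<lambda>\<omega>. (norm (\<xi> \<omega>))\<^sup>2)"
  shows "integrable M \<xi>"
proof (rule Bochner_Integration.integrable_bound)
  show "integrable M (\<lambda>\<omega>. 1 + (norm (\<xi> \<omega>))\<^sup>2)" using assms by simp
  have "t \<le> 1 + t\<^sup>2" for t :: real
    using zero_le_power2[of "t - 1 / 2"] by (simp add: power2_diff power_divide)
  then show "AE \<omega> in M. norm (\<xi> \<omega>) \<le> norm (1 + (norm (\<xi> \<omega>))\<^sup>2)" by auto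
qed simp

lemma square_integrable_product:
  fixes f g :: "'a \<Rightarrow> complex"
  assumes [measurable]: "f \<in> borel_measurable M" "g \<in> borel_measurable M"
    and "integrable M (\<lambda>\<omega>. (cmod (f \<omega>))\<^sup>2)" "integrable M (\<lambda>\<omega>. (cmod (g \<omega>))\<^sup>2)"
  shows "integrable M (\<lambda>\<omega>. f \<omega> * g \<omega>)"
proof (rule Bochner_Integration.integrable_bound)
  show "integrable M (\<lambda>\<omega>. (cmod (f \<omega>))\<^sup>2 + (cmod (g \<omega>))\<^sup>2)" using assms by simp
  have "s * t \<le> s\<^sup>2 + t\<^sup>2" if "s \<ge> 0" "t \<ge> 0" for s t :: real
  proof -
    have "0 \<le> s * t" using that by simp
    moreover have "2 * (s * t) \<le> s\<^sup>2 + t\<^sup>2" using sum_squares_bound[of s t] by simp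
    ultimately show ?thesis by linarith
  qed
  then show "AE \<omega> in M. norm (f \<omega> * g \<omega>) \<le> norm ((cmod (f \<omega>))\<^sup>2 + (cmod (g \<omega>))\<^sup>2)"
    by (auto simp: norm_mult)
qed simp

lemma square_integrable_hdot:
  fixes \<xi> :: "'a \<Rightarrow> complex^'n"
  assumes [measurable]: "\<xi> \<in> borel_measurable M" and "integrable M (\<lambda>\<omega>. (norm (\<xi> \<omega>))\<^sup>2)"
  shows "integrable M (\<lambda>\<omega>. (cmod (hdot u (\<xi> \<omega>)))\<^sup>2)"
proof (rule Bochner_Integration.integrable_bound)
  show "integrable M (\<lambda>\<omega>. (\<Sum>i\<in>UNIV. cmod (u $ i))\<^sup>2 * (norm (\<xi> \<omega>))\<^sup>2)"
    using assms by simp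
  show "AE \<omega> in M. norm ((cmod (hdot u (\<xi> \<omega>)))\<^sup>2) \<le> norm ((\<Sum>i\<in>UNIV. cmod (u $ i))\<^sup>2 * (norm (\<xi> \<omega>))\<^sup>2)"
    using norm_hdot_le[of u] by (auto simp: power_mult_distrib[symmetric] intro!: power_mono)
qed simp

lemma hdot_second_moment:
  fixes \<xi> :: "'a \<Rightarrow> complex^'n"
  assumes [measurable]: "\<xi> \<in> borel_measurable M" and sq: "integrable M (\<lambda>\<omega>. (norm (\<xi> \<omega>))\<^sup>2)"
  shows "hdot u (second_moment \<xi> *v u) = complex_of_real (expectation (\<lambda>\<omega>. (cmod (hdot u (\<xi> \<omega>)))\<^sup>2))"
proof -
  note axis = hdot_axis[of _ "\<xi> _", symmetric]
  have int: "integrable M (\<lambda>\<omega>. \<xi> \<omega> $ i * cnj (\<xi> \<omega> $ j))" for i j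
    unfolding axis by (rule square_integrable_product) (auto simp: square_integrable_hdot sq simp del: hdot_axis)
  have "hdot u (second_moment \<xi> *v u)
      = (\<Sum>i\<in>UNIV. \<Sum>j\<in>UNIV. expectation (\<lambda>\<omega>. cnj (u $ i) * u $ j * (\<xi> \<omega> $ i * cnj (\<xi> \<omega> $ j))))"
    by (simp add: hdot_def matrix_vector_mult_def second_moment_def sum_distrib_left mult_ac)
  also have "\<dots> = expectation (\<lambda>\<omega>. \<Sum>i\<in>UNIV. \<Sum>j\<in>UNIV. cnj (u $ i) * u $ j * (\<xi> \<omega> $ i * cnj (\<xi> \<omega> $ j)))"
    using int by (simp add: Bochner_Integration.integral_sum)
  also have "(\<lambda>\<omega>. \<Sum>i\<in>UNIV. \<Sum>j\<in>UNIV. cnj (u $ i) * u $ j * (\<xi> \<omega> $ i * cnj (\<xi> \<omega> $ j)))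
      = (\<lambda>\<omega>. complex_of_real ((cmod (hdot u (\<xi> \<omega>)))\<^sup>2))"
    unfolding complex_norm_square hdot_def cnj_sum sum_product
    by (intro ext sum.cong refl) simp
  finally show ?thesis by (simp only: integral_complex_of_real)
qed

lemma hdot_mat: "hdot u (mat (complex_of_real s) *v u) = complex_of_real (s * (norm u)\<^sup>2)"
proof -
  have "mat c *v u = c *s u" for c
    by (simp add: vec_eq_iff matrix_vector_mult_def mat_def if_distrib[of "\<lambda>x. x * _"] cong: if_cong)
  then have "hdot u (mat (complex_of_real s) *v u)
      = complex_of_real s * (\<Sum>i\<in>UNIV. u $ i * cnj (u $ i))"
    by (simp add: hdot_def sum_distrib_left mult_ac)
  then show ?thesis
    unfolding complex_norm_square[symmetric] norm_vec_power2 by simp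
qed

lemma hdot_diff: "hdot u (s - t) = hdot u s - hdot u t"
  by (simp add: hdot_def right_diff_distrib sum_subtractf)

text \<open>Testing the Loewner bound on the coordinate axes bounds each diagonal entry by
  \<open>s\<close>, hence the trace by \<open>s\<close> times the dimension.\<close>

lemma second_moment_upper:
  fixes s :: real and \<xi> :: "'a \<Rightarrow> complex^'n"
  assumes [measurable]: "\<xi> \<in> borel_measurable M" and sq: "integrable M (\<lambda>\<omega>. (norm (\<xi> \<omega>))\<^sup>2)"
    and le: "second_moment \<xi> \<preceq> mat (complex_of_real s)"
  shows "expectation (\<lambda>\<omega>. (norm (\<xi> \<omega>))\<^sup>2) \<le> CARD('n) * s"
proof -
  have [measurable]: "(\<lambda>\<omega>. \<xi> \<omega> $ i) \<in> borel_measurable M" for i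
    using borel_measurable_hdot[OF assms(1), of "axis i 1"] by simp
  have "expectation (\<lambda>\<omega>. (cmod (\<xi> \<omega> $ i))\<^sup>2) \<le> s" for i
  proof -
    have "0 \<le> Re (hdot (axis i 1) ((mat (complex_of_real s) - second_moment \<xi>) *v axis i 1))"
      using le unfolding loewner_le_def psd_def by blast
    then show ?thesis
      unfolding hdot_axis[of i, symmetric]
      by (simp add: matrix_vector_mult_diff_rdistrib hdot_diff hdot_mat hdot_second_moment[OF assms(1) sq] del: hdot_axis)
  qed
  moreover have "integrable M (\<lambda>\<omega>. (cmod (\<xi> \<omega> $ i))\<^sup>2)" for i
    by (rule Bochner_Integration.integrable_bound[OF sq])
      (auto intro!: power_mono Finite_Cartesian_Product.norm_nth_le)
  ultimately show ?thesis
    unfolding norm_vec_power2 by (simp add: Bochner_Integration.integral_sum sum_bounded_above)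
qed

lemma second_moment_lower:
  fixes s :: real and \<xi> :: "'a \<Rightarrow> complex^'n"
  assumes [measurable]: "\<xi> \<in> borel_measurable M" and sq: "integrable M (\<lambda>\<omega>. (norm (\<xi> \<omega>))\<^sup>2)"
    and le: "mat (complex_of_real s) \<preceq> second_moment \<xi>"
  shows "expectation (\<lambda>\<omega>. (cmod (hdot u (\<xi> \<omega>)))\<^sup>2) \<ge> s * (norm u)\<^sup>2"
proof -
  have "0 \<le> Re (hdot u ((second_moment \<xi> - mat (complex_of_real s)) *v u))"
    using le unfolding loewner_le_def psd_def by blast
  then show ?thesis
    by (simp add: matrix_vector_mult_diff_rdistrib hdot_diff hdot_mat hdot_second_moment[OF assms(1) sq]
        del: of_real_mult of_real_power)
qed

end

section \<open>Sigma-algebras generated by sets of sources\<close>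

context intermittent_system
begin

definition source_sets :: "source \<Rightarrow> 'a set set" where
  "source_sets s = (case s of
       Initial \<Rightarrow> sets (vimage_algebra (space M) (x 0) borel)
     | Process n \<Rightarrow> sets (vimage_algebra (space M) (w n) borel)
     | Measurement n \<Rightarrow> sets (vimage_algebra (space M) (v n) borel)
     | Channel n \<Rightarrow> sets (vimage_algebra (space M) (\<beta> n) borel))"

text \<open>The sources differ in type, so the dependence of a variable on some of them is expressed
  by measurability with respect to a set of labels. Disjoint label sets then give
  independence.\<close>

definition source_algebra :: "source set \<Rightarrow> 'a measure" where
  "source_algebra I = sigma (space M) (\<Union>s\<in>I. source_sets s)"

lemma indep_source_sets: "indep_sets source_sets UNIV"
  using independent by (simp add: source_sets_def[abs_def])

lemma source_sets_events: "source_sets s \<subseteq> events"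
  using indep_source_sets by (auto simp: indep_sets_def)

lemma space_source_algebra [simp]: "space (source_algebra I) = space M"
  by (simp add: source_algebra_def space_measure_of_conv)

lemma sets_source_algebra:
  "sets (source_algebra I) = sigma_sets (space M) (\<Union>s\<in>I. source_sets s)"
proof -
  have "(\<Union>s\<in>I. source_sets s) \<subseteq> Pow (space M)"
    using source_sets_events sets.space_closed[of M] by blast
  then show ?thesis by (simp add: source_algebra_def)
qed

lemma subalgebra_source_algebra: "subalgebra M (source_algebra I)"
  unfolding subalgebra_def sets_source_algebra
  using source_sets_events by (auto intro!: sets.sigma_sets_subset)

lemmas measurable_source_algebra = measurable_from_subalg[OF subalgebra_source_algebra]

lemma measurable_source:
  fixes f :: "'a \<Rightarrow> 'b::topological_space"
  assumes "sets (vimage_algebra (space M) f borel) = source_sets s" "s \<in> I"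
  shows "f \<in> borel_measurable (source_algebra I)"
proof (rule measurableI)
  fix D :: "'b set" assume "D \<in> sets borel"
  then have "f -` D \<inter> space M \<in> source_sets s"
    unfolding assms(1)[symmetric] by (auto simp: sets_vimage_algebra2 intro: in_vimage_algebra)
  then show "f -` D \<inter> space (source_algebra I) \<in> sets (source_algebra I)"
    using assms(2) by (auto simp: sets_source_algebra)
qed simp

lemma measurable_sources:
  "Initial \<in> I \<Longrightarrow> x 0 \<in> borel_measurable (source_algebra I)"
  "Process n \<in> I \<Longrightarrow> w n \<in> borel_measurable (source_algebra I)"
  "Measurement n \<in> I \<Longrightarrow> v n \<in> borel_measurable (source_algebra I)"
  "Channel n \<in> I \<Longrightarrow> \<beta> n \<in> borel_measurable (source_algebra I)"
  by (auto intro!: measurable_source simp: source_sets_def)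

lemma sigma_sets_vimage_source_algebra:
  assumes "h \<in> measurable (source_algebra I) N"
  shows "sigma_sets (space M) {h -` D \<inter> space M |D. D \<in> sets N} \<subseteq> sets (source_algebra I)"
  using sets.sigma_sets_subset[of "{h -` D \<inter> space M |D. D \<in> sets N}" "source_algebra I"]
    measurable_sets[OF assms] by auto

text \<open>The preimages under one source form a family stable under intersection, so independence
  passes to the sigma-algebras generated by disjoint groups of sources.\<close>

lemma indep_var_source_algebra:
  fixes f :: "'a \<Rightarrow> 'b" and g :: "'a \<Rightarrow> 'b"
  assumes f: "f \<in> measurable (source_algebra I) N" and g: "g \<in> measurable (source_algebra J) N'"
    and "I \<inter> J = {}"
  shows "indep_var N f N' g"
proof -
  define K where "K b = (case b of True \<Rightarrow> I | False \<Rightarrow> J)" for b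
  have "indep_sets (\<lambda>j. sigma_sets (space M) (\<Union>i\<in>K j. source_sets i)) UNIV"
  proof (rule indep_sets_collect_sigma)
    show "indep_sets source_sets (\<Union>j\<in>UNIV. K j)"
      by (rule indep_sets_mono_index[OF _ indep_source_sets]) simp
    show "Int_stable (source_sets i)" for i
      by (auto simp: source_sets_def Int_stable_def split: source.split)
    show "disjoint_family_on K UNIV"
      using assms(3) by (auto simp: disjoint_family_on_def K_def split: bool.splits)
  qed
  then have "indep_sets (case_bool (sets (source_algebra I)) (sets (source_algebra J))) UNIV"
    by (rule indep_sets_mono_sets) (auto simp: sets_source_algebra K_def split: bool.splits)
  then have ind: "indep_set (sets (source_algebra I)) (sets (source_algebra J))"
    by (simp add: indep_set_def)
  note sigma = sigma_sets_vimage_source_algebra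
  show ?thesis
    unfolding indep_var_eq indep_sets2_eq
  proof (intro conjI ballI)
    show "random_variable N f" "random_variable N' g"
      using f g by (auto intro: measurable_source_algebra)
    show "sigma_sets (space M) {f -` D \<inter> space M |D. D \<in> sets N} \<subseteq> events"
      "sigma_sets (space M) {g -` D \<inter> space M |D. D \<in> sets N'} \<subseteq> events"
      using sigma[OF f] sigma[OF g] indep_setD_ev1[OF ind] indep_setD_ev2[OF ind] by blast+
    fix a b assume "a \<in> sigma_sets (space M) {f -` D \<inter> space M |D. D \<in> sets N}"
      "b \<in> sigma_sets (space M) {g -` D \<inter> space M |D. D \<in> sets N'}"
    then show "prob (a \<inter> b) = prob a * prob b"
      using sigma[OF f] sigma[OF g] by (intro indep_setD[OF ind]) auto
  qed
qed

lemma integral_indep_product: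
  fixes f g :: "'a \<Rightarrow> 'b::{real_normed_field, banach, second_countable_topology}"
  assumes "f \<in> borel_measurable (source_algebra I)" "g \<in> borel_measurable (source_algebra J)" "I \<inter> J = {}"
    and "integrable M f" "integrable M g"
  shows "integrable M (\<lambda>\<omega>. f \<omega> * g \<omega>)"
    and "expectation (\<lambda>\<omega>. f \<omega> * g \<omega>) = expectation f * expectation g"
  using indep_var_source_algebra[OF assms(1-3)] assms(4,5)
  by (auto intro: indep_var_integrable indep_var_lebesgue_integral)

text \<open>Causality: which sources may be left out of \<open>I\<close> is what the independence
  arguments exploit.\<close>

lemma measurable_state:
  assumes "Initial \<in> I" "\<And>j. j < n \<Longrightarrow> Process j \<in> I"
  shows "x n \<in> borel_measurable (source_algebra I)"
  using assms(2)
proof (induction n)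
  case 0
  then show ?case using assms(1) by (intro measurable_sources)
next
  case (Suc n)
  have [measurable]: "x n \<in> borel_measurable (source_algebra I)"
    "w n \<in> borel_measurable (source_algebra I)"
    using Suc by (auto intro: measurable_sources)
  have "(\<lambda>\<omega>. A *v x n \<omega> + B *v w n \<omega>) \<in> borel_measurable (source_algebra I)" by measurable
  then show ?case
    by (subst measurable_cong[where g = "\<lambda>\<omega>. A *v x n \<omega> + B *v w n \<omega>"]) (auto simp: state)
qed

lemma measurable_observation:
  assumes "Initial \<in> I" "\<And>j. j < n \<Longrightarrow> Process j \<in> I" "Measurement n \<in> I" "Channel n \<in> I"
  shows "y n \<in> borel_measurable (source_algebra I)"
proof -
  have [measurable]: "x n \<in> borel_measurable (source_algebra I)"
    "v n \<in> borel_measurable (source_algebra I)" "\<beta> n \<in> borel_measurable (source_algebra I)"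
    using assms by (auto intro: measurable_sources measurable_state)
  have "(\<lambda>\<omega>. \<beta> n \<omega> *\<^sub>R (C *v x n \<omega> + v n \<omega>)) \<in> borel_measurable (source_algebra I)" by measurable
  then show ?thesis
    by (subst measurable_cong[where g = "\<lambda>\<omega>. \<beta> n \<omega> *\<^sub>R (C *v x n \<omega> + v n \<omega>)"]) (auto simp: observation)
qed

lemma measurable_x [measurable]: "x n \<in> borel_measurable M"
  by (rule measurable_source_algebra[where I = UNIV], rule measurable_state) auto

lemma measurable_y [measurable]: "y n \<in> borel_measurable M"
  by (rule measurable_source_algebra[where I = UNIV], rule measurable_observation) auto

declare measurable_w [measurable] measurable_v [measurable] measurable_\<beta> [measurable]

lemma gaussian_sources:
  "gaussian (\<lambda>\<omega>. a \<bullet> x 0 \<omega>)" "gaussian (\<lambda>\<omega>. b \<bullet> w n \<omega>)" "gaussian (\<lambda>\<omega>. c \<bullet> v n \<omega>)"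
proof -
  show "gaussian (\<lambda>\<omega>. a \<bullet> x 0 \<omega>)" using jointly_gaussian[of a _ _ 0] by simp
  show "gaussian (\<lambda>\<omega>. b \<bullet> w n \<omega>)"
    using jointly_gaussian[of 0 "\<lambda>k. if k = n then b else 0" "\<lambda>_. 0" "Suc n"]
    by (simp add: if_distrib[of "\<lambda>x. x \<bullet> _"] cong: if_cong)
  show "gaussian (\<lambda>\<omega>. c \<bullet> v n \<omega>)"
    using jointly_gaussian[of 0 "\<lambda>_. 0" "\<lambda>k. if k = n then c else 0" "Suc n"]
    by (simp add: if_distrib[of "\<lambda>x. x \<bullet> _"] cong: if_cong)
qed

lemma square_integrable_sources:
  "integrable M (\<lambda>\<omega>. (norm (x 0 \<omega>))\<^sup>2)" "integrable M (\<lambda>\<omega>. (norm (w n \<omega>))\<^sup>2)"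
  "integrable M (\<lambda>\<omega>. (norm (v n \<omega>))\<^sup>2)"
  by (auto intro: gaussian_vector_square_integrable gaussian_sources)

lemma integrable_sources:
  "integrable M (x 0)" "integrable M (w n)" "integrable M (v n)"
  by (auto intro!: square_integrable_imp_integrable square_integrable_sources)

lemma square_expectation_sources:
  "expectation (\<lambda>\<omega>. (norm (x 0 \<omega>))\<^sup>2) \<le> CARD('m) * \<sigma>\<^sup>2"
  "expectation (\<lambda>\<omega>. (norm (w n \<omega>))\<^sup>2) \<le> CARD('g) * \<sigma>\<^sup>2"
  "expectation (\<lambda>\<omega>. (norm (v n \<omega>))\<^sup>2) \<le> CARD('l) * \<sigma>\<^sup>2"
  using second_moment_upper[OF _ square_integrable_sources(1) moment_x0]
    second_moment_upper[OF _ square_integrable_sources(2) moment_w_upper]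
    second_moment_upper[OF _ square_integrable_sources(3) moment_v_upper]
  by auto

section \<open>The erasure channel\<close>

lemma erasure_probability: "0 \<le> p\<^sub>e" "p\<^sub>e \<le> 1"
  using erased[of 0] by (metis measure_nonneg, metis prob_le_1)

lemma channel_values: "AE \<omega> in M. \<beta> n \<omega> = 0 \<or> \<beta> n \<omega> = 1"
proof -
  have "prob ({\<omega> \<in> space M. \<beta> n \<omega> = 0} \<union> {\<omega> \<in> space M. \<beta> n \<omega> = 1}) = p\<^sub>e + (1 - p\<^sub>e)"
    by (subst finite_measure_Union) (auto simp: erased received)
  then have "prob {\<omega> \<in> space M. \<beta> n \<omega> = 0 \<or> \<beta> n \<omega> = 1} = 1"
    by (simp add: Collect_disj_eq[symmetric] conj_disj_distribL[symmetric] Un_def)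
  then show ?thesis by (subst (asm) prob_Collect_eq_1) auto
qed

lemma expectation_channel:
  fixes f :: "real \<Rightarrow> real"
  assumes [measurable]: "f \<in> borel_measurable borel"
  shows "integrable M (\<lambda>\<omega>. f (\<beta> n \<omega>))"
    and "expectation (\<lambda>\<omega>. f (\<beta> n \<omega>)) = p\<^sub>e * f 0 + (1 - p\<^sub>e) * f 1"
proof -
  define F where "F \<omega> = f 0 * indicator {\<omega> \<in> space M. \<beta> n \<omega> = 0} \<omega> + f 1 * indicator {\<omega> \<in> space M. \<beta> n \<omega> = 1} \<omega>" for \<omega>
  have [measurable]: "F \<in> borel_measurable M" unfolding F_def by measurable
  have ae: "AE \<omega> in M. f (\<beta> n \<omega>) = F \<omega>"
    using channel_values[of n] AE_space by eventually_elim (auto simp: F_def)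
  have "integrable M F" unfolding F_def by (auto intro!: integrable_real_indicator simp: emeasure_eq_measure)
  then show "integrable M (\<lambda>\<omega>. f (\<beta> n \<omega>))"
    by (subst integrable_cong_AE[OF _ _ ae]) auto
  have "expectation (\<lambda>\<omega>. f (\<beta> n \<omega>)) = expectation F"
    by (intro integral_cong_AE ae) auto
  also have "\<dots> = f 0 * prob {\<omega> \<in> space M. \<beta> n \<omega> = 0} + f 1 * prob {\<omega> \<in> space M. \<beta> n \<omega> = 1}"
    unfolding F_def by (subst Bochner_Integration.integral_add) (auto simp: emeasure_eq_measure)
  finally show "expectation (\<lambda>\<omega>. f (\<beta> n \<omega>)) = p\<^sub>e * f 0 + (1 - p\<^sub>e) * f 1"
    by (simp add: erased received)
qed

text \<open>Used twice: with the indicator of 0 it gives the probability of a run of erasures, and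
  with a small value off 0 it gives the exponential moment in the Chernoff bound.\<close>

lemma expectation_channel_product:
  fixes f :: "real \<Rightarrow> real"
  assumes [measurable]: "f \<in> borel_measurable borel" and "finite I"
  shows "integrable M (\<lambda>\<omega>. \<Prod>n\<in>I. f (\<beta> n \<omega>))"
    and "expectation (\<lambda>\<omega>. \<Prod>n\<in>I. f (\<beta> n \<omega>)) = (p\<^sub>e * f 0 + (1 - p\<^sub>e) * f 1) ^ card I"
proof -
  have "integrable M (\<lambda>\<omega>. \<Prod>n\<in>I. f (\<beta> n \<omega>)) \<and>
      expectation (\<lambda>\<omega>. \<Prod>n\<in>I. f (\<beta> n \<omega>)) = (p\<^sub>e * f 0 + (1 - p\<^sub>e) * f 1) ^ card I"
    using assms(2)
  proof (induction I rule: finite_induct)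
    case empty
    then show ?case by (simp add: prob_space)
  next
    case (insert k I)
    have meas: "(\<lambda>\<omega>. f (\<beta> n \<omega>)) \<in> borel_measurable (source_algebra (Channel ` J))" if "n \<in> J" for n J
      using that by (intro measurable_compose[OF measurable_sources(4) assms(1)]) auto
    have k: "(\<lambda>\<omega>. f (\<beta> k \<omega>)) \<in> borel_measurable (source_algebra (Channel ` {k}))"
      by (rule meas) simp
    have I: "(\<lambda>\<omega>. \<Prod>n\<in>I. f (\<beta> n \<omega>)) \<in> borel_measurable (source_algebra (Channel ` I))"
      by (intro borel_measurable_prod meas)
    have "Channel ` {k} \<inter> Channel ` I = {}" using insert.hyps by auto
    from integral_indep_product[OF k I this expectation_channel(1)[OF assms(1)]] insert show ?case
      by (simp add: expectation_channel(2))
  qed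
  then show "integrable M (\<lambda>\<omega>. \<Prod>n\<in>I. f (\<beta> n \<omega>))"
    and "expectation (\<lambda>\<omega>. \<Prod>n\<in>I. f (\<beta> n \<omega>)) = (p\<^sub>e * f 0 + (1 - p\<^sub>e) * f 1) ^ card I"
    by auto
qed

lemma mean_zero_sources:
  "bounded_linear f \<Longrightarrow> expectation (\<lambda>\<omega>. f (w n \<omega>)) = 0"
  "bounded_linear g \<Longrightarrow> expectation (\<lambda>\<omega>. g (v n \<omega>)) = 0"
  "bounded_linear h \<Longrightarrow> expectation (\<lambda>\<omega>. h (x 0 \<omega>)) = 0"
  by (auto simp: integral_bounded_linear[OF _ integrable_sources(1)] integral_bounded_linear[OF _ integrable_sources(2)]
      integral_bounded_linear[OF _ integrable_sources(3)] mean_w mean_v mean_x0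
      linear_0 bounded_linear.linear)

end

section \<open>Necessity\<close>

lemma hdot_add: "hdot u (s + t) = hdot u s + hdot u t"
  by (simp add: hdot_def distrib_left sum.distrib)

lemma bounded_linear_hdot: "bounded_linear (hdot u)"
  unfolding hdot_def[abs_def]
  by (intro bounded_linear_sum bounded_linear_const_mult bounded_linear_vec_nth)

text \<open>Since \<open>hdot\<close> conjugates its first argument, conjugating \<open>a\<close>
  beforehand leaves a bilinear pairing, under which \<open>D\<close> moves across as its
  transpose.\<close>

lemma hdot_matrix_vector:
  fixes D :: "complex^'m^'l"
  shows "hdot (\<chi> i. cnj (a $ i)) (D *v t) = hdot (\<chi> j. cnj ((transpose D *v a) $ j)) t"
proof -
  have "hdot (\<chi> i. cnj (a $ i)) (D *v t) = (\<Sum>i\<in>UNIV. \<Sum>j\<in>UNIV. a $ i * (D $ i $ j * t $ j))"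
    by (simp add: hdot_def matrix_vector_mult_def sum_distrib_left)
  also have "\<dots> = (\<Sum>j\<in>UNIV. \<Sum>i\<in>UNIV. a $ i * (D $ i $ j * t $ j))"
    by (rule sum.swap)
  also have "\<dots> = hdot (\<chi> j. cnj ((transpose D *v a) $ j)) t"
    by (simp add: hdot_def matrix_vector_mult_def transpose_def sum_distrib_left sum_distrib_right mult_ac
        del: transpose_matrix_vector)
  finally show ?thesis .
qed

text \<open>The functional of a left eigenvector reduces the system to a scalar one with multiplier
  \<open>z\<close>. Controllability makes \<open>b\<close> nonzero, so the process noise excites
  this mode at each step.\<close>

lemma controllable_left_eigenfunctional:
  assumes "controllable A B" "eigenvalue A z"
  shows "\<exists>u b. b \<noteq> 0 \<and> (\<forall>t. hdot u (A *v t) = z * hdot u t) \<and> (\<forall>t. hdot u (B *v t) = hdot b t)"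
proof -
  obtain a where a: "a \<noteq> 0" "transpose A *v a = z *s a"
    using eigenvalue_transpose[OF assms(2)] unfolding eigenvalue_def by blast
  have "transpose B *v a \<noteq> 0" using controllable_left_eigenvector[OF assms(1) a(2)] a(1) by blast
  then have "(\<chi> j. cnj ((transpose B *v a) $ j)) \<noteq> 0"
    by (auto simp: vec_eq_iff simp del: transpose_matrix_vector)
  moreover have "hdot (\<chi> i. cnj (a $ i)) (A *v t) = z * hdot (\<chi> i. cnj (a $ i)) t" for t
    unfolding hdot_matrix_vector a(2) by (simp add: hdot_def sum_distrib_left mult_ac)
  ultimately show ?thesis using hdot_matrix_vector[of a B] by blast
qed

context prob_space
begin

text \<open>By \<open>coeff\<close> and \<open>orth\<close> the sum of the \<open>U i\<close> is the
  orthogonal projection of \<open>e\<close> onto their span. With S the sum of their square norms,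
  the square of the distance is the square norm of \<open>e\<close> minus 2S plus S, and it is
  nonnegative.\<close>

lemma bessel_inequality:
  fixes e :: "'a \<Rightarrow> complex" and U :: "'i \<Rightarrow> 'a \<Rightarrow> complex"
  assumes "finite I"
    and [measurable]: "e \<in> borel_measurable M" "\<And>i. U i \<in> borel_measurable M"
    and sq: "integrable M (\<lambda>\<omega>. (cmod (e \<omega>))\<^sup>2)" "\<And>i. i \<in> I \<Longrightarrow> integrable M (\<lambda>\<omega>. (cmod (U i \<omega>))\<^sup>2)"
    and coeff: "\<And>i. i \<in> I \<Longrightarrow> expectation (\<lambda>\<omega>. e \<omega> * cnj (U i \<omega>)) = complex_of_real (expectation (\<lambda>\<omega>. (cmod (U i \<omega>))\<^sup>2))"
    and orth: "\<And>i j. i \<in> I \<Longrightarrow> j \<in> I \<Longrightarrow> i \<noteq> j \<Longrightarrow> expectation (\<lambda>\<omega>. U i \<omega> * cnj (U j \<omega>)) = 0"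
  shows "(\<Sum>i\<in>I. expectation (\<lambda>\<omega>. (cmod (U i \<omega>))\<^sup>2)) \<le> expectation (\<lambda>\<omega>. (cmod (e \<omega>))\<^sup>2)"
proof -
  define S where "S = (\<Sum>i\<in>I. expectation (\<lambda>\<omega>. (cmod (U i \<omega>))\<^sup>2))"
  have int_e: "integrable M (\<lambda>\<omega>. e \<omega> * cnj (U i \<omega>))" if "i \<in> I" for i
    by (rule square_integrable_product) (auto simp: sq that)
  have int_U: "integrable M (\<lambda>\<omega>. U i \<omega> * cnj (U j \<omega>))" if "i \<in> I" "j \<in> I" for i j
    by (rule square_integrable_product) (auto simp: sq that)
  have self: "expectation (\<lambda>\<omega>. U i \<omega> * cnj (U i \<omega>)) = complex_of_real (expectation (\<lambda>\<omega>. (cmod (U i \<omega>))\<^sup>2))" for i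
    unfolding complex_norm_square[symmetric] by (rule integral_complex_of_real)
  have eU: "expectation (\<lambda>\<omega>. \<Sum>i\<in>I. e \<omega> * cnj (U i \<omega>)) = complex_of_real S"
    using int_e coeff by (simp add: Bochner_Integration.integral_sum S_def)
  have UU: "expectation (\<lambda>\<omega>. \<Sum>i\<in>I. \<Sum>j\<in>I. U i \<omega> * cnj (U j \<omega>)) = complex_of_real S"
  proof -
    have "expectation (\<lambda>\<omega>. \<Sum>i\<in>I. \<Sum>j\<in>I. U i \<omega> * cnj (U j \<omega>))
        = (\<Sum>i\<in>I. \<Sum>j\<in>I. expectation (\<lambda>\<omega>. U i \<omega> * cnj (U j \<omega>)))"
      using int_U by (simp add: Bochner_Integration.integral_sum)
    also have "\<dots> = (\<Sum>i\<in>I. \<Sum>j\<in>I. if i = j then complex_of_real (expectation (\<lambda>\<omega>. (cmod (U i \<omega>))\<^sup>2)) else 0)"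
      using orth self by (intro sum.cong) auto
    also have "\<dots> = complex_of_real S" using assms(1) by (simp add: S_def)
    finally show ?thesis .
  qed
  have int: "integrable M (\<lambda>\<omega>. \<Sum>i\<in>I. e \<omega> * cnj (U i \<omega>))" "integrable M (\<lambda>\<omega>. \<Sum>i\<in>I. \<Sum>j\<in>I. U i \<omega> * cnj (U j \<omega>))"
    using int_e int_U by auto
  have "(cmod (e \<omega> - (\<Sum>i\<in>I. U i \<omega>)))\<^sup>2
      = (cmod (e \<omega>))\<^sup>2 - 2 * Re (\<Sum>i\<in>I. e \<omega> * cnj (U i \<omega>)) + Re (\<Sum>i\<in>I. \<Sum>j\<in>I. U i \<omega> * cnj (U j \<omega>))" for \<omega>
  proof -
    define s where "s = (\<Sum>i\<in>I. U i \<omega>)"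
    have "(\<Sum>i\<in>I. e \<omega> * cnj (U i \<omega>)) = e \<omega> * cnj s" "(\<Sum>i\<in>I. \<Sum>j\<in>I. U i \<omega> * cnj (U j \<omega>)) = s * cnj s"
      unfolding s_def cnj_sum sum_product by (simp_all add: sum_distrib_left)
    then show ?thesis
      unfolding s_def[symmetric] cmod_power2 by (simp add: power2_eq_square algebra_simps)
  qed
  then have "0 \<le> expectation (\<lambda>\<omega>. (cmod (e \<omega>))\<^sup>2 - 2 * Re (\<Sum>i\<in>I. e \<omega> * cnj (U i \<omega>)) +
      Re (\<Sum>i\<in>I. \<Sum>j\<in>I. U i \<omega> * cnj (U j \<omega>)))"
    by (intro integral_nonneg_AE AE_I2) (metis zero_le_power2)
  also have "\<dots> = expectation (\<lambda>\<omega>. (cmod (e \<omega>))\<^sup>2) - 2 * S + S"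
    using sq(1) int eU UU
    by (simp only: Bochner_Integration.integral_add Bochner_Integration.integral_diff integrable_Re
        Bochner_Integration.integrable_diff integrable_mult_right integral_mult_right_zero integral_Re Re_complex_of_real)
  finally show ?thesis by (simp add: S_def)
qed

end

context intermittent_system
begin

text \<open>Brings a real component of the state into the form required by
  \<open>jointly_gaussian\<close>; \<open>adjoint\<close> refers to the real inner product used
  there.\<close>

lemma state_linear_form:
  "\<exists>a\<^sub>0 b. \<forall>\<omega>\<in>space M. a \<bullet> x n \<omega> = a\<^sub>0 \<bullet> x 0 \<omega> + (\<Sum>k<n. b k \<bullet> w k \<omega>)"
proof (induction n arbitrary: a)
  case 0
  show ?case by (intro exI[of _ a]) simp
next
  case (Suc n)
  obtain a\<^sub>0 b where IH: "\<And>\<omega>. \<omega> \<in> space M \<Longrightarrow>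
      adjoint ((*v) A) a \<bullet> x n \<omega> = a\<^sub>0 \<bullet> x 0 \<omega> + (\<Sum>k<n. b k \<bullet> w k \<omega>)"
    using Suc[of "adjoint ((*v) A) a"] by blast
  have "a \<bullet> x (Suc n) \<omega> = a\<^sub>0 \<bullet> x 0 \<omega> + (\<Sum>k<Suc n. (b(n := adjoint ((*v) B) a)) k \<bullet> w k \<omega>)"
    if "\<omega> \<in> space M" for \<omega>
    using IH[OF that]
    by (simp add: state[OF that] inner_add_right adjoint_clauses bounded_linear.linear[OF matrix_vector_mul_bounded_linear])
  then show ?case by blast
qed

text \<open>In a suitable real direction \<open>a\<close> the measurement noise has positive
  variance. It is independent of the state, so the component of the observation along
  \<open>a\<close> is a Gaussian variable of positive variance and mean zero, which avoids 0 almost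
  surely.\<close>

lemma unerased_observation_nonzero:
  assumes "\<sigma>' > 0"
  shows "AE \<omega> in M. C *v x n \<omega> + v n \<omega> \<noteq> 0"
proof -
  \<comment> \<open>If all directions had variance zero, the second moment of the noise would
    vanish, against its lower bound.\<close>
  obtain a where a: "expectation (\<lambda>\<omega>. (a \<bullet> v n \<omega>)\<^sup>2) > 0"
  proof (rule ccontr)
    assume "\<not> thesis"
    then have "expectation (\<lambda>\<omega>. (b \<bullet> v n \<omega>)\<^sup>2) = 0" for b
      using that by (meson Bochner_Integration.integral_nonneg not_less order_antisym zero_le_power2)
    moreover have "(norm (v n \<omega>))\<^sup>2 = (\<Sum>b\<in>Basis. (b \<bullet> v n \<omega>)\<^sup>2)" for \<omega>
      unfolding power2_norm_eq_inner
      by (subst euclidean_inner) (simp add: power2_eq_square inner_commute)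
    moreover have "integrable M (\<lambda>\<omega>. (b \<bullet> v n \<omega>)\<^sup>2)" for b
      by (rule gaussian_square_integrable[OF gaussian_sources(3)]) simp
    ultimately have "expectation (\<lambda>\<omega>. (norm (v n \<omega>))\<^sup>2) = 0"
      by (simp add: Bochner_Integration.integral_sum)
    moreover have "\<sigma>'\<^sup>2 \<le> expectation (\<lambda>\<omega>. (cmod (hdot (axis undefined 1) (v n \<omega>)))\<^sup>2)"
      using second_moment_lower[OF _ square_integrable_sources(3) moment_v_lower, where u = "axis undefined 1"]
      unfolding norm_vec_power2[of "axis undefined 1"]
      by (simp add: axis_def if_distrib[of cmod] if_distrib[of "\<lambda>t. t\<^sup>2"] cong: if_cong)
    moreover have "\<dots> \<le> expectation (\<lambda>\<omega>. (norm (v n \<omega>))\<^sup>2)"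
      by (intro integral_mono square_integrable_hdot square_integrable_sources)
        (auto intro!: power_mono Finite_Cartesian_Product.norm_nth_le)
    ultimately show False using assms zero_less_power[of \<sigma>' 2] by linarith
  qed
  obtain a\<^sub>0 b where ab: "\<And>\<omega>. \<omega> \<in> space M \<Longrightarrow>
      adjoint ((*v) C) a \<bullet> x n \<omega> = a\<^sub>0 \<bullet> x 0 \<omega> + (\<Sum>k<n. b k \<bullet> w k \<omega>)"
    using state_linear_form by blast
  define X where "X \<omega> = a\<^sub>0 \<bullet> x 0 \<omega> + (\<Sum>k<n. b k \<bullet> w k \<omega>)" for \<omega>
  define V where "V \<omega> = a \<bullet> v n \<omega>" for \<omega>
  have [measurable]: "X \<in> borel_measurable M" "V \<in> borel_measurable M"
    unfolding X_def V_def by measurable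
  have X: "gaussian X"
    using jointly_gaussian[of a\<^sub>0 b "\<lambda>_. 0" n] by (simp add: X_def[abs_def])
  \<comment> \<open>\<open>v n\<close> requires the sum to run up to \<open>Suc n\<close>; the
    coefficient of \<open>w n\<close>, which does not occur in \<open>X\<close>, is therefore set to
    0.\<close>
  have XV: "gaussian (\<lambda>\<omega>. X \<omega> + V \<omega>)"
    using jointly_gaussian[of a\<^sub>0 "b(n := 0)" "\<lambda>k. if k = n then a else 0" "Suc n"]
    by (simp add: X_def V_def add.assoc)
  have sq: "integrable M (\<lambda>\<omega>. (X \<omega>)\<^sup>2)" "integrable M (\<lambda>\<omega>. (V \<omega>)\<^sup>2)"
    using gaussian_square_integrable[OF X] gaussian_square_integrable[OF gaussian_sources(3)]
    by (auto simp: V_def)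
  then have int: "integrable M X" "integrable M V"
    using square_integrable_imp_integrable[of X] square_integrable_imp_integrable[of V] by simp_all
  have "X \<in> borel_measurable (source_algebra (- {Measurement n}))"
    unfolding X_def
    by (intro borel_measurable_add borel_measurable_sum borel_measurable_inner borel_measurable_const
        measurable_sources) auto
  moreover have "V \<in> borel_measurable (source_algebra {Measurement n})"
    unfolding V_def by (intro borel_measurable_inner borel_measurable_const measurable_sources) auto
  ultimately have prod: "integrable M (\<lambda>\<omega>. X \<omega> * V \<omega>)" "expectation (\<lambda>\<omega>. X \<omega> * V \<omega>) = expectation X * expectation V"
    using int by (auto intro!: integral_indep_product)
  have "expectation V = 0"
    unfolding V_def by (rule mean_zero_sources(2)) (rule bounded_linear_inner_right)
  have "expectation X = 0"
    unfolding X_def using integrable_sources mean_zero_sources(1,3)[OF bounded_linear_inner_right]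
    by (simp add: Bochner_Integration.integral_add Bochner_Integration.integral_sum)
  have "expectation (\<lambda>\<omega>. (X \<omega> + V \<omega>)\<^sup>2) = expectation (\<lambda>\<omega>. (X \<omega>)\<^sup>2 + 2 * (X \<omega> * V \<omega>) + (V \<omega>)\<^sup>2)"
    by (simp add: power2_sum mult_ac add_ac)
  also have "\<dots> = expectation (\<lambda>\<omega>. (X \<omega>)\<^sup>2) + expectation (\<lambda>\<omega>. (V \<omega>)\<^sup>2)"
    using sq prod \<open>expectation V = 0\<close> by simp
  also have "\<dots> > 0" using a by (simp add: V_def add_nonneg_pos)
  finally have "AE \<omega> in M. X \<omega> + V \<omega> \<noteq> 0"
    using int \<open>expectation V = 0\<close> \<open>expectation X = 0\<close> by (intro gaussian_nonzero[OF XV]) auto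
  then show ?thesis
    using AE_space
  proof eventually_elim
    case (elim \<omega>)
    have "a \<bullet> (C *v x n \<omega> + v n \<omega>) = X \<omega> + V \<omega>"
      using ab[OF elim(2)]
      by (simp add: X_def V_def inner_add_right adjoint_clauses bounded_linear.linear[OF matrix_vector_mul_bounded_linear])
    then show ?case using elim(1) by auto
  qed
qed

lemma erasure_error_lower_bound:
  fixes h :: "(nat \<Rightarrow> complex^'l) \<Rightarrow> complex^'m"
  assumes h: "h \<in> borel_measurable (PiM {..n} (\<lambda>_. borel))"
    and sq: "integrable M (\<lambda>\<omega>. (norm (x n \<omega> - h (\<lambda>k\<in>{..n}. y k \<omega>)))\<^sup>2)"
    and u: "\<And>t. hdot u (A *v t) = z * hdot u t" and b: "\<And>t. hdot u (B *v t) = hdot b t"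
  shows "(\<Sum>i<n. p\<^sub>e ^ (n - i) * (cmod z)\<^sup>2 ^ (n - Suc i) * (\<sigma>'\<^sup>2 * (norm b)\<^sup>2))
    \<le> expectation (\<lambda>\<omega>. (cmod (hdot u (x n \<omega> - h (\<lambda>k\<in>{..n}. y k \<omega>))))\<^sup>2)"
proof -
  define e where "e \<omega> = hdot u (x n \<omega> - h (\<lambda>k\<in>{..n}. y k \<omega>))" for \<omega>
  define W where "W i \<omega> = hdot b (w i \<omega>)" for i \<omega>
  \<comment> \<open>Indicator of the event that all observations after time \<open>i\<close> are
    erased. Observation \<open>i\<close> itself may be received, because \<open>w i\<close> first
    enters \<open>x (Suc i)\<close>.\<close>
  define g where "g i \<omega> = (\<Prod>k\<in>{i<..n}. if \<beta> k \<omega> = 0 then 1 else 0 :: real)" for i \<omega>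
  \<comment> \<open>The contribution of \<open>w i\<close> to \<open>hdot u (x n \<omega>)\<close>,
    restricted to that event.\<close>
  define U where "U i \<omega> = complex_of_real (g i \<omega>) * z ^ (n - Suc i) * W i \<omega>" for i \<omega>
  have g01: "g i \<omega> = 0 \<or> g i \<omega> = 1" for i \<omega>
    unfolding g_def by (induction rule: infinite_finite_induct) auto
  have [measurable]: "(\<lambda>\<omega>. h (\<lambda>k\<in>{..n}. y k \<omega>)) \<in> borel_measurable M"
    by (rule measurable_compose[OF _ h]) measurable
  have [measurable]: "e \<in> borel_measurable M" unfolding e_def by measurable
  have W_meas: "W i \<in> borel_measurable (source_algebra I)" if "Process i \<in> I" for i I
    unfolding W_def by (intro borel_measurable_hdot measurable_sources that)
  have g_meas: "g i \<in> borel_measurable (source_algebra I)" if "range Channel \<subseteq> I" for i I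
  proof -
    have [measurable]: "\<beta> k \<in> borel_measurable (source_algebra I)" for k
      using that by (intro measurable_sources) auto
    show ?thesis unfolding g_def by measurable
  qed
  have U_meas: "U i \<in> borel_measurable (source_algebra I)" if "range Channel \<subseteq> I" "Process i \<in> I" for i I
    using g_meas[OF that(1)] W_meas[OF that(2)] unfolding U_def by measurable
  have [measurable]: "W i \<in> borel_measurable M" "g i \<in> borel_measurable M" "U i \<in> borel_measurable M" for i
    using W_meas[of i UNIV] g_meas[of UNIV i] U_meas[of UNIV i] by (auto intro: measurable_source_algebra)
  have sqe: "integrable M (\<lambda>\<omega>. (cmod (e \<omega>))\<^sup>2)"
    unfolding e_def by (rule square_integrable_hdot[OF _ sq]) simp
  have sqW: "integrable M (\<lambda>\<omega>. (cmod (W i \<omega>))\<^sup>2)" for i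
    unfolding W_def by (rule square_integrable_hdot[OF _ square_integrable_sources(2)]) simp
  have W0: "expectation (\<lambda>\<omega>. cnj (W i \<omega>)) = 0" for i
    using mean_zero_sources(1)[OF bounded_linear_hdot, of b i] by (simp add: W_def)
  have intW: "integrable M (\<lambda>\<omega>. cnj (W i \<omega>))" for i
    using square_integrable_imp_integrable[OF _ sqW] by simp
  have W_lower: "\<sigma>'\<^sup>2 * (norm b)\<^sup>2 \<le> expectation (\<lambda>\<omega>. (cmod (W i \<omega>))\<^sup>2)" for i
    unfolding W_def by (rule second_moment_lower[OF _ square_integrable_sources(2) moment_w_lower]) simp
  have U_square: "(cmod (U i \<omega>))\<^sup>2 = (cmod z)\<^sup>2 ^ (n - Suc i) * (g i \<omega> * (cmod (W i \<omega>))\<^sup>2)" for i \<omega>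
    using g01[of i \<omega>] by (auto simp: U_def norm_mult norm_power power_mult_distrib power_mult[symmetric] mult.commute)
  have U: "integrable M (\<lambda>\<omega>. (cmod (U i \<omega>))\<^sup>2)"
    "expectation (\<lambda>\<omega>. (cmod (U i \<omega>))\<^sup>2) = p\<^sub>e ^ (n - i) * (cmod z)\<^sup>2 ^ (n - Suc i) * expectation (\<lambda>\<omega>. (cmod (W i \<omega>))\<^sup>2)"
    for i
  proof -
    have g: "integrable M (g i)" "expectation (g i) = p\<^sub>e ^ (n - i)"
      using expectation_channel_product[of "\<lambda>t. if t = 0 then 1 else 0" "{i<..n}"]
      by (simp_all add: g_def[abs_def])
    have "(\<lambda>\<omega>. (cmod (W i \<omega>))\<^sup>2) \<in> borel_measurable (source_algebra {Process i})"
      using W_meas[of i "{Process i}"] by measurable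
    from integral_indep_product[OF g_meas[of "range Channel" i] this _ g(1) sqW]
    have "integrable M (\<lambda>\<omega>. g i \<omega> * (cmod (W i \<omega>))\<^sup>2)"
      "expectation (\<lambda>\<omega>. g i \<omega> * (cmod (W i \<omega>))\<^sup>2) = p\<^sub>e ^ (n - i) * expectation (\<lambda>\<omega>. (cmod (W i \<omega>))\<^sup>2)"
      using g(2) by auto
    then show "integrable M (\<lambda>\<omega>. (cmod (U i \<omega>))\<^sup>2)"
      "expectation (\<lambda>\<omega>. (cmod (U i \<omega>))\<^sup>2) = p\<^sub>e ^ (n - i) * (cmod z)\<^sup>2 ^ (n - Suc i) * expectation (\<lambda>\<omega>. (cmod (W i \<omega>))\<^sup>2)"
      unfolding U_square by simp_all
  qed
  have orth: "expectation (\<lambda>\<omega>. Q \<omega> * cnj (W i \<omega>)) = 0"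
    if "Q \<in> borel_measurable (source_algebra (- {Process i}))" "integrable M Q" for Q i
  proof -
    have "(\<lambda>\<omega>. cnj (W i \<omega>)) \<in> borel_measurable (source_algebra {Process i})"
      using W_meas[of i "{Process i}"] by measurable
    from integral_indep_product(2)[OF that(1) this _ that(2) intW] W0 show ?thesis by simp
  qed
  have innovations: "hdot u (x k \<omega>) = z ^ k * hdot u (x 0 \<omega>) + (\<Sum>j<k. z ^ (k - Suc j) * W j \<omega>)"
    if "\<omega> \<in> space M" for k \<omega>
  proof (induction k)
    case (Suc k)
    have "(\<Sum>j<k. z ^ (Suc k - Suc j) * W j \<omega>) = z * (\<Sum>j<k. z ^ (k - Suc j) * W j \<omega>)"
      unfolding sum_distrib_left
    proof (rule sum.cong)
      fix j assume "j \<in> {..<k}"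
      then have "Suc k - Suc j = Suc (k - Suc j)" by auto
      then show "z ^ (Suc k - Suc j) * W j \<omega> = z * (z ^ (k - Suc j) * W j \<omega>)" by simp
    qed simp
    then show ?case
      by (simp add: state[OF that] hdot_add u b Suc W_def distrib_left mult.assoc)
  qed simp
  have coeff: "expectation (\<lambda>\<omega>. e \<omega> * cnj (U i \<omega>)) = complex_of_real (expectation (\<lambda>\<omega>. (cmod (U i \<omega>))\<^sup>2))"
    if i: "i \<in> {..<n}" for i
  proof -
    define \<zeta> where "\<zeta> \<omega> = h (\<lambda>k\<in>{..n}. if k \<le> i then y k \<omega> else 0)" for \<omega>
    define R where "R \<omega> = g i \<omega> * (z ^ n * hdot u (x 0 \<omega>) + (\<Sum>j\<in>{..<n} - {i}. z ^ (n - Suc j) * W j \<omega>) - hdot u (\<zeta> \<omega>))" for \<omega>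
    \<comment> \<open>On the support of \<open>g i\<close> the estimate does not see the observations after time \<open>i\<close>, and \<open>R\<close> is the part
      of the error that does not depend on \<open>w i\<close>.\<close>
    define Q where "Q \<omega> = R \<omega> * cnj (g i \<omega> * z ^ (n - Suc i))" for \<omega>
    have "(\<lambda>\<omega>. if k \<le> i then y k \<omega> else 0) \<in> borel_measurable (source_algebra (- {Process i}))" for k
    proof (cases "k \<le> i")
      case True
      then have "y k \<in> borel_measurable (source_algebra (- {Process i}))"
        by (intro measurable_observation) auto
      then show ?thesis using True by simp
    qed simp
    then have [measurable]: "\<zeta> \<in> borel_measurable (source_algebra (- {Process i}))"
      unfolding \<zeta>_def by (intro measurable_compose[OF _ h] measurable_restrict)
    have [measurable]: "g i \<in> borel_measurable (source_algebra (- {Process i}))"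
      "x 0 \<in> borel_measurable (source_algebra (- {Process i}))"
      by (intro g_meas, force, intro measurable_sources, simp)
    have [measurable]: "(\<lambda>\<omega>. \<Sum>j\<in>{..<n} - {i}. z ^ (n - Suc j) * W j \<omega>) \<in> borel_measurable (source_algebra (- {Process i}))"
      by (intro borel_measurable_sum borel_measurable_times borel_measurable_const W_meas) auto
    have R_meas[measurable]: "R \<in> borel_measurable (source_algebra (- {Process i}))"
      unfolding R_def by measurable
    have Q_meas: "Q \<in> borel_measurable (source_algebra (- {Process i}))"
      unfolding Q_def by measurable
    have R: "g i \<omega> * e \<omega> = U i \<omega> + R \<omega>" if \<omega>: "\<omega> \<in> space M" for \<omega>
    proof (cases "g i \<omega> = 0")
      case False
      then have "\<beta> k \<omega> = 0" if "k \<in> {i<..n}" for k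
        using that unfolding g_def by (auto simp: prod_zero_iff split: if_splits)
      \<comment> \<open>An erased observation equals 0, the value that \<open>\<zeta>\<close> puts
        at the times after \<open>i\<close>.\<close>
      then have "(\<lambda>k\<in>{..n}. y k \<omega>) = (\<lambda>k\<in>{..n}. if k \<le> i then y k \<omega> else 0)"
        by (auto simp: fun_eq_iff observation[OF \<omega>])
      then have "e \<omega> = hdot u (x n \<omega>) - hdot u (\<zeta> \<omega>)" by (simp add: e_def \<zeta>_def hdot_diff)
      also have "hdot u (x n \<omega>) = z ^ n * hdot u (x 0 \<omega>) +
          (z ^ (n - Suc i) * W i \<omega> + (\<Sum>j\<in>{..<n} - {i}. z ^ (n - Suc j) * W j \<omega>))"
        by (subst innovations[OF \<omega>], subst sum.remove[OF _ i]) auto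
      finally show ?thesis using g01[of i \<omega>] False by (simp add: U_def R_def)
    qed (simp add: U_def R_def)
    \<comment> \<open>The estimator is arbitrary, so no moments of \<open>\<zeta>\<close> are
      available directly; integrability of \<open>R\<close> is inherited from the error and from
      \<open>U i\<close>.\<close>
    have "integrable M (\<lambda>\<omega>. g i \<omega> * e \<omega> - U i \<omega>)"
    proof (rule Bochner_Integration.integrable_diff)
      show "integrable M (\<lambda>\<omega>. complex_of_real (g i \<omega>) * e \<omega>)"
      proof (rule Bochner_Integration.integrable_bound)
        show "integrable M e" by (rule square_integrable_imp_integrable[OF _ sqe]) simp
        show "AE \<omega> in M. norm (complex_of_real (g i \<omega>) * e \<omega>) \<le> norm (e \<omega>)"
        proof (rule AE_I2)
          fix \<omega>
          show "norm (complex_of_real (g i \<omega>) * e \<omega>) \<le> norm (e \<omega>)" using g01[of i \<omega>] by auto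
        qed
      qed simp
      show "integrable M (U i)" by (rule square_integrable_imp_integrable[OF _ U(1)]) simp
    qed
    also have "integrable M (\<lambda>\<omega>. g i \<omega> * e \<omega> - U i \<omega>) \<longleftrightarrow> integrable M R"
      by (intro Bochner_Integration.integrable_cong) (auto simp: R)
    finally have intR: "integrable M R" .
    have "integrable M Q"
    proof (rule Bochner_Integration.integrable_bound)
      show "integrable M (\<lambda>\<omega>. cmod z ^ (n - Suc i) * norm (R \<omega>))" using intR by simp
      show "Q \<in> borel_measurable M" using Q_meas by (rule measurable_source_algebra)
      show "AE \<omega> in M. norm (Q \<omega>) \<le> norm (cmod z ^ (n - Suc i) * norm (R \<omega>))"
      proof (rule AE_I2)
        fix \<omega>
        show "norm (Q \<omega>) \<le> norm (cmod z ^ (n - Suc i) * norm (R \<omega>))"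
          using g01[of i \<omega>] by (auto simp: Q_def norm_mult norm_power)
      qed
    qed
    from orth[OF Q_meas this] have Q0: "expectation (\<lambda>\<omega>. Q \<omega> * cnj (W i \<omega>)) = 0" .
    have "integrable M (\<lambda>\<omega>. e \<omega> * cnj (U i \<omega>))"
      by (rule square_integrable_product) (auto simp: sqe U)
    have eq: "e \<omega> * cnj (U i \<omega>) = complex_of_real ((cmod (U i \<omega>))\<^sup>2) + Q \<omega> * cnj (W i \<omega>)" if "\<omega> \<in> space M" for \<omega>
    proof -
      have "e \<omega> * cnj (U i \<omega>) = (g i \<omega> * e \<omega>) * cnj (U i \<omega>)"
        using g01[of i \<omega>] by (auto simp: U_def)
      also have "\<dots> = U i \<omega> * cnj (U i \<omega>) + R \<omega> * cnj (U i \<omega>)"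
        unfolding R[OF that] by (simp add: distrib_right)
      also have "R \<omega> * cnj (U i \<omega>) = Q \<omega> * cnj (W i \<omega>)" by (simp add: Q_def U_def)
      finally show ?thesis by (simp only: complex_norm_square)
    qed
    have intUc: "integrable M (\<lambda>\<omega>. complex_of_real ((cmod (U i \<omega>))\<^sup>2))" using U(1) by (rule integrable_of_real)
    have "integrable M (\<lambda>\<omega>. Q \<omega> * cnj (W i \<omega>))"
      using Bochner_Integration.integrable_diff[OF \<open>integrable M (\<lambda>\<omega>. e \<omega> * cnj (U i \<omega>))\<close> intUc]
      by (rule iffD1[OF Bochner_Integration.integrable_cong, rotated 2]) (auto simp: eq)
    then have "expectation (\<lambda>\<omega>. complex_of_real ((cmod (U i \<omega>))\<^sup>2) + Q \<omega> * cnj (W i \<omega>))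
        = complex_of_real (expectation (\<lambda>\<omega>. (cmod (U i \<omega>))\<^sup>2))"
      using intUc Q0 by (simp only: Bochner_Integration.integral_add integral_complex_of_real add_0_right)
    then show ?thesis
      by (subst Bochner_Integration.integral_cong[OF refl eq]) auto
  qed
  have "(\<Sum>i<n. p\<^sub>e ^ (n - i) * (cmod z)\<^sup>2 ^ (n - Suc i) * (\<sigma>'\<^sup>2 * (norm b)\<^sup>2))
      \<le> (\<Sum>i<n. expectation (\<lambda>\<omega>. (cmod (U i \<omega>))\<^sup>2))"
    unfolding U(2) using W_lower erasure_probability by (intro sum_mono mult_left_mono) auto
  also have "\<dots> \<le> expectation (\<lambda>\<omega>. (cmod (e \<omega>))\<^sup>2)"
  proof (rule bessel_inequality)
    fix i j assume ij: "i \<in> {..<n}" "j \<in> {..<n}" "i \<noteq> j"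
    \<comment> \<open>\<open>g i\<close> and \<open>g j\<close> share channel variables and are not
      separated; the whole coefficient goes into \<open>Q\<close>, which only has to avoid
      \<open>w j\<close>.\<close>
    define Q where "Q \<omega> = U i \<omega> * cnj (g j \<omega> * z ^ (n - Suc j))" for \<omega>
    have [measurable]: "U i \<in> borel_measurable (source_algebra (- {Process j}))"
      "g j \<in> borel_measurable (source_algebra (- {Process j}))"
      using ij by (auto intro!: U_meas g_meas)
    have Q_meas: "Q \<in> borel_measurable (source_algebra (- {Process j}))"
      unfolding Q_def by measurable
    have "integrable M (U i)" by (rule square_integrable_imp_integrable[OF _ U(1)]) simp
    have "integrable M Q"
    proof (rule Bochner_Integration.integrable_bound)
      show "integrable M (\<lambda>\<omega>. cmod z ^ (n - Suc j) * norm (U i \<omega>))" using \<open>integrable M (U i)\<close> by simp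
      show "Q \<in> borel_measurable M" using Q_meas by (rule measurable_source_algebra)
      show "AE \<omega> in M. norm (Q \<omega>) \<le> norm (cmod z ^ (n - Suc j) * norm (U i \<omega>))"
      proof (rule AE_I2)
        fix \<omega>
        show "norm (Q \<omega>) \<le> norm (cmod z ^ (n - Suc j) * norm (U i \<omega>))"
          using g01[of j \<omega>] by (auto simp: Q_def norm_mult norm_power)
      qed
    qed
    from orth[OF Q_meas this] show "expectation (\<lambda>\<omega>. U i \<omega> * cnj (U j \<omega>)) = 0"
      by (simp add: Q_def U_def[of j] mult.assoc)
  qed (auto simp: sqe U(1) coeff)
  finally show ?thesis unfolding e_def .
qed

text \<open>If the product is at least 1, no term of the lower bound falls below \<kappa>: the
  erasure exponent exceeds the exponent of \<open>z\<close> by one, which leaves one factor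
  \<open>p\<^sub>e\<close>. The error at time n is then at least of order n \<kappa>.\<close>

theorem intermittent_observable_necessary:
  assumes "intermittent_observable M x y" "controllable A B" "eigenvalue A z" "\<sigma>' > 0"
  shows "p\<^sub>e * (cmod z)\<^sup>2 < 1"
proof (rule ccontr)
  assume "\<not> p\<^sub>e * (cmod z)\<^sup>2 < 1"
  then have pz: "p\<^sub>e * (cmod z)\<^sup>2 \<ge> 1" by simp
  then have "p\<^sub>e > 0" using erasure_probability(1) by (cases "p\<^sub>e = 0") auto
  obtain h where h: "\<And>n. h n \<in> borel_measurable (PiM {..n} (\<lambda>_. borel))"
    and fin: "(SUP n. \<integral>\<^sup>+\<omega>. ennreal ((norm (x n \<omega> - h n (\<lambda>i\<in>{..n}. y i \<omega>)))\<^sup>2) \<partial>M) < \<infinity>"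
    using assms(1) unfolding intermittent_observable_def by blast
  obtain u b where b: "b \<noteq> 0" and u: "\<And>t. hdot u (A *v t) = z * hdot u t" "\<And>t. hdot u (B *v t) = hdot b t"
    using controllable_left_eigenfunctional[OF assms(2,3)] by blast
  define S where "S = (SUP n. \<integral>\<^sup>+\<omega>. ennreal ((norm (x n \<omega> - h n (\<lambda>i\<in>{..n}. y i \<omega>)))\<^sup>2) \<partial>M)"
  define c where "c = (\<Sum>i\<in>UNIV. cmod (u $ i))\<^sup>2 * enn2real S"
  define \<kappa> where "\<kappa> = p\<^sub>e * (\<sigma>'\<^sup>2 * (norm b)\<^sup>2)"
  have "\<kappa> > 0" using \<open>p\<^sub>e > 0\<close> assms(4) b by (simp add: \<kappa>_def)
  have "real n * \<kappa> \<le> c" for n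
  proof -
    have [measurable]: "(\<lambda>\<omega>. h n (\<lambda>k\<in>{..n}. y k \<omega>)) \<in> borel_measurable M"
      by (rule measurable_compose[OF _ h]) measurable
    define E where "E \<omega> = (norm (x n \<omega> - h n (\<lambda>i\<in>{..n}. y i \<omega>)))\<^sup>2" for \<omega>
    have le: "(\<integral>\<^sup>+\<omega>. ennreal (E \<omega>) \<partial>M) \<le> S" unfolding S_def E_def by (rule SUP_upper) simp
    have [measurable]: "E \<in> borel_measurable M" unfolding E_def by measurable
    have int: "integrable M E"
    proof (rule integrableI_bounded)
      show "(\<integral>\<^sup>+\<omega>. ennreal (norm (E \<omega>)) \<partial>M) < \<infinity>"
        using le_less_trans[OF le fin[folded S_def]] by (simp add: E_def)
    qed simp
    have "expectation E \<le> enn2real S"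
      using le fin[folded S_def] by (subst integral_eq_nn_integral) (auto simp: E_def intro!: enn2real_mono)
    have "real n * \<kappa> = (\<Sum>i<n. p\<^sub>e * (\<sigma>'\<^sup>2 * (norm b)\<^sup>2))" by (simp add: \<kappa>_def)
    also have "\<dots> \<le> (\<Sum>i<n. p\<^sub>e ^ (n - i) * (cmod z)\<^sup>2 ^ (n - Suc i) * (\<sigma>'\<^sup>2 * (norm b)\<^sup>2))"
    proof (intro sum_mono mult_right_mono)
      fix i assume "i \<in> {..<n}"
      then have "n - i = Suc (n - Suc i)" by auto
      then have "p\<^sub>e ^ (n - i) * (cmod z)\<^sup>2 ^ (n - Suc i) = p\<^sub>e * (p\<^sub>e * (cmod z)\<^sup>2) ^ (n - Suc i)"
        by (simp add: power_mult_distrib)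
      also have "\<dots> \<ge> p\<^sub>e * 1"
        using pz \<open>p\<^sub>e > 0\<close> by (intro mult_left_mono one_le_power) auto
      finally show "p\<^sub>e \<le> p\<^sub>e ^ (n - i) * (cmod z)\<^sup>2 ^ (n - Suc i)" by simp
    qed auto
    also have "\<dots> \<le> expectation (\<lambda>\<omega>. (cmod (hdot u (x n \<omega> - h n (\<lambda>k\<in>{..n}. y k \<omega>))))\<^sup>2)"
      by (rule erasure_error_lower_bound[OF h _ u]) (use int in \<open>simp add: E_def[abs_def]\<close>)
    also have "\<dots> \<le> expectation (\<lambda>\<omega>. (\<Sum>i\<in>UNIV. cmod (u $ i))\<^sup>2 * E \<omega>)"
    proof (rule integral_mono)
      show "integrable M (\<lambda>\<omega>. (cmod (hdot u (x n \<omega> - h n (\<lambda>k\<in>{..n}. y k \<omega>))))\<^sup>2)"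
        by (rule square_integrable_hdot) (use int in \<open>auto simp: E_def[abs_def]\<close>)
      show "(cmod (hdot u (x n \<omega> - h n (\<lambda>k\<in>{..n}. y k \<omega>))))\<^sup>2 \<le> (\<Sum>i\<in>UNIV. cmod (u $ i))\<^sup>2 * E \<omega>" for \<omega>
        unfolding E_def power_mult_distrib[symmetric] by (intro power_mono norm_hdot_le) simp
    qed (use int in simp)
    also have "\<dots> \<le> c"
      using \<open>expectation E \<le> enn2real S\<close> by (simp add: c_def mult_left_mono)
    finally show ?thesis .
  qed
  moreover obtain n where "c < real n * \<kappa>" using reals_Archimedean3[OF \<open>\<kappa> > 0\<close>] by blast
  ultimately show False by (metis not_less)
qed

end

section \<open>Sufficiency\<close>

text \<open>The disjunction prepares the tail bound: a window of length \<open>k\<close> beyond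
  \<open>K\<^sub>0\<close> is used only when receptions are sparse in the last k - 1 times. The term
  \<open>norm (x 0)\<close> covers the case that the whole past is too sparse.\<close>

lemma received_window_estimate:
  fixes A :: "complex^'m^'m" and B :: "complex^'g^'m" and C :: "complex^'m^'l"
  assumes obs: "observable A C" and cyc: "no_eigenvalue_cycles A"
    and r: "\<And>z. eigenvalue A z \<Longrightarrow> cmod z < r" "r \<ge> 1"
  shows "\<exists>c K\<^sub>0. c \<ge> 0 \<and> (\<forall>n. \<forall>T\<subseteq>{..n}. \<exists>k\<le>n + 1. \<exists>\<Phi> :: nat \<Rightarrow> complex^'l^'m.
     (k \<le> K\<^sub>0 \<or> N * card (T \<inter> {n + 1 - (k - 1)..n}) < k - 1) \<and>
     (\<forall>x w v. (\<forall>n. x (Suc n) = A *v x n + B *v w n) \<longrightarrow>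
       norm (x n - (\<Sum>t\<in>T. \<Phi> t *v (C *v x t + v t)))
         \<le> c * r ^ k * (norm (x 0) + (\<Sum>j\<in>{n + 1 - k..n}. norm (w j) + norm (v j)))))"
proof -
  obtain c\<^sub>1 K\<^sub>1 where c\<^sub>1: "c\<^sub>1 \<ge> 0" and est: "\<forall>K\<ge>K\<^sub>1. \<forall>T\<subseteq>{..<K}. K \<le> N * card T \<longrightarrow>
    (\<exists>\<Phi> :: nat \<Rightarrow> complex^'l^'m. \<forall>x w v. (\<forall>n. x (Suc n) = A *v x n + B *v w n) \<longrightarrow>
       norm (x (K - 1) - (\<Sum>t\<in>T. \<Phi> t *v (C *v x t + v t)))
         \<le> c\<^sub>1 * r ^ K * (\<Sum>j<K. norm (w j) + norm (v j)))"
    by atomize_elim (rule dense_observation_estimate[OF obs cyc r])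
  obtain cA where cA: "cA \<ge> 0" "\<And>k u. norm (matpow A k *v u) \<le> cA * r ^ k * norm u"
    using matpow_bound[of A r] r(1) by blast
  from state_propagation_bound[of A r B, OF r(1)]
  obtain cW where cW: "cW \<ge> 0" "\<And>x (w :: nat \<Rightarrow> complex^'g) a s. (\<And>n. x (Suc n) = A *v x n + B *v w n) \<Longrightarrow>
     norm (x (a + s) - matpow A s *v x a) \<le> cW * (\<Sum>j<s. r ^ (s - Suc j) * norm (w (a + j)))"
    by blast
  define c where "c = c\<^sub>1 + cA + cW"
  define K\<^sub>0 where "K\<^sub>0 = max K\<^sub>1 1"
  have "c \<ge> 0" using c\<^sub>1 cA cW by (simp add: c_def)
  have *: "\<exists>k\<le>n + 1. \<exists>\<Phi> :: nat \<Rightarrow> complex^'l^'m.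
     (k \<le> K\<^sub>0 \<or> N * card (T \<inter> {n + 1 - (k - 1)..n}) < k - 1) \<and>
     (\<forall>x w v. (\<forall>n. x (Suc n) = A *v x n + B *v w n) \<longrightarrow>
       norm (x n - (\<Sum>t\<in>T. \<Phi> t *v (C *v x t + v t)))
         \<le> c * r ^ k * (norm (x 0) + (\<Sum>j\<in>{n + 1 - k..n}. norm (w j) + norm (v j))))"
    if T: "T \<subseteq> {..n}" for n T
  proof -
    define good where "good k \<longleftrightarrow> K\<^sub>0 \<le> k \<and> k \<le> n + 1 \<and> k \<le> N * card (T \<inter> {n + 1 - k..n})" for k
    have "finite T" using T finite_subset by blast
    show ?thesis
    proof (cases "\<exists>k. good k")
      case True
      \<comment> \<open>The shortest good window; minimality provides the sparsity of the last k - 1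
        times. The 1 in \<open>K\<^sub>0\<close> keeps \<open>k\<close> positive, so that
        \<open>k - 1\<close> is really smaller.\<close>
      define k where "k = (LEAST k. good k)"
      have k: "good k" unfolding k_def using True by (rule LeastI_ex)
      then have k_bounds: "K\<^sub>1 \<le> k" "1 \<le> k" "k \<le> n + 1" by (auto simp: good_def K\<^sub>0_def)
      have "\<not> good (k - 1)" unfolding k_def
        using k_bounds(2) by (intro not_less_Least) (simp add: k_def)
      then have cond: "k \<le> K\<^sub>0 \<or> N * card (T \<inter> {n + 1 - (k - 1)..n}) < k - 1"
        using k_bounds by (auto simp: good_def)
      define a where "a = n + 1 - k"
      have n: "n = k - 1 + a" "n + 1 - k = a" using k_bounds by (auto simp: a_def)
      \<comment> \<open>The system is time-invariant, so the estimate for windows starting at 0 is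
        applied to the trajectory shifted by \<open>a\<close>.\<close>
      define T' where "T' = {t. t < k \<and> t + a \<in> T}"
      have TT': "T \<inter> {a..n} = (\<lambda>t. t + a) ` T'"
      proof (intro equalityI subsetI)
        fix t assume "t \<in> T \<inter> {a..n}"
        then show "t \<in> (\<lambda>t. t + a) ` T'" using n
          by (intro image_eqI[of _ _ "t - a"]) (auto simp: T'_def)
      qed (use n k_bounds in \<open>auto simp: T'_def\<close>)
      then have "card (T \<inter> {a..n}) = card T'" by (simp add: card_image)
      then have "k \<le> N * card T'" "T' \<subseteq> {..<k}" using k n by (auto simp: good_def T'_def)
      then obtain \<Phi> :: "nat \<Rightarrow> complex^'l^'m" where \<Phi>: "\<forall>x w v. (\<forall>n. x (Suc n) = A *v x n + B *v w n) \<longrightarrow>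
         norm (x (k - 1) - (\<Sum>t\<in>T'. \<Phi> t *v (C *v x t + v t)))
         \<le> c\<^sub>1 * r ^ k * (\<Sum>j<k. norm (w j) + norm (v j))"
        using est k_bounds(1) by blast
      define \<Phi>' where "\<Phi>' t = (if a \<le> t then \<Phi> (t - a) else 0)" for t
      have "norm (x n - (\<Sum>t\<in>T. \<Phi>' t *v (C *v x t + v t)))
         \<le> c * r ^ k * (norm (x 0) + (\<Sum>j\<in>{n + 1 - k..n}. norm (w j) + norm (v j)))"
        if x: "\<forall>n. x (Suc n) = A *v x n + B *v w n" for x and w :: "nat \<Rightarrow> complex^'g" and v :: "nat \<Rightarrow> complex^'l"
      proof -
        have "(\<Sum>t\<in>T. \<Phi>' t *v (C *v x t + v t)) = (\<Sum>t\<in>T \<inter> {a..n}. \<Phi>' t *v (C *v x t + v t))"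
          using \<open>finite T\<close> T by (intro sum.mono_neutral_right) (auto simp: \<Phi>'_def)
        also have "\<dots> = (\<Sum>t\<in>T'. \<Phi> t *v (C *v x (t + a) + v (t + a)))"
          unfolding TT' by (simp add: sum.reindex \<Phi>'_def)
        finally have eq: "x n - (\<Sum>t\<in>T. \<Phi>' t *v (C *v x t + v t))
            = x (k - 1 + a) - (\<Sum>t\<in>T'. \<Phi> t *v (C *v x (t + a) + v (t + a)))"
          using n by simp
        have "norm (x (k - 1 + a) - (\<Sum>t\<in>T'. \<Phi> t *v (C *v x (t + a) + v (t + a))))
            \<le> c\<^sub>1 * r ^ k * (\<Sum>j<k. norm (w (j + a)) + norm (v (j + a)))"
          using \<Phi>[rule_format, of "\<lambda>t. x (t + a)" "\<lambda>t. w (t + a)" "\<lambda>t. v (t + a)"] x by simp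
        also have "(\<Sum>j<k. norm (w (j + a)) + norm (v (j + a))) = (\<Sum>j\<in>{a..n}. norm (w j) + norm (v j))"
          using n k_bounds(2)
          by (intro sum.reindex_bij_witness[of _ "\<lambda>j. j - a" "\<lambda>j. j + a"]) auto
        also have "c\<^sub>1 * r ^ k * \<dots> \<le> c * r ^ k * (norm (x 0) + \<dots>)"
          using c\<^sub>1 cA(1) cW(1) r(2)
          by (intro mult_mono mult_right_mono) (auto simp: c_def intro!: sum_nonneg add_nonneg_nonneg)
        finally show ?thesis unfolding eq n(2) .
      qed
      then show ?thesis using cond k_bounds(3) by blast
    next
      case False
      \<comment> \<open>Without a good window the length is n + 1 and the estimate is 0. Sparsity
        comes from the failure of length \<open>n\<close>, one less than the length used.\<close>
      have cond: "n + 1 \<le> K\<^sub>0 \<or> N * card (T \<inter> {n + 1 - (n + 1 - 1)..n}) < n + 1 - 1"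
        using False by (auto simp: good_def not_le dest: spec[of _ n])
      have "norm (x n - (\<Sum>t\<in>T. (0 :: complex^'l^'m) *v (C *v x t + v t)))
         \<le> c * r ^ (n + 1) * (norm (x 0) + (\<Sum>j\<in>{n + 1 - (n + 1)..n}. norm (w j) + norm (v j)))"
        if x: "\<forall>n. x (Suc n) = A *v x n + B *v w n" for x and w :: "nat \<Rightarrow> complex^'g" and v :: "nat \<Rightarrow> complex^'l"
      proof -
        define Z where "Z = (\<Sum>j\<in>{0..n}. norm (w j) + norm (v j))"
        have "Z \<ge> 0" unfolding Z_def by (auto intro!: sum_nonneg add_nonneg_nonneg)
        have "norm (x n) \<le> norm (x (0 + n) - matpow A n *v x 0) + norm (matpow A n *v x 0)"
          using norm_triangle_ineq[of "x n - matpow A n *v x 0" "matpow A n *v x 0"] by simp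
        also have "\<dots> \<le> cW * (\<Sum>j<n. r ^ (n - Suc j) * norm (w (0 + j))) + cA * r ^ n * norm (x 0)"
          using x by (intro add_mono cW(2) cA(2)) auto
        also have "(\<Sum>j<n. r ^ (n - Suc j) * norm (w (0 + j))) \<le> (\<Sum>j<n. r ^ (n + 1) * norm (w j))"
          using r(2) by (simp only: add_0, intro sum_mono mult_right_mono power_increasing) auto
        also have "\<dots> = r ^ (n + 1) * (\<Sum>j<n. norm (w j))" by (simp add: sum_distrib_left)
        also have "(\<Sum>j<n. norm (w j)) \<le> (\<Sum>j\<in>{0..n}. norm (w j))"
          by (intro sum_mono2) auto
        also have "\<dots> \<le> Z" unfolding Z_def by (intro sum_mono) simp
        also have "cA * r ^ n * norm (x 0) \<le> cA * r ^ (n + 1) * norm (x 0)"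
          using cA(1) r(2) by (intro mult_right_mono mult_left_mono power_increasing) auto
        finally have "norm (x n) \<le> cW * (r ^ (n + 1) * Z) + cA * r ^ (n + 1) * norm (x 0)"
          using cW(1) r(2) by (simp add: mult_left_mono)
        also have "\<dots> \<le> c * r ^ (n + 1) * (norm (x 0) + Z)"
        proof -
          have "0 \<le> r ^ (n + 1) * (c\<^sub>1 * (norm (x 0) + Z) + cW * norm (x 0) + cA * Z)"
            using r(2) c\<^sub>1 cW(1) cA(1) \<open>Z \<ge> 0\<close> by (intro mult_nonneg_nonneg add_nonneg_nonneg) auto
          then show ?thesis unfolding c_def by (simp add: algebra_simps)
        qed
        finally show ?thesis by (simp add: Z_def)
      qed
      then show ?thesis using cond by (intro exI[of _ "n + 1"] conjI exI[of _ "\<lambda>_. 0"]) auto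
    qed
  qed
  then show ?thesis using \<open>c \<ge> 0\<close> by (intro exI[of _ c] exI[of _ K\<^sub>0]) simp
qed

lemma measurable_support_pattern:
  fixes f :: "nat \<Rightarrow> 'a \<Rightarrow> 'b::{t1_space, zero}"
  assumes [measurable]: "\<And>k. k \<le> n \<Longrightarrow> f k \<in> borel_measurable N"
  shows "(\<lambda>\<omega>. {k\<in>{..n}. f k \<omega> \<noteq> 0}) \<in> measurable N (count_space (Pow {..n}))"
proof -
  have "(\<lambda>\<omega>. {k\<in>{..n}. f k \<omega> \<noteq> 0}) -` {T} \<inter> space N \<in> sets N" if T: "T \<in> Pow {..n}" for T
  proof -
    have [measurable]: "Measurable.pred N (\<lambda>\<omega>. f k \<omega> \<noteq> 0)" if "k \<in> {..n}" for k
    proof -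
      have "{\<omega> \<in> space N. f k \<omega> = 0} = f k -` {0} \<inter> space N" by auto
      also have "\<dots> \<in> sets N" using that by (intro measurable_sets[OF assms]) auto
      finally have "Measurable.pred N (\<lambda>\<omega>. f k \<omega> = 0)" by (simp add: pred_def)
      then show ?thesis by simp
    qed
    have "(\<lambda>\<omega>. {k\<in>{..n}. f k \<omega> \<noteq> 0}) -` {T} \<inter> space N
        = {\<omega> \<in> space N. \<forall>k\<in>{..n}. (f k \<omega> \<noteq> 0) = (k \<in> T)}"
      using T by auto
    also have "\<dots> \<in> sets N" by measurable
    finally show ?thesis .
  qed
  then show ?thesis by (subst measurable_count_space_eq2) auto
qed

lemma nat_times_power_bounded:
  fixes t :: real
  assumes "0 < t" "t < 1"
  shows "\<exists>c\<ge>0. \<forall>k. (real k + 1) * t ^ k \<le> c"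
proof -
  have "(\<lambda>k. real k * t ^ k) \<longlonglongrightarrow> 0" using assms by (intro powser_times_n_limit_0) auto
  then have "Bseq (\<lambda>k. real k * t ^ k)" by (rule convergent_imp_Bseq[OF convergentI])
  then obtain c where c: "c > 0" "\<And>k. norm (real k * t ^ k) \<le> c" by (auto simp: Bseq_def)
  have "(real k + 1) * t ^ k \<le> c + 1" for k
  proof -
    have "real k * t ^ k \<le> c" using c(2)[of k] by (auto simp: abs_le_iff)
    moreover have "t ^ k \<le> 1" using assms by (intro power_le_one) auto
    ultimately show ?thesis by (simp add: distrib_right)
  qed
  then show ?thesis using c(1) by (intro exI[of _ "c + 1"]) auto
qed

text \<open>Any \<eta> strictly between p \<rho> and 1 works, here the midpoint: the power of \<eta>
  tends to 0 and finally fits into the gap. The quotient becomes the decay rate of long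
  windows.\<close>

lemma Chernoff_parameters:
  fixes p \<rho> :: real
  assumes "0 \<le> p" "p * \<rho> < 1" "\<rho> > 0"
  shows "\<exists>\<eta> N. 0 < \<eta> \<and> \<eta> < 1 \<and> (p + \<eta> ^ N) / \<eta> * \<rho> < 1"
proof -
  define \<eta> where "\<eta> = (1 + p * \<rho>) / 2"
  have "0 \<le> p * \<rho>" using assms by simp
  then have \<eta>: "0 < \<eta>" "\<eta> < 1" "p * \<rho> < \<eta>" using assms(2) by (simp_all add: \<eta>_def mult.commute)
  obtain N where N: "\<eta> ^ N < (\<eta> - p * \<rho>) / \<rho>"
    using real_arch_pow_inv[of "(\<eta> - p * \<rho>) / \<rho>" \<eta>] \<eta> assms(3) by auto
  then have "(p + \<eta> ^ N) * \<rho> < \<eta>"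
    using assms(3) by (simp add: pos_less_divide_eq distrib_right)
  then have "(p + \<eta> ^ N) / \<eta> * \<rho> < 1" using \<eta>(1) by simp
  then show ?thesis using \<eta> by blast
qed

section \<open>Mean square bounds\<close>

context intermittent_system
begin

lemma intermittent_observableI:
  assumes "\<And>n. h n \<in> borel_measurable (PiM {..n} (\<lambda>_. borel))"
    and "\<And>n. integrable M (F n)" "\<And>n. expectation (F n) \<le> c"
    and "\<And>n. AE \<omega> in M. (norm (x n \<omega> - h n (\<lambda>i\<in>{..n}. y i \<omega>)))\<^sup>2 \<le> F n \<omega>"
  shows "intermittent_observable M x y"
proof -
  have "(\<integral>\<^sup>+\<omega>. ennreal ((norm (x n \<omega> - h n (\<lambda>i\<in>{..n}. y i \<omega>)))\<^sup>2) \<partial>M) \<le> ennreal c" for n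
  proof -
    have "(\<integral>\<^sup>+\<omega>. ennreal ((norm (x n \<omega> - h n (\<lambda>i\<in>{..n}. y i \<omega>)))\<^sup>2) \<partial>M) \<le> (\<integral>\<^sup>+\<omega>. ennreal (F n \<omega>) \<partial>M)"
    proof (rule nn_integral_mono_AE)
      show "AE \<omega> in M. ennreal ((norm (x n \<omega> - h n (\<lambda>i\<in>{..n}. y i \<omega>)))\<^sup>2) \<le> ennreal (F n \<omega>)"
        using assms(4)[of n] by eventually_elim (rule ennreal_leI)
    qed
    also have "\<dots> = ennreal (expectation (F n))"
    proof (rule nn_integral_eq_integral[OF assms(2)])
      show "AE \<omega> in M. 0 \<le> F n \<omega>"
        using assms(4)[of n] by eventually_elim (metis order_trans zero_le_power2)
    qed
    also have "\<dots> \<le> ennreal c" by (rule ennreal_leI[OF assms(3)])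
    finally show ?thesis .
  qed
  then have "(SUP n. \<integral>\<^sup>+\<omega>. ennreal ((norm (x n \<omega> - h n (\<lambda>i\<in>{..n}. y i \<omega>)))\<^sup>2) \<partial>M) \<le> ennreal c"
    by (rule SUP_least)
  then show ?thesis
    unfolding intermittent_observable_def using assms(1)
    by (intro exI[of _ h] conjI allI) (auto intro: le_less_trans)
qed

text \<open>The state itself stays bounded in mean square, so the estimate 0 suffices. This case is
  separate because the window estimates assume a growth rate of at least 1.\<close>

lemma stable_intermittent_observable:
  assumes r: "\<And>z. eigenvalue A z \<Longrightarrow> cmod z < r" "0 < r" "r < 1"
  shows "intermittent_observable M x y"
proof -
  obtain cA where cA: "cA \<ge> 0" "\<And>k u. norm (matpow A k *v u) \<le> cA * r ^ k * norm u"
    using matpow_bound[of A r] r(1) by blast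
  from state_propagation_bound[of A r B, OF r(1)]
  obtain cW where cW: "cW \<ge> 0" "\<And>x (w :: nat \<Rightarrow> complex^'g) a s. (\<And>n. x (Suc n) = A *v x n + B *v w n) \<Longrightarrow>
     norm (x (a + s) - matpow A s *v x a) \<le> cW * (\<Sum>j<s. r ^ (s - Suc j) * norm (w (a + j)))"
    by blast
  define R where "R = 1 / (1 - r)"
  have "R > 0" using r by (simp add: R_def)
  have gp: "(\<Sum>j<n. r ^ (n - Suc j)) \<le> R" for n
    unfolding R_def sum.nat_diff_reindex using geometric_sum_less[of r "{..<n}"] r by auto
  define F where "F n \<omega> = 2 * cW\<^sup>2 * R * (\<Sum>j<n. r ^ (n - Suc j) * (norm (w j \<omega>))\<^sup>2) + 2 * cA\<^sup>2 * (norm (x 0 \<omega>))\<^sup>2" for n \<omega>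
  define c where "c = 2 * cW\<^sup>2 * R * (R * (CARD('g) * \<sigma>\<^sup>2)) + 2 * cA\<^sup>2 * (CARD('m) * \<sigma>\<^sup>2)"
  show ?thesis
  proof (rule intermittent_observableI[where h = "\<lambda>_ _. 0" and F = F and c = c])
    fix n
    show "integrable M (F n)" unfolding F_def using square_integrable_sources by simp
    have "expectation (F n) = 2 * cW\<^sup>2 * R * (\<Sum>j<n. r ^ (n - Suc j) * expectation (\<lambda>\<omega>. (norm (w j \<omega>))\<^sup>2))
        + 2 * cA\<^sup>2 * expectation (\<lambda>\<omega>. (norm (x 0 \<omega>))\<^sup>2)"
      unfolding F_def using square_integrable_sources
      by (simp add: Bochner_Integration.integral_sum)
    also have "(\<Sum>j<n. r ^ (n - Suc j) * expectation (\<lambda>\<omega>. (norm (w j \<omega>))\<^sup>2)) \<le> (\<Sum>j<n. r ^ (n - Suc j) * (CARD('g) * \<sigma>\<^sup>2))"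
      using square_expectation_sources r by (intro sum_mono mult_left_mono) auto
    also have "\<dots> \<le> R * (CARD('g) * \<sigma>\<^sup>2)"
      unfolding sum_distrib_right[symmetric] by (intro mult_right_mono gp) auto
    also have "expectation (\<lambda>\<omega>. (norm (x 0 \<omega>))\<^sup>2) \<le> CARD('m) * \<sigma>\<^sup>2"
      by (rule square_expectation_sources)
    finally show "expectation (F n) \<le> c"
      unfolding c_def using \<open>R > 0\<close> by (simp add: mult_left_mono)
    show "AE \<omega> in M. (norm (x n \<omega> - 0))\<^sup>2 \<le> F n \<omega>"
    proof (rule AE_I2)
      fix \<omega> assume \<omega>: "\<omega> \<in> space M"
      define s where "s = (\<Sum>j<n. r ^ (n - Suc j) * norm (w j \<omega>))"
      have "norm (x n \<omega>) \<le> norm (x (0 + n) \<omega> - matpow A n *v x 0 \<omega>) + norm (matpow A n *v x 0 \<omega>)"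
        using norm_triangle_ineq[of "x n \<omega> - matpow A n *v x 0 \<omega>" "matpow A n *v x 0 \<omega>"] by simp
      also have "norm (x (0 + n) \<omega> - matpow A n *v x 0 \<omega>) \<le> cW * s"
        using cW(2)[of "\<lambda>n. x n \<omega>" "\<lambda>n. w n \<omega>" 0 n] state[OF \<omega>] by (simp add: s_def)
      also have "norm (matpow A n *v x 0 \<omega>) \<le> cA * norm (x 0 \<omega>)"
      proof -
        have "cA * r ^ n * norm (x 0 \<omega>) \<le> cA * 1 * norm (x 0 \<omega>)"
          using cA(1) r by (intro mult_right_mono mult_left_mono power_le_one) auto
        then show ?thesis using cA(2)[of n "x 0 \<omega>"] by simp
      qed
      finally have "(norm (x n \<omega>))\<^sup>2 \<le> (cW * s + cA * norm (x 0 \<omega>))\<^sup>2"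
        by (intro power_mono) auto
      also have "\<dots> \<le> 2 * (cW\<^sup>2 * s\<^sup>2) + 2 * (cA\<^sup>2 * (norm (x 0 \<omega>))\<^sup>2)"
        using sum_squares_bound[of "cW * s" "cA * norm (x 0 \<omega>)"] by (simp add: power2_sum power_mult_distrib)
      also have "s\<^sup>2 \<le> R * (\<Sum>j<n. r ^ (n - Suc j) * (norm (w j \<omega>))\<^sup>2)"
      proof -
        \<comment> \<open>Splitting each weight into two square roots keeps the Cauchy-Schwarz
          factor at the geometric sum, where a plain application would cost a factor
          \<open>n\<close>.\<close>
        have "s\<^sup>2 = (\<Sum>j<n. sqrt (r ^ (n - Suc j)) * (sqrt (r ^ (n - Suc j)) * norm (w j \<omega>)))\<^sup>2"
          using r by (simp add: s_def mult.assoc[symmetric])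
        also have "\<dots> \<le> (\<Sum>j<n. (sqrt (r ^ (n - Suc j)))\<^sup>2) * (\<Sum>j<n. (sqrt (r ^ (n - Suc j)) * norm (w j \<omega>))\<^sup>2)"
          by (rule Cauchy_Schwarz_ineq_sum)
        also have "\<dots> = (\<Sum>j<n. r ^ (n - Suc j)) * (\<Sum>j<n. r ^ (n - Suc j) * (norm (w j \<omega>))\<^sup>2)"
          using r by (simp add: power_mult_distrib)
        also have "\<dots> \<le> R * (\<Sum>j<n. r ^ (n - Suc j) * (norm (w j \<omega>))\<^sup>2)"
          using r by (intro mult_right_mono gp sum_nonneg) auto
        finally show ?thesis .
      qed
      finally show "(norm (x n \<omega> - 0))\<^sup>2 \<le> F n \<omega>"
        by (simp add: F_def mult_left_mono mult.assoc)
    qed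
  qed simp
qed

text \<open>Markov's inequality for \<eta> raised to \<open>N\<close> times the number of
  receptions. As \<eta> < 1, this is at least \<open>\<eta> ^ card I\<close> on the event, and its
  expectation factors over the channel uses.\<close>

lemma few_receptions_probability:
  assumes "finite I" "0 < \<eta>" "\<eta> < 1"
  shows "prob {\<omega> \<in> space M. N * card {k\<in>I. \<beta> k \<omega> \<noteq> 0} < card I} \<le> ((p\<^sub>e + \<eta> ^ N) / \<eta>) ^ card I"
proof -
  define f where "f t = (if t = 0 then 1 else \<eta> ^ N)" for t :: real
  have [measurable]: "f \<in> borel_measurable borel" unfolding f_def by measurable
  define E where "E = {\<omega> \<in> space M. N * card {k\<in>I. \<beta> k \<omega> \<noteq> 0} < card I}"
  have prod: "(\<Prod>k\<in>I. f (\<beta> k \<omega>)) = \<eta> ^ (N * card {k\<in>I. \<beta> k \<omega> \<noteq> 0})" for \<omega>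
    using assms(1)
    by (simp add: f_def prod.If_cases power_mult Int_def Collect_neg_eq[symmetric])
  have "card {k\<in>I. \<beta> k \<omega> \<noteq> 0} = (\<Sum>k\<in>I. if \<beta> k \<omega> \<noteq> 0 then 1 else 0)" for \<omega>
    using assms(1) by (simp add: sum.If_cases Int_def)
  then have [measurable]: "E \<in> events" unfolding E_def by simp
  have "\<eta> ^ card I * prob E = expectation (\<lambda>\<omega>. \<eta> ^ card I * indicator E \<omega>)" by simp
  also have "\<dots> \<le> expectation (\<lambda>\<omega>. \<Prod>k\<in>I. f (\<beta> k \<omega>))"
  proof (rule integral_mono)
    show "integrable M (\<lambda>\<omega>. \<eta> ^ card I * indicator E \<omega>)" by (simp add: emeasure_eq_measure)
    show "integrable M (\<lambda>\<omega>. \<Prod>k\<in>I. f (\<beta> k \<omega>))" using assms(1) by (intro expectation_channel_product) auto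
    show "\<eta> ^ card I * indicator E \<omega> \<le> (\<Prod>k\<in>I. f (\<beta> k \<omega>))" for \<omega>
      unfolding prod using assms by (auto simp: E_def indicator_def intro!: power_decreasing)
  qed
  also have "\<dots> = (p\<^sub>e + (1 - p\<^sub>e) * \<eta> ^ N) ^ card I"
    using assms(1) by (subst expectation_channel_product) (auto simp: f_def)
  also have "\<dots> \<le> (p\<^sub>e + \<eta> ^ N) ^ card I"
    using erasure_probability assms(2) by (intro power_mono add_mono) (auto intro!: mult_left_le_one_le add_nonneg_nonneg)
  finally have "\<eta> ^ card I * prob E \<le> (p\<^sub>e + \<eta> ^ N) ^ card I" .
  then show ?thesis
    using assms(2) by (simp add: E_def[symmetric] power_divide pos_le_divide_eq mult.commute)
qed

text \<open>Cauchy-Schwarz costs a factor of the window length, hence the quadratic growth; the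
  exponential slack chosen later absorbs it.\<close>

lemma window_noise_square:
  fixes J :: "nat set"
  assumes "finite J"
  defines "Z \<equiv> \<lambda>\<omega>. norm (x 0 \<omega>) + (\<Sum>j\<in>J. norm (w j \<omega>) + norm (v j \<omega>))"
  shows "integrable M (\<lambda>\<omega>. (Z \<omega>)\<^sup>2)"
    and "expectation (\<lambda>\<omega>. (Z \<omega>)\<^sup>2) \<le> 3 * (CARD('m) + CARD('g) + CARD('l)) * \<sigma>\<^sup>2 * (real (card J) + 1)\<^sup>2"
proof -
  define k where "k = real (card J)"
  define F where "F \<omega> = 3 * ((norm (x 0 \<omega>))\<^sup>2 + (\<Sum>j\<in>J. (norm (w j \<omega>))\<^sup>2) * k + (\<Sum>j\<in>J. (norm (v j \<omega>))\<^sup>2) * k)" for \<omega>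
  have F: "integrable M F" unfolding F_def using square_integrable_sources by simp
  have le: "(Z \<omega>)\<^sup>2 \<le> F \<omega>" for \<omega>
  proof -
    define a where "a = (\<Sum>j\<in>J. norm (w j \<omega>))"
    define b where "b = (\<Sum>j\<in>J. norm (v j \<omega>))"
    have "(Z \<omega>)\<^sup>2 = (norm (x 0 \<omega>) + a + b)\<^sup>2"
      by (simp add: Z_def a_def b_def sum.distrib add.assoc)
    also have "\<dots> \<le> 3 * ((norm (x 0 \<omega>))\<^sup>2 + a\<^sup>2 + b\<^sup>2)"
      using sum_squares_bound[of "norm (x 0 \<omega>)" a] sum_squares_bound[of "norm (x 0 \<omega>)" b] sum_squares_bound[of a b]
      by (simp add: power2_eq_square algebra_simps)
    also have "\<dots> \<le> F \<omega>"
      using sum_squared_le_sum_of_squares[of "\<lambda>j. norm (w j \<omega>)" J]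
        sum_squared_le_sum_of_squares[of "\<lambda>j. norm (v j \<omega>)" J]
      by (simp add: F_def a_def b_def k_def)
    finally show ?thesis .
  qed
  have [measurable]: "Z \<in> borel_measurable M" unfolding Z_def by measurable
  show int: "integrable M (\<lambda>\<omega>. (Z \<omega>)\<^sup>2)"
    by (rule Bochner_Integration.integrable_bound[OF F]) (auto intro!: AE_I2 order_trans[OF le])
  have "expectation (\<lambda>\<omega>. (Z \<omega>)\<^sup>2) \<le> expectation F" by (intro integral_mono int F le)
  also have "expectation F = 3 * (expectation (\<lambda>\<omega>. (norm (x 0 \<omega>))\<^sup>2) +
      (\<Sum>j\<in>J. expectation (\<lambda>\<omega>. (norm (w j \<omega>))\<^sup>2)) * k + (\<Sum>j\<in>J. expectation (\<lambda>\<omega>. (norm (v j \<omega>))\<^sup>2)) * k)"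
    unfolding F_def using square_integrable_sources by (simp add: Bochner_Integration.integral_sum)
  also have "\<dots> \<le> 3 * (CARD('m) * \<sigma>\<^sup>2 + (\<Sum>j\<in>J. CARD('g) * \<sigma>\<^sup>2) * k + (\<Sum>j\<in>J. CARD('l) * \<sigma>\<^sup>2) * k)"
    using square_expectation_sources
    by (intro mult_left_mono add_mono mult_right_mono sum_mono) (auto simp: k_def)
  also have "\<dots> = 3 * (CARD('m) * \<sigma>\<^sup>2 * 1 + CARD('g) * \<sigma>\<^sup>2 * k\<^sup>2 + CARD('l) * \<sigma>\<^sup>2 * k\<^sup>2)"
    by (simp add: k_def power2_eq_square)
  also have "\<dots> \<le> 3 * (CARD('m) * \<sigma>\<^sup>2 * (k + 1)\<^sup>2 + CARD('g) * \<sigma>\<^sup>2 * (k + 1)\<^sup>2 + CARD('l) * \<sigma>\<^sup>2 * (k + 1)\<^sup>2)"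
    by (intro mult_left_mono add_mono power_mono) (auto simp: k_def one_le_power)
  finally show "expectation (\<lambda>\<omega>. (Z \<omega>)\<^sup>2) \<le> 3 * (CARD('m) + CARD('g) + CARD('l)) * \<sigma>\<^sup>2 * (real (card J) + 1)\<^sup>2"
    by (simp add: k_def algebra_simps)
qed

text \<open>This lets an estimator recover the reception pattern from \<open>y\<close>
  alone.\<close>

lemma observation_support:
  assumes "\<sigma>' > 0"
  shows "AE \<omega> in M. \<forall>n. (y n \<omega> \<noteq> 0 \<longleftrightarrow> \<beta> n \<omega> \<noteq> 0) \<and> (\<beta> n \<omega> \<noteq> 0 \<longrightarrow> y n \<omega> = C *v x n \<omega> + v n \<omega>)"
  unfolding AE_all_countable
proof
  fix n
  show "AE \<omega> in M. (y n \<omega> \<noteq> 0 \<longleftrightarrow> \<beta> n \<omega> \<noteq> 0) \<and> (\<beta> n \<omega> \<noteq> 0 \<longrightarrow> y n \<omega> = C *v x n \<omega> + v n \<omega>)"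
    using channel_values[of n] unerased_observation_nonzero[OF assms, of n] AE_space
    by eventually_elim (auto simp: observation)
qed

text \<open>The mean square error is summed over the window length k. The probability decays like
  q^k, the squared amplification is r^(2k), and the squared noise has order (k + 1)^2. Window and
  noise are independent, so these factors multiply, and q \<rho> < 1 makes the series
  converge.\<close>

theorem intermittent_observable_sufficient:
  assumes "observable A C" "no_eigenvalue_cycles A" "\<sigma>' > 0"
    and z: "\<And>z'. eigenvalue A z' \<Longrightarrow> cmod z' \<le> cmod z" "p\<^sub>e * (cmod z)\<^sup>2 < 1" "cmod z \<ge> 1"
  shows "intermittent_observable M x y"
proof -
  \<comment> \<open>Room above the squared modulus of \<open>z\<close>. For erasure probability 0
    there is no upper limit for \<rho>, and division by it is avoided.\<close>
  obtain \<rho> where \<rho>: "(cmod z)\<^sup>2 < \<rho>" "p\<^sub>e * \<rho> < 1"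
  proof (cases "p\<^sub>e = 0")
    case True
    then show ?thesis using that[of "(cmod z)\<^sup>2 + 1"] by simp
  next
    case False
    then have "p\<^sub>e > 0" using erasure_probability(1) by simp
    then have "(cmod z)\<^sup>2 < 1 / p\<^sub>e" using z(2) by (simp add: field_simps)
    then obtain \<rho> where "(cmod z)\<^sup>2 < \<rho>" "\<rho> < 1 / p\<^sub>e" using dense by blast
    then show ?thesis using that[of \<rho>] \<open>p\<^sub>e > 0\<close> by (simp add: field_simps)
  qed
  have "(cmod z)\<^sup>2 \<ge> 1" using z(3) by simp
  then have "\<rho> > 1" using \<rho>(1) by simp
  have "cmod z < sqrt \<rho>" using \<rho>(1) by (simp add: real_less_rsqrt)
  \<comment> \<open>The gap below \<open>r\<close> is for the Jordan blocks, the gap above it for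
    the factor k + 1 from the noise.\<close>
  then obtain r where r: "cmod z < r" "r < sqrt \<rho>" using dense by blast
  have "r > 1" using r(1) z(3) by simp
  define t where "t = r / sqrt \<rho>"
  have t: "0 < t" "t < 1" using r \<open>r > 1\<close> \<open>\<rho> > 1\<close> by (simp_all add: t_def)
  obtain D where D: "D \<ge> 0" "\<And>k. (real k + 1) * t ^ k \<le> D" using nat_times_power_bounded[OF t] by blast
  have growth: "(r ^ k)\<^sup>2 * (real k + 1)\<^sup>2 \<le> D\<^sup>2 * \<rho> ^ k" for k
  proof -
    have "r = t * sqrt \<rho>" using \<open>\<rho> > 1\<close> by (simp add: t_def)
    then have "(r ^ k)\<^sup>2 * (real k + 1)\<^sup>2 = ((real k + 1) * t ^ k)\<^sup>2 * \<rho> ^ k"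
      using \<open>\<rho> > 1\<close> by (simp add: power_mult_distrib power_mult[symmetric] mult_ac)
        (simp add: power_mult[of _ 2] mult.commute[of _ 2])
    also have "\<dots> \<le> D\<^sup>2 * \<rho> ^ k"
      using D t \<open>\<rho> > 1\<close> by (intro mult_right_mono power_mono) auto
    finally show ?thesis .
  qed
  obtain \<eta> N where \<eta>: "0 < \<eta>" "\<eta> < 1" "(p\<^sub>e + \<eta> ^ N) / \<eta> * \<rho> < 1"
    using Chernoff_parameters[OF erasure_probability(1) \<rho>(2)] \<open>\<rho> > 1\<close> by auto
  define q where "q = (p\<^sub>e + \<eta> ^ N) / \<eta>"
  have q: "q > 0" "q * \<rho> < 1"
    using \<eta> erasure_probability(1) by (auto simp: q_def intro!: divide_pos_pos add_nonneg_pos)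
  have r_eig: "cmod z' < r" if "eigenvalue A z'" for z' using z(1)[OF that] r(1) by simp
  obtain c K\<^sub>0 where c: "c \<ge> 0" and est: "\<forall>n. \<forall>T\<subseteq>{..n}. \<exists>k\<le>n + 1. \<exists>\<Phi> :: nat \<Rightarrow> complex^'l^'m.
     (k \<le> K\<^sub>0 \<or> N * card (T \<inter> {n + 1 - (k - 1)..n}) < k - 1) \<and>
     (\<forall>x w v. (\<forall>n. x (Suc n) = A *v x n + B *v w n) \<longrightarrow>
       norm (x n - (\<Sum>t\<in>T. \<Phi> t *v (C *v x t + v t)))
         \<le> c * r ^ k * (norm (x 0) + (\<Sum>j\<in>{n + 1 - k..n}. norm (w j) + norm (v j))))"
    by atomize_elim (rule received_window_estimate[OF assms(1,2) r_eig less_imp_le[OF \<open>r > 1\<close>]])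
  define good where "good n T k \<Phi> \<longleftrightarrow> k \<le> n + 1 \<and> (k \<le> K\<^sub>0 \<or> N * card (T \<inter> {n + 1 - (k - 1)..n}) < k - 1) \<and>
     (\<forall>x w v. (\<forall>n. x (Suc n) = A *v x n + B *v w n) \<longrightarrow>
       norm (x n - (\<Sum>t\<in>T. \<Phi> t *v (C *v x t + v t)))
         \<le> c * r ^ k * (norm (x 0) + (\<Sum>j\<in>{n + 1 - k..n}. norm (w j) + norm (v j))))"
    for n T k and \<Phi> :: "nat \<Rightarrow> complex^'l^'m"
  have ex: "\<exists>q. good n T (fst q) (snd q)" if "T \<subseteq> {..n}" for n T
    using est that unfolding good_def by fastforce
  \<comment> \<open>Window length and coefficients are chosen from the reception pattern alone,
    which makes the window length independent of the noise.\<close>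
  define \<kappa> where "\<kappa> n T = fst (SOME q. good n T (fst q) (snd q))" for n T
  define \<Phi> where "\<Phi> n T = snd (SOME q. good n T (fst q) (snd q))" for n T
  have good: "good n T (\<kappa> n T) (\<Phi> n T)" if "T \<subseteq> {..n}" for n T
    unfolding \<kappa>_def \<Phi>_def by (rule someI_ex[OF ex[OF that]])
  \<comment> \<open>The nonzero entries of \<open>Y\<close> serve as the reception pattern.\<close>
  define h where "h n Y = (\<Sum>t\<in>{k\<in>{..n}. Y k \<noteq> 0}. \<Phi> n {k\<in>{..n}. Y k \<noteq> 0} t *v Y t)"
    for n and Y :: "nat \<Rightarrow> complex^'l"
  define S where "S n \<omega> = {k\<in>{..n}. \<beta> k \<omega> \<noteq> 0}" for n \<omega>
  define Z where "Z n k \<omega> = norm (x 0 \<omega>) + (\<Sum>j\<in>{n + 1 - k..n}. norm (w j \<omega>) + norm (v j \<omega>))" for n k \<omega>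
  define G where "G n k \<omega> = (if \<kappa> n (S n \<omega>) = k then 1 else 0 :: real)" for n k \<omega>
  define F where "F n \<omega> = (\<Sum>k\<le>n + 1. c\<^sup>2 * (r ^ k)\<^sup>2 * (G n k \<omega> * (Z n k \<omega>)\<^sup>2))" for n \<omega>
  define s where "s = 3 * (CARD('m) + CARD('g) + CARD('l)) * \<sigma>\<^sup>2"
  have "s \<ge> 0" by (simp add: s_def)
  have G_meas: "G n k \<in> borel_measurable (source_algebra (range Channel))" for n k
  proof -
    have "S n \<in> measurable (source_algebra (range Channel)) (count_space (Pow {..n}))"
      unfolding S_def[abs_def] by (intro measurable_support_pattern measurable_sources) auto
    then show ?thesis
      unfolding G_def by (rule measurable_compose) simp
  qed
  note [measurable] = measurable_source_algebra[OF G_meas]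
  have Z_meas: "Z n k \<in> borel_measurable (source_algebra (- range Channel))" for n k
  proof -
    have [measurable]: "x 0 \<in> borel_measurable (source_algebra (- range Channel))"
      "w j \<in> borel_measurable (source_algebra (- range Channel))"
      "v j \<in> borel_measurable (source_algebra (- range Channel))" for j
      by (auto intro!: measurable_sources)
    show ?thesis unfolding Z_def by measurable
  qed
  have G: "integrable M (G n k)" for n k
    by (rule integrable_const_bound[where B = 1]) (auto simp: G_def)
  have GZ: "integrable M (\<lambda>\<omega>. G n k \<omega> * (Z n k \<omega>)\<^sup>2)"
    "expectation (\<lambda>\<omega>. G n k \<omega> * (Z n k \<omega>)\<^sup>2) \<le> expectation (G n k) * (s * (real k + 1)\<^sup>2)"
    if "k \<le> n + 1" for n k
  proof -
    note Z_square = window_noise_square[of "{n + 1 - k..n}", folded Z_def s_def]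
    have Z2: "(\<lambda>\<omega>. (Z n k \<omega>)\<^sup>2) \<in> borel_measurable (source_algebra (- range Channel))"
      using Z_meas by measurable
    note prod = integral_indep_product[OF G_meas Z2 _ G Z_square(1)]
    show "integrable M (\<lambda>\<omega>. G n k \<omega> * (Z n k \<omega>)\<^sup>2)" using prod(1) by auto
    have "expectation (\<lambda>\<omega>. G n k \<omega> * (Z n k \<omega>)\<^sup>2) = expectation (G n k) * expectation (\<lambda>\<omega>. (Z n k \<omega>)\<^sup>2)"
      using prod(2) by auto
    also have "\<dots> \<le> expectation (G n k) * (s * (real k + 1)\<^sup>2)"
      using Z_square(2) that by (intro mult_left_mono) (auto simp: G_def intro!: Bochner_Integration.integral_nonneg)
    finally show "expectation (\<lambda>\<omega>. G n k \<omega> * (Z n k \<omega>)\<^sup>2) \<le> expectation (G n k) * (s * (real k + 1)\<^sup>2)" .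
  qed
  \<comment> \<open>The exponent is k - 1 because sparsity is known for the last k - 1 times
    only.\<close>
  have G_tail: "expectation (G n k) \<le> (if k \<le> K\<^sub>0 then 1 else 0) + q ^ (k - 1)" if k: "k \<le> n + 1" for n k
  proof (cases "k \<le> K\<^sub>0")
    case True
    have "expectation (G n k) \<le> expectation (\<lambda>_. 1)"
      by (intro integral_mono G) (auto simp: G_def)
    then show ?thesis using True q(1) by (simp add: prob_space add_increasing2)
  next
    case False
    define I where "I = {n + 1 - (k - 1)..n}"
    have card_I: "card I = k - 1" using k by (simp add: I_def)
    define E where "E = {\<omega> \<in> space M. N * card {j\<in>I. \<beta> j \<omega> \<noteq> 0} < card I}"
    have "card {j\<in>I. \<beta> j \<omega> \<noteq> 0} = (\<Sum>j\<in>I. if \<beta> j \<omega> \<noteq> 0 then 1 else 0)" for \<omega>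
      by (simp add: sum.If_cases Int_def I_def)
    then have [measurable]: "E \<in> events" unfolding E_def by simp
    have "expectation (G n k) \<le> expectation (indicator E)"
    proof (intro integral_mono G)
      show "G n k \<omega> \<le> indicator E \<omega>" if "\<omega> \<in> space M" for \<omega>
      proof (cases "\<kappa> n (S n \<omega>) = k")
        case True
        have "S n \<omega> \<subseteq> {..n}" by (auto simp: S_def)
        from good[OF this] True False have "N * card (S n \<omega> \<inter> {n + 1 - (k - 1)..n}) < k - 1"
          by (auto simp: good_def)
        also have "S n \<omega> \<inter> {n + 1 - (k - 1)..n} = {j\<in>I. \<beta> j \<omega> \<noteq> 0}" by (auto simp: S_def I_def)
        finally show ?thesis using that True by (simp add: E_def card_I G_def)
      qed (simp add: G_def)
    qed (simp add: emeasure_eq_measure)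
    also have "\<dots> = prob E" by simp
    also have "\<dots> \<le> q ^ (k - 1)"
      using few_receptions_probability[of I \<eta> N] \<eta> by (simp add: E_def q_def card_I) (simp add: I_def)
    finally show ?thesis using False by simp
  qed
  \<comment> \<open>The first sum bounds the short windows, the second summand the geometric tail of
    the long ones.\<close>
  define b where "b = (\<Sum>k\<le>K\<^sub>0. \<rho> ^ k) + \<rho> * (1 + 1 / (1 - q * \<rho>))"
  have b: "(\<Sum>k\<le>n + 1. expectation (G n k) * \<rho> ^ k) \<le> b" for n
  proof -
    have "(\<Sum>k\<le>n + 1. expectation (G n k) * \<rho> ^ k)
        \<le> (\<Sum>k\<le>n + 1. (if k \<le> K\<^sub>0 then \<rho> ^ k else 0) + \<rho> * (q * \<rho>) ^ (k - 1))"
    proof (rule sum_mono)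
      fix k assume "k \<in> {..n + 1}"
      then have "expectation (G n k) * \<rho> ^ k \<le> ((if k \<le> K\<^sub>0 then 1 else 0) + q ^ (k - 1)) * \<rho> ^ k"
        using G_tail[of k n] \<open>\<rho> > 1\<close> by (intro mult_right_mono) auto
      also have "\<dots> = (if k \<le> K\<^sub>0 then \<rho> ^ k else 0) + q ^ (k - 1) * \<rho> ^ k"
        by (simp add: distrib_right)
      also have "q ^ (k - 1) * \<rho> ^ k \<le> q ^ (k - 1) * \<rho> ^ (Suc (k - 1))"
        using q(1) \<open>\<rho> > 1\<close> by (intro mult_left_mono power_increasing) auto
      also have "\<dots> = \<rho> * (q * \<rho>) ^ (k - 1)" by (simp add: power_mult_distrib)
      finally show "expectation (G n k) * \<rho> ^ k \<le> (if k \<le> K\<^sub>0 then \<rho> ^ k else 0) + \<rho> * (q * \<rho>) ^ (k - 1)" by simp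
    qed
    also have "\<dots> = (\<Sum>k\<in>{..n + 1} \<inter> {..K\<^sub>0}. \<rho> ^ k) + \<rho> * (\<Sum>k\<le>Suc n. (q * \<rho>) ^ (k - 1))"
      by (simp add: sum.distrib sum_distrib_left sum.If_cases Int_def atMost_def del: sum.atMost_Suc)
    \<comment> \<open>Truncated subtraction gives k = 0 the exponent 0 as well, which is the extra
      1.\<close>
    also have "(\<Sum>k\<le>Suc n. (q * \<rho>) ^ (k - 1)) = 1 + (\<Sum>k\<le>n. (q * \<rho>) ^ k)"
      by (subst sum.atMost_Suc_shift) simp
    also have "(\<Sum>k\<le>n. (q * \<rho>) ^ k) \<le> 1 / (1 - q * \<rho>)"
      using geometric_sum_less[of "q * \<rho>" "{..n}"] q \<open>\<rho> > 1\<close> by simp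
    also have "(\<Sum>k\<in>{..n + 1} \<inter> {..K\<^sub>0}. \<rho> ^ k) \<le> (\<Sum>k\<le>K\<^sub>0. \<rho> ^ k)"
      using \<open>\<rho> > 1\<close> by (intro sum_mono2) auto
    finally show ?thesis unfolding b_def using \<open>\<rho> > 1\<close> by (simp add: mult_left_mono)
  qed
  show ?thesis
  proof (rule intermittent_observableI[where h = h and F = F and c = "c\<^sup>2 * s * D\<^sup>2 * b"])
    fix n
    show "h n \<in> borel_measurable (PiM {..n} (\<lambda>_. borel))"
      unfolding h_def
    \<comment> \<open>The estimator is linear in the observations on each of the finitely many
      reception patterns.\<close>
    proof (rule measurable_compose_countable'[where I = "Pow {..n}" and g = "\<lambda>Y. {k\<in>{..n}. Y k \<noteq> 0}"])
      fix T assume "T \<in> Pow {..n}"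
      then show "(\<lambda>Y. \<Sum>t\<in>T. \<Phi> n T t *v Y t) \<in> borel_measurable (PiM {..n} (\<lambda>_. borel))"
        by (intro borel_measurable_sum borel_measurable_matrix_vector measurable_component_singleton) auto
    next
      show "(\<lambda>Y. {k\<in>{..n}. Y k \<noteq> (0 :: complex^'l)}) \<in> measurable (PiM {..n} (\<lambda>_. borel)) (count_space (Pow {..n}))"
        by (rule measurable_support_pattern[of n "\<lambda>k Y. Y k"]) (simp add: measurable_component_singleton)
    qed (simp add: countable_finite)
    show "integrable M (F n)" unfolding F_def using GZ(1) by (intro Bochner_Integration.integrable_sum) auto
    have "expectation (F n) = (\<Sum>k\<le>n + 1. c\<^sup>2 * (r ^ k)\<^sup>2 * expectation (\<lambda>\<omega>. G n k \<omega> * (Z n k \<omega>)\<^sup>2))"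
      unfolding F_def using GZ(1) by (subst Bochner_Integration.integral_sum) auto
    also have "\<dots> \<le> (\<Sum>k\<le>n + 1. c\<^sup>2 * s * D\<^sup>2 * (expectation (G n k) * \<rho> ^ k))"
    proof (rule sum_mono)
      fix k assume "k \<in> {..n + 1}"
      then have "c\<^sup>2 * (r ^ k)\<^sup>2 * expectation (\<lambda>\<omega>. G n k \<omega> * (Z n k \<omega>)\<^sup>2)
          \<le> c\<^sup>2 * (r ^ k)\<^sup>2 * (expectation (G n k) * (s * (real k + 1)\<^sup>2))"
        by (intro mult_left_mono GZ(2)) auto
      also have "\<dots> = c\<^sup>2 * s * expectation (G n k) * ((r ^ k)\<^sup>2 * (real k + 1)\<^sup>2)" by simp
      also have "\<dots> \<le> c\<^sup>2 * s * expectation (G n k) * (D\<^sup>2 * \<rho> ^ k)"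
        using \<open>s \<ge> 0\<close> by (intro mult_left_mono growth mult_nonneg_nonneg Bochner_Integration.integral_nonneg) (auto simp: G_def)
      finally show "c\<^sup>2 * (r ^ k)\<^sup>2 * expectation (\<lambda>\<omega>. G n k \<omega> * (Z n k \<omega>)\<^sup>2)
          \<le> c\<^sup>2 * s * D\<^sup>2 * (expectation (G n k) * \<rho> ^ k)" by (simp add: mult_ac)
    qed
    also have "\<dots> \<le> c\<^sup>2 * s * D\<^sup>2 * b"
      unfolding sum_distrib_left[symmetric] using \<open>s \<ge> 0\<close> by (intro mult_left_mono b) auto
    finally show "expectation (F n) \<le> c\<^sup>2 * s * D\<^sup>2 * b" .
    show "AE \<omega> in M. (norm (x n \<omega> - h n (\<lambda>i\<in>{..n}. y i \<omega>)))\<^sup>2 \<le> F n \<omega>"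
      using observation_support[OF assms(3)] AE_space
    proof eventually_elim
      case (elim \<omega>)
      define T where "T = S n \<omega>"
      have T: "T \<subseteq> {..n}" by (auto simp: T_def S_def)
      have "{k\<in>{..n}. (\<lambda>i\<in>{..n}. y i \<omega>) k \<noteq> 0} = T"
        using elim(1) by (auto simp: T_def S_def)
      then have "h n (\<lambda>i\<in>{..n}. y i \<omega>) = (\<Sum>t\<in>T. \<Phi> n T t *v (\<lambda>i\<in>{..n}. y i \<omega>) t)"
        by (simp add: h_def)
      also have "\<dots> = (\<Sum>t\<in>T. \<Phi> n T t *v (C *v x t \<omega> + v t \<omega>))"
        using elim(1) by (intro sum.cong) (auto simp: T_def S_def)
      finally have h: "h n (\<lambda>i\<in>{..n}. y i \<omega>) = (\<Sum>t\<in>T. \<Phi> n T t *v (C *v x t \<omega> + v t \<omega>))" .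
      define k where "k = \<kappa> n T"
      have k: "k \<le> n + 1" and bound: "\<forall>x w v. (\<forall>n. x (Suc n) = A *v x n + B *v w n) \<longrightarrow>
          norm (x n - (\<Sum>t\<in>T. \<Phi> n T t *v (C *v x t + v t)))
         \<le> c * r ^ k * (norm (x 0) + (\<Sum>j\<in>{n + 1 - k..n}. norm (w j) + norm (v j)))"
        using good[OF T] unfolding good_def k_def[symmetric] by blast+
      have "norm (x n \<omega> - h n (\<lambda>i\<in>{..n}. y i \<omega>)) \<le> c * r ^ k * Z n k \<omega>"
        unfolding h Z_def
        using bound[rule_format, of "\<lambda>t. x t \<omega>" "\<lambda>t. w t \<omega>" "\<lambda>t. v t \<omega>"] state[OF elim(2)] by blast
      then have "(norm (x n \<omega> - h n (\<lambda>i\<in>{..n}. y i \<omega>)))\<^sup>2 \<le> (c * r ^ k * Z n k \<omega>)\<^sup>2"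
        by (intro power_mono) auto
      \<comment> \<open>\<open>G\<close> is 1 at the window actually used, so the bound is one
        summand of \<open>F\<close>.\<close>
      also have "\<dots> = c\<^sup>2 * (r ^ k)\<^sup>2 * (G n k \<omega> * (Z n k \<omega>)\<^sup>2)"
        by (simp add: G_def k_def T_def power_mult_distrib)
      also have "\<dots> \<le> F n \<omega>"
        unfolding F_def using k
        by (intro member_le_sum[of k "{..n + 1}" "\<lambda>k. c\<^sup>2 * (r ^ k)\<^sup>2 * (G n k \<omega> * (Z n k \<omega>)\<^sup>2)"])
          (auto simp: G_def)
      finally show ?case .
    qed
  qed
qed

end

theorem corollary1:
  fixes M :: "'a measure"
    and A :: "complex^'m^'m" and B :: "complex^'g^'m" and C :: "complex^'m^'l"
    and \<sigma> \<sigma>' p\<^sub>e :: real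
    and x :: "nat \<Rightarrow> 'a \<Rightarrow> complex^'m" and w :: "nat \<Rightarrow> 'a \<Rightarrow> complex^'g"
    and v :: "nat \<Rightarrow> 'a \<Rightarrow> complex^'l" and \<beta> :: "nat \<Rightarrow> 'a \<Rightarrow> real"
    and y :: "nat \<Rightarrow> 'a \<Rightarrow> complex^'l"
    and z\<^sub>m\<^sub>a\<^sub>x :: complex
  assumes "intermittent_system M A B C \<sigma> \<sigma>' p\<^sub>e x w v \<beta> y"
    and "\<sigma>' > 0"
    and "controllable A B"
    and "observable A C"
    and "no_eigenvalue_cycles A"
    and "eigenvalue A z\<^sub>m\<^sub>a\<^sub>x"
    and "\<And>z. eigenvalue A z \<Longrightarrow> cmod z \<le> cmod z\<^sub>m\<^sub>a\<^sub>x"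
  shows "intermittent_observable M x y \<longleftrightarrow> ereal p\<^sub>e < 1 / ereal ((cmod z\<^sub>m\<^sub>a\<^sub>x)\<^sup>2)"
proof -
  interpret intermittent_system M A B C \<sigma> \<sigma>' p\<^sub>e x w v \<beta> y by fact
  \<comment> \<open>In \<open>ereal\<close> the quotient 1 / 0 is \<infinity>, as the convention
    asks; the product form covers this case too, where it reads 0 < 1.\<close>
  have iff: "ereal p\<^sub>e < 1 / ereal ((cmod z\<^sub>m\<^sub>a\<^sub>x)\<^sup>2) \<longleftrightarrow> p\<^sub>e * (cmod z\<^sub>m\<^sub>a\<^sub>x)\<^sup>2 < 1"
  proof (cases "z\<^sub>m\<^sub>a\<^sub>x = 0")
    case False
    then have "1 / ereal ((cmod z\<^sub>m\<^sub>a\<^sub>x)\<^sup>2) = ereal (1 / (cmod z\<^sub>m\<^sub>a\<^sub>x)\<^sup>2)"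
      by (simp add: one_ereal_def)
    then show ?thesis using False by (simp add: pos_less_divide_eq)
  qed (simp add: one_ereal_def)
  show ?thesis
    unfolding iff
  proof
    assume "intermittent_observable M x y"
    then show "p\<^sub>e * (cmod z\<^sub>m\<^sub>a\<^sub>x)\<^sup>2 < 1"
      using intermittent_observable_necessary assms(2,3,6) by blast
  next
    assume p: "p\<^sub>e * (cmod z\<^sub>m\<^sub>a\<^sub>x)\<^sup>2 < 1"
    show "intermittent_observable M x y"
    proof (cases "cmod z\<^sub>m\<^sub>a\<^sub>x < 1")
      case True
      then obtain r where r: "cmod z\<^sub>m\<^sub>a\<^sub>x < r" "r < 1" using dense by blast
      moreover have "0 < r" using r(1) norm_ge_zero[of z\<^sub>m\<^sub>a\<^sub>x] by linarith
      ultimately show ?thesis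
        using assms(7) by (intro stable_intermittent_observable[of r]) (auto intro: le_less_trans)
    next
      case False
      then show ?thesis
        using intermittent_observable_sufficient[OF assms(4,5,2,7) p] by auto
    qed
  qed
qed

end
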